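(* Let $L>0$, let $f$ be a nonnegative log-concave function defined on $[0,L]$, and let $2\le p<\infty$. Then $$\inf_{\substack{u\in W^{1,p}(0,L)\\ \int_0^L f|u|^{p-2}u\,dx=0}} \frac{\int_0^L f(x)|u'(x)|^p\,dx}{\int_0^L f(x)|u(x)|^p\,dx}\;\ge\;\min_{\substack{u\in W^{1,p}(0,L)\\ \int_0^L |u|^{p-2}u\,dx=0}} \frac{\int_0^L |u'(x)|^p\,dx}{\int_0^L |u(x)|^p\,dx}=\left(\frac{\pi_p}{L}\right)^p .$$
   Context: Here $$\pi_p=2\int_0^{(p-1)^{1/p}}\frac{dt}{\left(1-\frac{t^p}{p-1}\right)^{1/p}}=2\pi\,\frac{(p-1)^{1/p}}{p\,\sin(\pi/p)}.$$ Functions are real-valued, and $|u|^{p-2}u$ is understood to be $0$ where $u=0$. A nonnegative function $f$ is log-concave on $[0,L]$ if $f((1-s)x+sy)\ge f(x)^{1-s}f(y)^s$ for all $x,y\in[0,L]$, $s\in(0,1)$. In each infimum or minimum of a quotient, $u$ ranges over the indicated functions for which the denominator is nonzero (the infimum over the empty set being $+\infty$). *)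

theory Defs
  imports "HOL-Analysis.Analysis"
begin

definition pi_p :: "real \<Rightarrow> real" where
  "pi_p p = 2 * (LINT t:{0..(p - 1) powr (1 / p)}|lebesgue.
                   1 / (1 - t powr p / (p - 1)) powr (1 / p))"

(* Nonnegativity of f is not part of the definition. *)
definition log_concave_on :: "real set \<Rightarrow> (real \<Rightarrow> real) \<Rightarrow> bool" where
  "log_concave_on S f \<longleftrightarrow>
     (\<forall>x\<in>S. \<forall>y\<in>S. \<forall>s\<in>{0<..<1}.
        f ((1 - s) * x + s * y) \<ge> f x powr (1 - s) * f y powr s)"

(* Elements of L^p and W^{1,p} are represented by individual functions real => real whose
   values outside S are irrelevant; functions agreeing almost everywhere on S are not
   identified. *)
definition Lp_on :: "real \<Rightarrow> real set \<Rightarrow> (real \<Rightarrow> real) set" where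
  "Lp_on p S = {u. set_borel_measurable lebesgue S u \<and>
                   set_integrable lebesgue S (\<lambda>x. \<bar>u x\<bar> powr p)}"

definition test_function_on :: "real set \<Rightarrow> (real \<Rightarrow> real) \<Rightarrow> bool" where
  "test_function_on S \<phi> \<longleftrightarrow>
     (\<forall>n x. (deriv ^^ n) \<phi> differentiable at x) \<and>
     compact (closure {x. \<phi> x \<noteq> 0}) \<and> closure {x. \<phi> x \<noteq> 0} \<subseteq> S"

definition locally_integrable_on :: "real set \<Rightarrow> (real \<Rightarrow> real) \<Rightarrow> bool" where
  "locally_integrable_on S u \<longleftrightarrow>
     (\<forall>K. compact K \<and> K \<subseteq> S \<longrightarrow> set_integrable lebesgue K u)"

definition has_weak_deriv_on :: "real set \<Rightarrow> (real \<Rightarrow> real) \<Rightarrow> (real \<Rightarrow> real) \<Rightarrow> bool" where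
  "has_weak_deriv_on S u g \<longleftrightarrow>
     locally_integrable_on S u \<and> locally_integrable_on S g \<and>
     (\<forall>\<phi>. test_function_on S \<phi> \<longrightarrow>
        (LINT x:S|lebesgue. u x * deriv \<phi> x) = - (LINT x:S|lebesgue. g x * \<phi> x))"

definition sobolev_W1 :: "real \<Rightarrow> real set \<Rightarrow> (real \<Rightarrow> real) set" where
  "sobolev_W1 p S = {u \<in> Lp_on p S. \<exists>g\<in>Lp_on p S. has_weak_deriv_on S u g}"

(* On an open set the weak derivative is unique up to a null set, so the choice
   does not affect the integrals below. *)
definition weak_deriv_on :: "real set \<Rightarrow> (real \<Rightarrow> real) \<Rightarrow> (real \<Rightarrow> real)" where
  "weak_deriv_on S u = (SOME g. has_weak_deriv_on S u g)"

definition admissible :: "real \<Rightarrow> real \<Rightarrow> (real \<Rightarrow> real) \<Rightarrow> (real \<Rightarrow> real) set" where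
  "admissible p L f =
     {u \<in> sobolev_W1 p {0<..<L}.
        (LINT x:{0<..<L}|lebesgue. f x * (\<bar>u x\<bar> powr (p - 2) * u x)) = 0 \<and>
        (LINT x:{0<..<L}|lebesgue. f x * \<bar>u x\<bar> powr p) \<noteq> 0}"

definition rayleigh :: "real \<Rightarrow> real \<Rightarrow> (real \<Rightarrow> real) \<Rightarrow> (real \<Rightarrow> real) \<Rightarrow> real" where
  "rayleigh p L f u =
     (LINT x:{0<..<L}|lebesgue. f x * \<bar>weak_deriv_on {0<..<L} u x\<bar> powr p) /
     (LINT x:{0<..<L}|lebesgue. f x * \<bar>u x\<bar> powr p)"

end

theory Submission
  imports Defs "HOL-Computational_Algebra.Polynomial" "HOL-Real_Asymp.Real_Asymp"
begin

text \<open>Write \<open>\<lambda> = (pi_p / L)\<^sup>p\<close>.  The constraint \<open>\<integral> f |u|\<^sup>p\<^sup>-\<^sup>2 u = 0\<close> says that \<open>t = 0\<close> minimises the convex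
function \<open>t \<mapsto> \<integral> f |u - t|\<^sup>p\<close>.  It is therefore enough to find one point \<open>c\<close> with
\<open>\<lambda> \<integral> f |u - u(c)|\<^sup>p \<le> \<integral> f |u'|\<^sup>p\<close>, and for this the two halves \<open>(0, c)\<close> and \<open>(c, L)\<close>, on which
\<open>u - u(c)\<close> satisfies a Dirichlet condition at \<open>c\<close> and a natural condition at the other end, may
be treated separately.

On each half \<open>f\<close> is compared with an exponential.  For the weight \<open>exp (-b x)\<close> on an interval of
length \<open>l\<close>, the logarithmic derivative of the first eigenfunction solves an autonomous Riccati
equation.  Hence the mixed eigenvalue is at least \<open>\<kappa>\<^sup>p\<close> as soon as \<open>\<kappa> l\<close> is smaller than the
travel time \<open>T(a) = \<integral> ds / (1 + s\<^sup>p / (p - 1) + a s)\<close> over \<open>(0, \<infinity>)\<close>, where \<open>b = (p - 1) \<kappa> a\<close>.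
If \<open>f(x) exp (b x)\<close> increases up to \<open>c\<close> and decreases afterwards, then \<open>f\<close> is at least as good as
\<open>exp (-b x)\<close> on the left half, and the mirror image of \<open>f\<close> is at least as good as \<open>exp (b x)\<close> on the
right half.  What is needed is thus a pair \<open>(a, c)\<close> such that \<open>c\<close> is a mode of \<open>f(x) exp (b x)\<close> and
\<open>\<kappa> c < T(a)\<close>, \<open>\<kappa> (L - c) < T(-a)\<close>.

Pointwise \<open>1 / (A + x) + 1 / (A - x) \<ge> 2 / A\<close>, so \<open>T(a) + T(-a) \<ge> 2 T(0) = pi_p\<close>.  If
\<open>\<kappa> < pi_p / L\<close> this leaves room for a continuous curve \<open>a \<mapsto> c(a)\<close> running from \<open>L\<close> down to \<open>0\<close>
along which both length conditions hold (\<open>splitting_curve\<close>).  Log-concavity makes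
\<open>f(x) exp (b x)\<close> unimodal for every \<open>b\<close>, and a supremum argument shows that its mode meets \<open>c(a)\<close>
somewhere along the curve (\<open>tilted_mode_selection\<close>).  Letting \<open>\<kappa>\<close> tend to \<open>pi_p / L\<close> gives the lower
bound, for the weight \<open>f\<close> as well as for the weight \<open>1\<close>.

The comparison with the eigenfunctions is carried out by a Schur test (\<open>schur_test\<close>): \<open>|u(x) - u(c)|\<close>
is bounded by the integral of \<open>|u'|\<close> between \<open>x\<close> and \<open>c\<close>, and Hoelder's inequality against the
derivative of the eigenfunction followed by Tonelli's theorem gives the estimate.  The estimate
rests on the monotonicity of \<open>f(x) exp (b x)\<close> on each side of \<open>c\<close> and on the fact that \<open>u\<close> is a
primitive of its weak derivative, which follows from the lemma of du Bois-Reymond.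

For \<open>f = 1\<close> the value \<open>\<lambda>\<close> is attained by the generalised sine: if \<open>s\<close> is the solution of
\<open>s' = 1 + |s|\<^sup>p / (p - 1)\<close> on its maximal interval, rescaled to \<open>(0, L)\<close>, then
\<open>v = s / (1 + |s|\<^sup>p / (p - 1))\<^sup>1\<^sup>/\<^sup>p\<close> is an admissible minimiser (\<open>extremal_function\<close>).\<close>

section \<open>A Schur test for weighted integral operators\<close>

text \<open>The graph of \<open>s \<mapsto> s\<^sup>p\<close> lies above its tangent at \<open>r\<close>; written without subtraction, so that it
can be integrated in the extended nonnegative reals.\<close>

lemma young_tangent:
  fixes p r s :: real
  assumes "p > 1" "r \<ge> 0" "s \<ge> 0"
  shows "p * r powr (p - 1) * s \<le> s powr p + (p - 1) * r powr p"
proof -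
  have q: "p / (p - 1) > 1" using assms by (simp add: field_simps)
  have "s * r powr (p - 1) \<le> s powr p / p + (r powr (p - 1)) powr (p / (p - 1)) / (p / (p - 1))"
    by (rule Youngs_inequality) (use assms q in \<open>auto simp: field_simps\<close>)
  also have "(r powr (p - 1)) powr (p / (p - 1)) = r powr p"
    using assms by (simp add: powr_powr)
  finally show ?thesis using assms by (simp add: field_simps)
qed

lemma powr_minus_one_mult: "x \<ge> 0 \<Longrightarrow> x powr (p - 1) * x = x powr (p::real)"
  by (cases "x = 0") (auto simp: powr_diff)

text \<open>Hoelder's inequality \<open>(\<integral> g)\<^sup>p \<le> (\<integral> \<eta>)\<^sup>p\<^sup>-\<^sup>1 \<integral> g\<^sup>p \<eta>\<^sup>1\<^sup>-\<^sup>p\<close>, with an upper bound \<open>w\<close> in place of \<open>\<integral> \<eta>\<close>.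
It follows by integrating the tangent inequality for \<open>g / \<eta>\<close> at the point \<open>r = v / w\<close>.\<close>

lemma hoelder_bound:
  fixes g \<eta> :: "'a \<Rightarrow> real"
  assumes p: "p > 1"
    and m: "g \<in> borel_measurable M" "\<eta> \<in> borel_measurable M" "A \<in> sets M"
    and eta: "\<And>y. y \<in> A \<Longrightarrow> \<eta> y > 0" and g: "\<And>y. g y \<ge> 0"
    and w: "(\<integral>\<^sup>+y. indicator A y * ennreal (\<eta> y) \<partial>M) \<le> ennreal w" "w > 0"
    and v: "ennreal v \<le> (\<integral>\<^sup>+y. indicator A y * ennreal (g y) \<partial>M)" "v \<ge> 0"
  shows "ennreal (v powr p)
          \<le> ennreal (w powr (p - 1)) * (\<integral>\<^sup>+y. indicator A y * ennreal (g y powr p * \<eta> y powr (1 - p)) \<partial>M)"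
    (is "_ \<le> _ * ?J")
proof (cases "?J = \<infinity>")
  case True
  then show ?thesis using w by (simp add: ennreal_mult_top)
next
  case False
  note [measurable] = m
  then obtain J where J: "?J = ennreal J" "J \<ge> 0"
    by (cases ?J) (use False in auto)
  define r where "r = v / w"
  have r: "r \<ge> 0" using v w by (simp add: r_def)
  have pt: "p * r powr (p - 1) * g y \<le> g y powr p * \<eta> y powr (1 - p) + (p - 1) * r powr p * \<eta> y"
    if "y \<in> A" for y
  proof -
    have e: "\<eta> y > 0" using eta that by simp
    have "p * r powr (p - 1) * (g y / \<eta> y) \<le> (g y / \<eta> y) powr p + (p - 1) * r powr p"
      by (rule young_tangent) (use p r g e in auto)
    then have "\<eta> y * (p * r powr (p - 1) * (g y / \<eta> y)) \<le> \<eta> y * ((g y / \<eta> y) powr p + (p - 1) * r powr p)"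
      using e by (intro mult_left_mono) auto
    also have "\<eta> y * (g y / \<eta> y) powr p = g y powr p * \<eta> y powr (1 - p)"
      using e g by (simp add: powr_divide powr_diff)
    then have "\<eta> y * ((g y / \<eta> y) powr p + (p - 1) * r powr p) = g y powr p * \<eta> y powr (1 - p) + (p - 1) * r powr p * \<eta> y"
      by (simp add: algebra_simps)
    finally show ?thesis using e by (simp add: mult.commute)
  qed
  have "ennreal (p * r powr (p - 1) * v) = ennreal (p * r powr (p - 1)) * ennreal v"
    using p r v by (simp add: ennreal_mult)
  also have "\<dots> \<le> ennreal (p * r powr (p - 1)) * (\<integral>\<^sup>+y. indicator A y * ennreal (g y) \<partial>M)"
    by (intro mult_left_mono v) auto
  also have "\<dots> = (\<integral>\<^sup>+y. ennreal (p * r powr (p - 1)) * (indicator A y * ennreal (g y)) \<partial>M)"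
    by (rule nn_integral_cmult[symmetric]) measurable
  also have "\<dots> \<le> (\<integral>\<^sup>+y. indicator A y * ennreal (g y powr p * \<eta> y powr (1 - p))
                   + ennreal ((p - 1) * r powr p) * (indicator A y * ennreal (\<eta> y)) \<partial>M)"
  proof (intro nn_integral_mono)
    fix y
    show "ennreal (p * r powr (p - 1)) * (indicator A y * ennreal (g y)) \<le> indicator A y * ennreal (g y powr p * \<eta> y powr (1 - p))
                   + ennreal ((p - 1) * r powr p) * (indicator A y * ennreal (\<eta> y))"
      using pt[of y] eta[of y] g[of y] p r
      by (cases "y \<in> A") (auto simp: ennreal_mult[symmetric] ennreal_plus[symmetric] mult.assoc simp del: ennreal_plus intro!: ennreal_leI)
  qed
  also have "\<dots> = ?J + ennreal ((p - 1) * r powr p) * (\<integral>\<^sup>+y. indicator A y * ennreal (\<eta> y) \<partial>M)"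
    by (subst nn_integral_add) (auto simp: nn_integral_cmult)
  also have "\<dots> \<le> ennreal J + ennreal ((p - 1) * r powr p) * ennreal w"
    unfolding J by (intro add_mono mult_left_mono w) auto
  also have "\<dots> = ennreal (J + (p - 1) * r powr p * w)"
    using J p w by (simp add: ennreal_mult)
  finally have "p * r powr (p - 1) * v \<le> J + (p - 1) * r powr p * w"
    using J p w by (subst (asm) ennreal_le_iff) auto
  moreover have "r powr (p - 1) * v = v powr p / w powr (p - 1)"
    using v w by (simp add: r_def powr_divide powr_minus_one_mult)
  moreover have "r powr p * w = v powr p / w powr (p - 1)"
    using v w by (simp add: r_def powr_divide powr_diff)
  ultimately have "v powr p / w powr (p - 1) \<le> J"
    by (simp add: algebra_simps)
  then have "v powr p \<le> w powr (p - 1) * J"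
    using w by (simp add: field_simps)
  then show ?thesis using J w by (simp add: ennreal_mult[symmetric])
qed

text \<open>Hoelder's inequality with the test function \<open>\<eta>\<close> bounds \<open>|v(x)|\<^sup>p\<close> by
\<open>w(x)\<^sup>p\<^sup>-\<^sup>1 \<integral> K(x, y) |g(y)|\<^sup>p \<eta>(y)\<^sup>1\<^sup>-\<^sup>p dy\<close>.  After integration against \<open>F\<close> and an exchange of the
integrals, the second hypothesis on \<open>w\<close> and \<open>\<eta>\<close> controls the factor of \<open>|g(y)|\<^sup>p\<close>.  In the application
\<open>w\<close> is an eigenfunction and \<open>\<eta> = |w'|\<close>: the first hypothesis is the fundamental theorem of calculus,
the second one the integrated differential inequality \<open>(F \<eta>\<^sup>p\<^sup>-\<^sup>1)' \<ge> \<mu> F w\<^sup>p\<^sup>-\<^sup>1\<close>.\<close>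

lemma schur_test:
  fixes F g \<eta> w v :: "'a \<Rightarrow> real"
  assumes sf: "sigma_finite_measure M" and p: "p > 1" and \<mu>: "\<mu> \<ge> 0"
    and m: "F \<in> borel_measurable M" "g \<in> borel_measurable M" "\<eta> \<in> borel_measurable M"
      "w \<in> borel_measurable M"
    and K: "K \<in> sets (M \<Otimes>\<^sub>M M)" "K \<subseteq> S \<times> S"
    and F: "\<And>x. F x \<ge> 0" "\<And>x. x \<notin> S \<Longrightarrow> F x = 0"
    and eta: "\<And>y. y \<in> S \<Longrightarrow> \<eta> y > 0" and w: "\<And>y. y \<in> S \<Longrightarrow> w y > 0"
    and h1: "\<And>x. x \<in> S \<Longrightarrow> (\<integral>\<^sup>+y. indicator K (x, y) * ennreal (\<eta> y) \<partial>M) \<le> ennreal (w x)"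
    and h2: "\<And>y. y \<in> S \<Longrightarrow> ennreal \<mu> * (\<integral>\<^sup>+x. indicator K (x, y) * ennreal (F x * w x powr (p - 1)) \<partial>M)
                \<le> ennreal (F y * \<eta> y powr (p - 1))"
    and v: "\<And>x. x \<in> S \<Longrightarrow> ennreal \<bar>v x\<bar> \<le> (\<integral>\<^sup>+y. indicator K (x, y) * ennreal \<bar>g y\<bar> \<partial>M)"
  shows "ennreal \<mu> * (\<integral>\<^sup>+x. ennreal (F x * \<bar>v x\<bar> powr p) \<partial>M) \<le> (\<integral>\<^sup>+y. ennreal (F y * \<bar>g y\<bar> powr p) \<partial>M)"
proof -
  interpret sigma_finite_measure M by (rule sf)
  interpret pair_sigma_finite M M by standard
  note [measurable] = m K(1)
  let ?h = "\<lambda>y. \<bar>g y\<bar> powr p * \<eta> y powr (1 - p)"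
  let ?c = "\<lambda>y. \<integral>\<^sup>+x. indicator K (x, y) * ennreal (F x * w x powr (p - 1)) \<partial>M"
  have sec: "{y. (x, y) \<in> K} \<in> sets M" for x
    using sets_Pair1[OF K(1), of x] by (simp add: vimage_def)
  have pt: "ennreal (F x * \<bar>v x\<bar> powr p) \<le> (\<integral>\<^sup>+y. ennreal (F x * w x powr (p - 1)) * indicator K (x, y) * ennreal (?h y) \<partial>M)" for x
  proof (cases "x \<in> S")
    case True
    let ?A = "{y. (x, y) \<in> K}"
    have ind: "indicator ?A y = (indicator K (x, y) :: ennreal)" for y
      by (simp add: indicator_def)
    have "ennreal (\<bar>v x\<bar> powr p) \<le> ennreal (w x powr (p - 1)) * (\<integral>\<^sup>+y. indicator ?A y * ennreal (?h y) \<partial>M)"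
      by (rule hoelder_bound) (use sec K eta w[OF True] v[OF True] h1[OF True] p in \<open>auto simp: ind\<close>)
    then have "ennreal (F x) * ennreal (\<bar>v x\<bar> powr p) \<le> ennreal (F x) * (ennreal (w x powr (p - 1)) * (\<integral>\<^sup>+y. indicator ?A y * ennreal (?h y) \<partial>M))"
      by (rule mult_left_mono) auto
    also have "\<dots> = (\<integral>\<^sup>+y. ennreal (F x * w x powr (p - 1)) * indicator K (x, y) * ennreal (?h y) \<partial>M)"
    proof -
      have [measurable]: "?A \<in> sets M" by (rule sec)
      have "(\<integral>\<^sup>+y. ennreal (F x * w x powr (p - 1)) * (indicator ?A y * ennreal (?h y)) \<partial>M)
          = ennreal (F x * w x powr (p - 1)) * (\<integral>\<^sup>+y. indicator ?A y * ennreal (?h y) \<partial>M)"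
        by (rule nn_integral_cmult) measurable
      then show ?thesis using F(1) by (simp only: ind ennreal_mult mult.assoc powr_ge_zero)
    qed
    finally show ?thesis using F(1) by (simp add: ennreal_mult)
  qed (use F in auto)
  have "ennreal \<mu> * (\<integral>\<^sup>+x. ennreal (F x * \<bar>v x\<bar> powr p) \<partial>M)
     \<le> ennreal \<mu> * (\<integral>\<^sup>+x. (\<integral>\<^sup>+y. ennreal (F x * w x powr (p - 1)) * indicator K (x, y) * ennreal (?h y) \<partial>M) \<partial>M)"
    by (intro mult_left_mono nn_integral_mono pt) auto
  also have "\<dots> = ennreal \<mu> * (\<integral>\<^sup>+y. (\<integral>\<^sup>+x. ennreal (F x * w x powr (p - 1)) * indicator K (x, y) * ennreal (?h y) \<partial>M) \<partial>M)"
    by (subst Fubini') (auto)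
  also have "\<dots> = (\<integral>\<^sup>+y. ennreal \<mu> * (\<integral>\<^sup>+x. ennreal (?h y) * (indicator K (x, y) * ennreal (F x * w x powr (p - 1))) \<partial>M) \<partial>M)"
    by (subst nn_integral_cmult) (auto simp: mult_ac)
  also have "\<dots> = (\<integral>\<^sup>+y. ennreal (?h y) * (ennreal \<mu> * ?c y) \<partial>M)"
    by (intro nn_integral_cong, subst nn_integral_cmult) (auto simp: mult_ac)
  also have "\<dots> \<le> (\<integral>\<^sup>+y. ennreal (F y * \<bar>g y\<bar> powr p) \<partial>M)"
  proof (intro nn_integral_mono)
    fix y
    show "ennreal (?h y) * (ennreal \<mu> * ?c y) \<le> ennreal (F y * \<bar>g y\<bar> powr p)"
    proof (cases "y \<in> S")
      case True
      have "ennreal (?h y) * (ennreal \<mu> * ?c y)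
         \<le> ennreal (?h y) * ennreal (F y * \<eta> y powr (p - 1))"
        by (intro mult_left_mono h2 True) auto
      also have "\<dots> = ennreal (?h y * (F y * \<eta> y powr (p - 1)))"
        using F(1) by (intro ennreal_mult[symmetric]) auto
      also have "?h y * (F y * \<eta> y powr (p - 1)) = F y * \<bar>g y\<bar> powr p"
        using eta[OF True] by (simp add: powr_diff field_simps)
      finally show ?thesis .
    next
      case False
      then have "indicator K (x, y) = (0::ennreal)" for x using K by (auto simp: indicator_def)
      then show ?thesis by simp
    qed
  qed
  finally show ?thesis .
qed

section \<open>Log-concave functions on an interval\<close>

lemma log_concave_on_mult_exp:
  assumes "log_concave_on S f" "\<And>x. x \<in> S \<Longrightarrow> f x \<ge> 0"
  shows "log_concave_on S (\<lambda>x. f x * exp (b * x))"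
  unfolding log_concave_on_def
proof (intro ballI)
  fix x y s assume xys: "x \<in> S" "y \<in> S" "s \<in> {0<..<1::real}"
  have "(f x * exp (b * x)) powr (1 - s) * (f y * exp (b * y)) powr s
      = (f x powr (1 - s) * f y powr s) * exp (b * ((1 - s) * x + s * y))"
    using assms(2) xys by (simp add: powr_mult powr_def[of "exp _"] exp_add[symmetric] algebra_simps)
  also have "\<dots> \<le> f ((1 - s) * x + s * y) * exp (b * ((1 - s) * x + s * y))"
    using assms(1) xys by (intro mult_right_mono) (auto simp: log_concave_on_def)
  finally show "(f x * exp (b * x)) powr (1 - s) * (f y * exp (b * y)) powr s
     \<le> f ((1 - s) * x + s * y) * exp (b * ((1 - s) * x + s * y))" .
qed

lemma log_concave_on_between:
  assumes "log_concave_on S f" "x \<in> S" "z \<in> S" "x < y" "y < z"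
  shows "f x powr ((z - y) / (z - x)) * f z powr ((y - x) / (z - x)) \<le> f y"
proof -
  let ?s = "(y - x) / (z - x)"
  have s: "?s \<in> {0<..<1}" using assms by auto
  have "1 - ?s = (z - y) / (z - x)" using assms by (simp add: field_simps)
  moreover have "(1 - t) * x + t * z = x + t * (z - x)" for t by (simp add: algebra_simps)
  from this[of ?s] have "(1 - ?s) * x + ?s * z = y" using assms by simp
  ultimately show ?thesis
    using assms s unfolding log_concave_on_def by metis
qed

text \<open>The value at \<open>y\<close> is at least a weighted geometric mean of the values at \<open>x\<close> and \<open>z\<close>, hence at least
the smaller one; as it is below the value at \<open>x\<close>, it cannot be below the value at \<open>z\<close>.\<close>

lemma log_concave_on_descent:
  assumes lc: "log_concave_on {a..b} f" and nn: "\<And>x. x \<in> {a..b} \<Longrightarrow> f x \<ge> 0"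
    and "a \<le> x" "x < y" "y < z" "z \<le> b" "f y < f x"
  shows "f z \<le> f y" "f z < f x"
proof -
  let ?s = "(y - x) / (z - x)"
  have s: "0 < ?s" "?s < 1" using assms by auto
  have eq: "(z - y) / (z - x) = 1 - ?s" using assms by (simp add: field_simps)
  have le: "f x powr (1 - ?s) * f z powr ?s \<le> f y"
    using log_concave_on_between[OF lc, of x z y] assms eq by auto
  have fy: "f y \<ge> 0" "f z \<ge> 0" using assms by auto
  have "f z \<le> f y"
  proof (rule ccontr)
    assume "\<not> f z \<le> f y"
    then have gt: "f z > f y" by simp
    have "f y = f y powr (1 - ?s) * f y powr ?s"
      using fy by (cases "f y = 0") (auto simp flip: powr_add)
    also have "\<dots> < f x powr (1 - ?s) * f z powr ?s"
      by (intro mult_strict_mono' powr_less_mono2) (use gt assms s fy in auto)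
    finally show False using le by simp
  qed
  then show "f z \<le> f y" "f z < f x" using assms by auto
qed

lemma log_concave_on_unimodal:
  assumes lc: "log_concave_on {a..b} f" and nn: "\<And>x. x \<in> {a..b} \<Longrightarrow> f x \<ge> 0"
    and "a \<le> x" "x < y" "y \<le> u" "u \<le> v" "v \<le> b" "f y < f x"
  shows "f v \<le> f u"
proof -
  consider "v = u" | "u = y" "u < v" | "y < u" "u < v" using assms by linarith
  then show ?thesis
  proof cases
    case 2 then show ?thesis using log_concave_on_descent(1)[OF lc nn, of x y v] assms by auto
  next
    case 3
    then have "f u < f x" using log_concave_on_descent(2)[OF lc nn, of x y u] assms by auto
    then show ?thesis using log_concave_on_descent(1)[OF lc nn, of x u v] assms 3 by auto
  qed auto
qed

text \<open>Take the supremum of those \<open>r\<close> for which the tilted function increases on \<open>(0, c(r))\<close>.  This property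
passes to limits, so it holds at the supremum.  Beyond the supremum the tilted function has a descent
before \<open>c(r)\<close>, and by log-concavity it decreases from there on, in particular on \<open>(c(r), L)\<close>; this
passes to the limit as well.\<close>

lemma tilted_mode_selection:
  fixes b c :: "real \<Rightarrow> real"
  assumes lc: "log_concave_on {0..L} f" and nn: "\<And>x. x \<in> {0..L} \<Longrightarrow> f x \<ge> 0"
    and cont: "continuous_on {lo..hi} b" "continuous_on {lo..hi} c"
    and r: "lo \<le> hi" and ends: "c lo = 0" "c hi = L" and c: "\<And>r. r \<in> {lo..hi} \<Longrightarrow> c r \<in> {0..L}"
  obtains r where "r \<in> {lo..hi}"
    "\<And>x y. 0 < x \<Longrightarrow> x \<le> y \<Longrightarrow> y < c r \<Longrightarrow> f x * exp (b r * x) \<le> f y * exp (b r * y)"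
    "\<And>x y. c r < x \<Longrightarrow> x \<le> y \<Longrightarrow> y < L \<Longrightarrow> f y * exp (b r * y) \<le> f x * exp (b r * x)"
proof -
  define G where "G = {r \<in> {lo..hi}. \<forall>x y. 0 < x \<longrightarrow> x \<le> y \<longrightarrow> y < c r \<longrightarrow> f x * exp (b r * x) \<le> f y * exp (b r * y)}"
  have "lo \<in> G" using r ends by (auto simp: G_def)
  have bdd: "bdd_above G" by (rule bdd_aboveI[of _ hi]) (auto simp: G_def)
  define R where "R = Sup G"
  have R: "R \<in> {lo..hi}"
    using \<open>lo \<in> G\<close> bdd unfolding R_def
    by (auto intro!: cSup_upper cSup_least simp: G_def)
  have lim: "((\<lambda>r. f x * exp (b r * x)) \<longlongrightarrow> f x * exp (b R * x)) (at R within {lo..hi})" 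
    and limc: "(c \<longlongrightarrow> c R) (at R within {lo..hi})" for x
    using cont R by (auto simp: continuous_on_def intro!: tendsto_intros)
  have left: "f x * exp (b R * x) \<le> f y * exp (b R * y)" if xy: "0 < x" "x \<le> y" "y < c R" for x y
  proof (rule ccontr)
    assume n: "\<not> ?thesis"
    have "\<forall>\<^sub>F r in at R within {lo..hi}. f y * exp (b r * y) < f x * exp (b r * x)"
      using tendsto_diff[OF lim[of x] lim[of y]] n
      by (auto dest!: order_tendstoD(1)[where a = 0] elim!: eventually_mono)
    moreover have "\<forall>\<^sub>F r in at R within {lo..hi}. y < c r"
      using limc xy by (auto dest!: order_tendstoD(1))
    ultimately have "\<forall>\<^sub>F r in at R within {lo..hi}. r \<notin> G"
      by eventually_elim (use xy in \<open>auto simp: G_def not_le\<close>)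
    then obtain d where d: "d > 0" "\<And>r. r \<in> {lo..hi} \<Longrightarrow> r \<noteq> R \<Longrightarrow> dist r R < d \<Longrightarrow> r \<notin> G"
      by (auto simp: eventually_at)
    have RG: "R \<notin> G" using xy n by (auto simp: G_def)
    obtain r where "r \<in> G" "R - d < r"
      using less_cSupE[of "R - d" G] \<open>lo \<in> G\<close> d by (auto simp: R_def)
    moreover have "r \<le> R" using \<open>r \<in> G\<close> bdd by (auto simp: R_def intro: cSup_upper)
    moreover have "r \<noteq> R" using RG \<open>r \<in> G\<close> by auto
    ultimately show False using d(2)[of r] by (auto simp: G_def dist_real_def)
  qed
  have right: "f y * exp (b R * y) \<le> f x * exp (b R * x)" if xy: "c R < x" "x \<le> y" "y < L" for x y
  proof (rule ccontr)
    assume n: "\<not> ?thesis"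
    have "R \<noteq> hi" using xy ends by auto
    then have "R < hi" using R by auto
    have "\<forall>\<^sub>F r in at R within {lo..hi}. f x * exp (b r * x) < f y * exp (b r * y)"
      using tendsto_diff[OF lim[of y] lim[of x]] n
      by (auto dest!: order_tendstoD(1)[where a = 0] elim!: eventually_mono)
    moreover have "\<forall>\<^sub>F r in at R within {lo..hi}. c r < x"
      using limc xy by (auto dest!: order_tendstoD(2))
    ultimately have "\<forall>\<^sub>F r in at R within {lo..hi}. f x * exp (b r * x) < f y * exp (b r * y) \<and> c r < x"
      by eventually_elim auto
    then obtain d where d: "d > 0" "\<And>r. r \<in> {lo..hi} \<Longrightarrow> r \<noteq> R \<Longrightarrow> dist r R < d \<Longrightarrow> 
        f x * exp (b r * x) < f y * exp (b r * y) \<and> c r < x"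
      by (auto simp: eventually_at)
    \<comment> \<open>A parameter slightly beyond the supremum.\<close>
    define r where "r = min hi (R + d / 2)"
    have rr: "r \<in> {lo..hi}" "r \<noteq> R" "dist r R < d" "r > R"
      using R \<open>R < hi\<close> d(1) by (auto simp: r_def dist_real_def)
    then have "r \<notin> G" using bdd cSup_upper[of r G] by (auto simp: R_def)
    then obtain s t where st: "0 < s" "s \<le> t" "t < c r" "f t * exp (b r * t) < f s * exp (b r * s)"
      using rr by (auto simp: G_def not_le)
    then have "s < t" by (cases "s = t") auto
    have "f y * exp (b r * y) \<le> f x * exp (b r * x)"
      using log_concave_on_unimodal[OF log_concave_on_mult_exp[OF lc nn, of "b r"], of s t x y]
        nn st \<open>s < t\<close> d(2)[of r] rr xy by auto
    then show False using d(2)[of r] rr by auto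
  qed
  show ?thesis by (rule that[OF R left right])
qed

text \<open>If \<open>f\<close> is positive at three points \<open>x1 < x2 < x3\<close>, then a large value to the left of \<open>x2\<close> would, by
log-concavity between it and \<open>x3\<close>, force a large value at \<open>x2\<close>, and symmetrically on the right.
Otherwise \<open>f\<close> is positive at one point at most.\<close>

lemma log_concave_bounded:
  assumes lc: "log_concave_on {0..L} f" and nn: "\<And>x. x \<in> {0..L} \<Longrightarrow> f x \<ge> 0"
  obtains B where "B \<ge> 0" "\<And>x. x \<in> {0..L} \<Longrightarrow> f x \<le> B"
proof (cases "\<exists>x y. 0 \<le> x \<and> x < y \<and> y \<le> L \<and> f x > 0 \<and> f y > 0")
  case False
  then have one: "x = y" if "x \<in> {0..L}" "y \<in> {0..L}" "f x > 0" "f y > 0" for x y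
    using that by (cases x y rule: linorder_cases) auto
  show ?thesis
  proof (cases "\<exists>z\<in>{0..L}. f z > 0")
    case True
    then obtain z where z: "z \<in> {0..L}" "f z > 0" by auto
    show ?thesis
    proof (rule that[of "f z"])
      show "f x \<le> f z" if "x \<in> {0..L}" for x
        using one[of x z] z that by (cases "f x > 0") auto
    qed (use z in auto)
  next
    case False
    then show ?thesis by (intro that[of 0]) (auto simp: not_less)
  qed
next
  case True
  then obtain x1 x3 where x: "0 \<le> x1" "x1 < x3" "x3 \<le> L" "f x1 > 0" "f x3 > 0" by auto
  define x2 where "x2 = (x1 + x3) / 2"
  have x2: "x1 < x2" "x2 < x3" using x by (auto simp: x2_def)
  \<comment> \<open>The exponent of \<open>f x\<close> is at least \<open>e\<close>, uniformly in \<open>x\<close>.\<close>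
  have aux: "f x \<le> max 1 ((f x2 / min 1 m) powr (1 / e))"
    if h: "f x powr (1 - s) * f z powr s \<le> f x2" "0 \<le> s" "s \<le> 1 - e" "0 < e" "m = f z" "f z > 0" for x s z e m
  proof (cases "f x \<le> 1")
    case False
    have m: "0 < min 1 m" using h by auto
    have e: "s \<le> 1" using h by auto
    have "min 1 m \<le> f z powr s"
    proof (cases "f z \<le> 1")
      case True
      have "f z powr 1 \<le> f z powr s" using True h by (intro powr_mono') auto
      then show ?thesis using h by auto
    next
      case False
      then show ?thesis using h by (simp add: ge_one_powr_ge_zero)
    qed
    moreover have "f x powr e \<le> f x powr (1 - s)" using False h by (intro powr_mono) auto
    ultimately have "f x powr e * min 1 m \<le> f x powr (1 - s) * f z powr s"
      using m by (intro mult_mono) auto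
    then have "f x powr e \<le> f x2 / min 1 m" using h m by (simp add: pos_le_divide_eq)
    then have "(f x powr e) powr (1 / e) \<le> (f x2 / min 1 m) powr (1 / e)"
      using h by (intro powr_mono2) auto
    then show ?thesis using False h by (simp add: powr_powr)
  qed auto
  define e where "e = (x2 - x1) / (L + 1)"
  have L: "L > 0" using x by auto
  have e: "e > 0" using x2 L by (simp add: e_def)
  define B where "B = max (f x2) (max (max 1 ((f x2 / min 1 (f x1)) powr (1 / e))) (max 1 ((f x2 / min 1 (f x3)) powr (1 / e))))"
  show ?thesis
  proof (rule that[of B])
    fix x assume xL: "x \<in> {0..L}"
    consider "x = x2" | "x < x2" | "x2 < x" by linarith
    then show "f x \<le> B"
    proof cases
      case 2
      have d: "(x3 - x2) / (x3 - x) \<ge> e" unfolding e_def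
        by (rule frac_le) (use x x2 xL L 2 in \<open>auto simp: x2_def field_simps\<close>)
      have "f x powr (1 - (x2 - x) / (x3 - x)) * f x3 powr ((x2 - x) / (x3 - x)) \<le> f x2"
        using log_concave_on_between[OF lc, of x x3 x2] x xL 2 x2 by (simp add: field_simps)
      then have "f x \<le> max 1 ((f x2 / min 1 (f x3)) powr (1 / e))"
        by (rule aux[where e = e]) (use x x2 2 e d in \<open>auto simp: field_simps\<close>)
      then show ?thesis by (simp add: B_def le_max_iff_disj)
    next
      case 3
      have d: "(x2 - x1) / (x - x1) \<ge> e" unfolding e_def
        by (rule frac_le) (use x x2 xL L 3 in \<open>auto simp: x2_def field_simps\<close>)
      have "f x powr (1 - (x - x2) / (x - x1)) * f x1 powr ((x - x2) / (x - x1)) \<le> f x2"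
        using log_concave_on_between[OF lc, of x1 x x2] x xL 3 x2 by (simp add: field_simps mult.commute)
      then have "f x \<le> max 1 ((f x2 / min 1 (f x1)) powr (1 / e))"
        by (rule aux[where e = e]) (use x x2 3 e d in \<open>auto simp: field_simps\<close>)
      then show ?thesis by (simp add: B_def le_max_iff_disj)
    qed (simp add: B_def)
  qed (simp add: B_def le_max_iff_disj)
qed

section \<open>Mixed boundary value problems with exponential weights\<close>

text \<open>Let \<open>w\<close> be the decreasing solution of \<open>(e\<^sup>-\<^sup>b\<^sup>x |w'|\<^sup>p\<^sup>-\<^sup>2 w')' + \<kappa>\<^sup>p e\<^sup>-\<^sup>b\<^sup>x w\<^sup>p\<^sup>-\<^sup>1 = 0\<close>.  The variable
\<open>\<sigma> = \<kappa> w / |w'|\<close> runs from infinity (natural condition) to zero (Dirichlet condition), and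
\<open>- \<sigma>' = \<kappa> riccati_rate p a \<sigma>\<close> if \<open>b = (p - 1) \<kappa> a\<close>.\<close>

definition riccati_rate :: "real \<Rightarrow> real \<Rightarrow> real \<Rightarrow> real" where
  "riccati_rate p a s = 1 + s powr p / (p - 1) + a * s"

text \<open>Solves the autonomous equation \<open>S' = \<phi>(S)\<close> by separation of variables.\<close>

lemma inverse_primitive:
  fixes \<phi> :: "real \<Rightarrow> real"
  assumes "continuous_on {0..M} \<phi>" "\<And>s. s \<in> {0..M} \<Longrightarrow> \<phi> s > 0" "M > 0"
  obtains S where "\<And>y. y \<in> {0<..<integral {0..M} (\<lambda>s. 1 / \<phi> s)} \<Longrightarrow> S y \<in> {0<..<M}"
    "\<And>y. y \<in> {0<..<integral {0..M} (\<lambda>s. 1 / \<phi> s)} \<Longrightarrow> (S has_real_derivative \<phi> (S y)) (at y)"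
proof -
  define R where "R = (\<lambda>x. integral {0..x} (\<lambda>s. 1 / \<phi> s))"
  have cont: "continuous_on {0..M} (\<lambda>s. 1 / \<phi> s)"
    using assms by (intro continuous_intros) force+
  have DR: "(R has_real_derivative 1 / \<phi> x) (at x within {0..M})" if "x \<in> {0..M}" for x
    unfolding R_def by (rule integral_has_real_derivative[OF cont that])
  have DR': "(R has_real_derivative 1 / \<phi> x) (at x)" if "x \<in> {0<..<M}" for x
    using DR[of x] that at_within_interior[of x "{0..M}"] by auto
  have contR: "continuous_on {0..M} R"
    using DERIV_continuous[OF DR] by (auto simp: continuous_on_eq_continuous_within)
  have mono: "R x < R y" if "0 \<le> x" "x < y" "y \<le> M" for x y
  proof (rule DERIV_pos_imp_increasing_open[OF that(2)])
    show "\<exists>d. (R has_real_derivative d) (at z) \<and> 0 < d" if "x < z" "z < y" for z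
      using DR'[of z] assms(2)[of z] that \<open>0 \<le> x\<close> \<open>y \<le> M\<close> by (intro exI[of _ "1 / \<phi> z"]) auto
    show "continuous_on {x..y} R" using contR that by (auto intro: continuous_on_subset)
  qed
  have inj: "inj_on R {0..M}"
  proof (rule linorder_inj_onI)
    show "R x \<noteq> R y" if "x < y" "x \<in> {0..M}" "y \<in> {0..M}" for x y
      using mono[of x y] that by auto
  qed auto
  define S where "S = the_inv_into {0..M} R"
  have SR: "S (R x) = x" if "x \<in> {0..M}" for x
    unfolding S_def by (rule the_inv_into_f_f[OF inj that])
  have R0: "R 0 = 0" by (simp add: R_def)
  have ex: "\<exists>x\<in>{0<..<M}. R x = y" if "y \<in> {0<..<R M}" for y
  proof -
    have "R 0 \<le> y" "y \<le> R M" using that R0 by auto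
    then obtain x where "0 \<le> x" "x \<le> M" "R x = y"
      using IVT'[of R 0 y M] assms(3) contR by auto
    moreover have "x \<noteq> 0" "x \<noteq> M" using that calculation R0 by auto
    ultimately show ?thesis by auto
  qed
  have RM: "integral {0..M} (\<lambda>s. 1 / \<phi> s) = R M" by (simp add: R_def)
  show ?thesis
  proof (rule that[of S], unfold RM)
    fix y assume y: "y \<in> {0<..<R M}"
    then obtain x where x: "x \<in> {0<..<M}" "R x = y" using ex by blast
    then have Sy: "S y = x" using SR by auto
    then show "S y \<in> {0<..<M}" using x by simp
    have "(S has_real_derivative inverse (1 / \<phi> x)) (at (R x))"
    proof (rule has_derivative_inverse_strong[of "{0<..<M}" x R S "(*) (1 / \<phi> x)" "(*) (inverse (1 / \<phi> x))", folded has_field_derivative_def])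
      show "(R has_real_derivative 1 / \<phi> x) (at x)" using DR' x by blast
      show "continuous_on {0<..<M} R" using contR by (rule continuous_on_subset) auto
      show "(*) (1 / \<phi> x) \<circ> (*) (inverse (1 / \<phi> x)) = id"
        using assms(2)[of x] x by (auto simp: fun_eq_iff)
    qed (use x SR in auto)
    then show "(S has_real_derivative \<phi> (S y)) (at y)" using x Sy by simp
  qed
qed

text \<open>If the rate is nonpositive somewhere, a constant is a supersolution for all times.  Otherwise the
equation is solved backwards from a value below \<open>M\<close>; since the travel time between \<open>0\<close> and \<open>M\<close>
exceeds \<open>\<kappa> l\<close>, the solution stays positive on the whole interval.\<close>

lemma supersolution_ex:
  fixes p a \<kappa> l M :: real
  assumes p: "p > 1" and \<kappa>: "\<kappa> > 0" and M: "M > 0"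
    and h: "(\<exists>s>0. riccati_rate p a s \<le> 0) \<or> (\<forall>s\<in>{0..M}. riccati_rate p a s > 0) \<and> \<kappa> * l < integral {0..M} (\<lambda>s. 1 / riccati_rate p a s)"
  obtains \<sigma> \<sigma>' where "\<And>x. x \<in> {0..l} \<Longrightarrow> \<sigma> x > 0" 
    "\<And>x. x \<in> {0..l} \<Longrightarrow> (\<sigma> has_real_derivative \<sigma>' x) (at x)"
    "\<And>x. x \<in> {0..l} \<Longrightarrow> - \<sigma>' x \<ge> \<kappa> * riccati_rate p a (\<sigma> x)"
proof (cases "\<exists>s>0. riccati_rate p a s \<le> 0")
  case True
  then obtain s where "s > 0" "riccati_rate p a s \<le> 0" by auto
  then show ?thesis using \<kappa> by (intro that[of "\<lambda>_. s" "\<lambda>_. 0"]) (auto simp: mult_le_0_iff)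
next
  case False
  define T where "T = integral {0..M} (\<lambda>s. 1 / riccati_rate p a s)"
  have pos: "\<And>s. s \<in> {0..M} \<Longrightarrow> riccati_rate p a s > 0" and lt: "\<kappa> * l < T" using h False by (auto simp: T_def)
  have "continuous_on {0..M} (riccati_rate p a)"
    unfolding riccati_rate_def using p by (intro continuous_intros continuous_on_powr') auto
  then obtain S where S: "\<And>y. y \<in> {0<..<T} \<Longrightarrow> S y \<in> {0<..<M}"
    "\<And>y. y \<in> {0<..<T} \<Longrightarrow> (S has_real_derivative riccati_rate p a (S y)) (at y)"
    using inverse_primitive[of M "riccati_rate p a", OF _ pos M] unfolding T_def by blast
  \<comment> \<open>Starting strictly between \<open>\<kappa> l\<close> and \<open>T\<close> keeps the solution in the open range of the inverse.\<close>
  define t where "t = (\<kappa> * l + T) / 2"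
  have range: "t - \<kappa> * x \<in> {0<..<T}" if "x \<in> {0..l}" for x
  proof -
    have "0 \<le> \<kappa> * x" "\<kappa> * x \<le> \<kappa> * l" using that \<kappa> by auto
    moreover have "t < T" "\<kappa> * l < t" using lt by (auto simp: t_def field_simps)
    ultimately show ?thesis by auto
  qed
  show ?thesis
  proof (rule that[of "\<lambda>x. S (t - \<kappa> * x)" "\<lambda>x. riccati_rate p a (S (t - \<kappa> * x)) * (- \<kappa>)"])
    fix x assume x: "x \<in> {0..l}"
    show "0 < S (t - \<kappa> * x)" using S(1)[OF range[OF x]] by auto
    show "((\<lambda>x. S (t - \<kappa> * x)) has_real_derivative riccati_rate p a (S (t - \<kappa> * x)) * - \<kappa>) (at x)"
      by (rule DERIV_chain2[where f = S and g = "\<lambda>x. t - \<kappa> * x", OF S(2)[OF range[OF x]]]) (auto intro!: derivative_eq_intros)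
  qed (auto simp: mult.commute)
qed

text \<open>Undoes the passage to the Riccati variable: \<open>w = exp (- \<integral> \<kappa> / \<sigma>)\<close> and \<open>\<eta> = - w'\<close>.  The logarithmic
derivative of \<open>e\<^sup>-\<^sup>b\<^sup>x \<eta>\<^sup>p\<^sup>-\<^sup>1\<close> is \<open>- b - (p - 1) (\<kappa> / \<sigma> + \<sigma>' / \<sigma>)\<close>, which the differential inequality bounds
below by \<open>\<kappa> \<sigma>\<^sup>p\<^sup>-\<^sup>1\<close>, and \<open>\<eta>\<^sup>p\<^sup>-\<^sup>1 \<kappa> \<sigma>\<^sup>p\<^sup>-\<^sup>1 = \<kappa>\<^sup>p w\<^sup>p\<^sup>-\<^sup>1\<close>.\<close>

lemma eigenfunction_from_supersolution:
  fixes p a \<kappa> l :: real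
  assumes p: "p > 1" and \<kappa>: "\<kappa> > 0"
    and \<sigma>: "\<And>x. x \<in> {0..l} \<Longrightarrow> \<sigma> x > 0" 
    "\<And>x. x \<in> {0..l} \<Longrightarrow> (\<sigma> has_real_derivative \<sigma>' x) (at x)"
    "\<And>x. x \<in> {0..l} \<Longrightarrow> - \<sigma>' x \<ge> \<kappa> * riccati_rate p a (\<sigma> x)"
  defines "b \<equiv> (p - 1) * \<kappa> * a"
  obtains w \<eta> F' where 
    "\<And>x. x \<in> {0..l} \<Longrightarrow> w x > 0" "\<And>x. x \<in> {0..l} \<Longrightarrow> \<eta> x > 0" 
    "continuous_on {0..l} w" "continuous_on {0..l} \<eta>"
    "\<And>x. x \<in> {0..l} \<Longrightarrow> (w has_real_derivative - \<eta> x) (at x within {0..l})"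
    "\<And>x. x \<in> {0..l} \<Longrightarrow> ((\<lambda>x. exp (- b * x) * \<eta> x powr (p - 1)) has_real_derivative F' x) (at x within {0..l})"
    "\<And>x. x \<in> {0..l} \<Longrightarrow> F' x \<ge> \<kappa> powr p * exp (- b * x) * w x powr (p - 1)"
proof -
  have cont\<sigma>: "continuous_on {0..l} \<sigma>"
    using \<sigma>(2) by (meson DERIV_continuous continuous_at_imp_continuous_on)
  have cont: "continuous_on {0..l} (\<lambda>x. \<kappa> / \<sigma> x)"
    using \<sigma>(1) by (intro continuous_intros cont\<sigma>) force+
  define w where "w = (\<lambda>x. exp (- integral {0..x} (\<lambda>x. \<kappa> / \<sigma> x)))"
  define \<eta> where "\<eta> = (\<lambda>x. \<kappa> * w x / \<sigma> x)"
  have wpos: "w x > 0" for x by (simp add: w_def)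
  have \<eta>pos: "\<eta> x > 0" if "x \<in> {0..l}" for x using wpos[of x] \<sigma>(1)[OF that] \<kappa> by (simp add: \<eta>_def)
  have dw: "(w has_real_derivative - \<eta> x) (at x within {0..l})" if "x \<in> {0..l}" for x
    unfolding w_def \<eta>_def using \<sigma>(1)[OF that]
    by (auto intro!: derivative_eq_intros integral_has_real_derivative[OF cont that])
  have contw: "continuous_on {0..l} w"
    using DERIV_continuous[OF dw] by (auto simp: continuous_on_eq_continuous_within)
  have d\<eta>: "(\<eta> has_real_derivative - \<eta> x * (\<kappa> / \<sigma> x + \<sigma>' x / \<sigma> x)) (at x within {0..l})" if x: "x \<in> {0..l}" for x
    unfolding \<eta>_def using \<sigma>(1)[OF x]
    by (auto intro!: derivative_eq_intros dw[OF x] has_field_derivative_at_within[OF \<sigma>(2)[OF x]]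
        simp: \<eta>_def field_simps power2_eq_square)
  have cont\<eta>: "continuous_on {0..l} \<eta>"
    using DERIV_continuous[OF d\<eta>] by (auto simp: continuous_on_eq_continuous_within)
  define F' where "F' = (\<lambda>x. exp (- b * x) * \<eta> x powr (p - 1) * (- b - (p - 1) * (\<kappa> / \<sigma> x + \<sigma>' x / \<sigma> x)))"
  have dF: "((\<lambda>x. exp (- b * x) * \<eta> x powr (p - 1)) has_real_derivative F' x) (at x within {0..l})"
    if x: "x \<in> {0..l}" for x
  proof -
    have "((\<lambda>x. \<eta> x powr (p - 1)) has_real_derivative
        (p - 1) * \<eta> x powr (p - 1) * (- (\<kappa> / \<sigma> x + \<sigma>' x / \<sigma> x))) (at x within {0..l})"
    proof -
      have "\<eta> x powr (p - 1 - 1) * \<eta> x = \<eta> x powr (p - 1)"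
        using \<eta>pos[OF x] by (simp add: powr_diff power2_eq_square)
      then have eq: "(p - 1) * \<eta> x powr (p - 1 - 1) * (- \<eta> x * Q) = (p - 1) * \<eta> x powr (p - 1) * (- Q)" for Q
        by (metis (no_types, opaque_lifting) mult.assoc mult_minus_left mult_minus_right)
      then show ?thesis
        using DERIV_chain2[OF has_real_derivative_powr[OF \<eta>pos[OF x]] d\<eta>[OF x], of "p - 1"]
        by (simp only: eq)
    qed
    moreover have "((\<lambda>x. exp (- b * x)) has_real_derivative - b * exp (- b * x)) (at x within {0..l})"
      by (auto intro!: derivative_eq_intros)
    ultimately have "((\<lambda>x. exp (- b * x) * \<eta> x powr (p - 1)) has_real_derivative
        - b * exp (- b * x) * \<eta> x powr (p - 1)
          + (p - 1) * \<eta> x powr (p - 1) * (- (\<kappa> / \<sigma> x + \<sigma>' x / \<sigma> x)) * exp (- b * x)) (at x within {0..l})"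
      by (intro DERIV_mult)
    moreover have "F' x = - b * exp (- b * x) * \<eta> x powr (p - 1)
          + (p - 1) * \<eta> x powr (p - 1) * (- (\<kappa> / \<sigma> x + \<sigma>' x / \<sigma> x)) * exp (- b * x)"
    proof -
      have "E * N * (- b - (p - 1) * Q) = - b * E * N + (p - 1) * N * (- Q) * E" for E N Q :: real
        by (simp add: algebra_simps)
      then show ?thesis unfolding F'_def .
    qed
    ultimately show ?thesis by (simp only:)
  qed
  have "F' x \<ge> \<kappa> powr p * exp (- b * x) * w x powr (p - 1)" if x: "x \<in> {0..l}" for x
  proof -
    have s: "\<sigma> x > 0" using \<sigma> x by auto
    have "\<kappa> * riccati_rate p a (\<sigma> x) / \<sigma> x \<le> - \<sigma>' x / \<sigma> x" using \<sigma>(3)[OF x] s by (intro divide_right_mono) auto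
    then have "(p - 1) * (\<kappa> * riccati_rate p a (\<sigma> x) / \<sigma> x) \<le> (p - 1) * (- \<sigma>' x / \<sigma> x)" using p by (intro mult_left_mono) auto
    moreover have "(p - 1) * (\<kappa> * riccati_rate p a (\<sigma> x) / \<sigma> x) = (p - 1) * \<kappa> / \<sigma> x + \<kappa> * \<sigma> x powr (p - 1) + b"
      using s p by (simp add: riccati_rate_def b_def field_simps powr_diff)
    ultimately have "\<kappa> * \<sigma> x powr (p - 1) \<le> - b - (p - 1) * (\<kappa> / \<sigma> x + \<sigma>' x / \<sigma> x)"
      by (simp add: algebra_simps)
    then have "exp (- b * x) * \<eta> x powr (p - 1) * (\<kappa> * \<sigma> x powr (p - 1)) \<le> F' x"
      unfolding F'_def by (intro mult_left_mono) auto
    moreover have "\<eta> x powr (p - 1) * (\<kappa> * \<sigma> x powr (p - 1)) = \<kappa> powr p * w x powr (p - 1)"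
      using s \<kappa> wpos[of x] by (simp add: \<eta>_def powr_divide powr_mult powr_diff)
    ultimately have "exp (- b * x) * (\<kappa> powr p * w x powr (p - 1)) \<le> F' x"
      by (simp only: mult.assoc)
    then show ?thesis by (simp only: mult_ac)
  qed
  then show ?thesis
    by (intro that[of w \<eta> F']) (use wpos \<eta>pos contw cont\<eta> dw dF in auto)
qed

text \<open>The travel time of the Riccati variable, cut off at \<open>M\<close>: it is \<open>\<kappa>\<close> times the length of the interval
that the variable needs to decrease from \<open>M\<close> to \<open>0\<close>.\<close>

definition half_length :: "real \<Rightarrow> real \<Rightarrow> real \<Rightarrow> real" where
  "half_length p M a = integral {0..M} (\<lambda>s. 1 / riccati_rate p a s)"

lemma riccati_rate_ge_1: "p > 1 \<Longrightarrow> a \<ge> 0 \<Longrightarrow> s \<ge> 0 \<Longrightarrow> riccati_rate p a s \<ge> 1"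
  by (simp add: riccati_rate_def)

lemma continuous_on_riccati_rate:
  assumes "p > 1" shows "continuous_on (A \<times> {0..M}) (\<lambda>(a, s). riccati_rate p a s)"
  unfolding riccati_rate_def case_prod_unfold using assms
  by (intro continuous_intros continuous_on_powr') auto

lemma riccati_rate_inverse_integrable:
  assumes "p > 1" "\<And>s. s \<in> {0..M} \<Longrightarrow> riccati_rate p a s > 0"
  shows "(\<lambda>s. 1 / riccati_rate p a s) integrable_on {0..M}"
proof (rule integrable_continuous_interval)
  have "continuous_on {0..M} (riccati_rate p a)"
    unfolding riccati_rate_def using assms(1) by (intro continuous_intros continuous_on_powr') auto
  then show "continuous_on {0..M} (\<lambda>s. 1 / riccati_rate p a s)"
    using assms(2) by (intro continuous_intros) force+
qed

lemma half_length_continuous: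
  assumes "p > 1" shows "continuous_on {0..A} (half_length p M)"
proof -
  have "continuous_on ({0..A} \<times> cbox 0 M) (\<lambda>(a, s). 1 / riccati_rate p a s)"
    using continuous_on_riccati_rate[OF assms, of "{0..A}" M] riccati_rate_ge_1[OF assms] unfolding case_prod_unfold
    by (intro continuous_intros) (force simp: not_le)+
  then show ?thesis
    unfolding half_length_def using integral_continuous_on_param[of "{0..A}" 0 M "\<lambda>a s. 1 / riccati_rate p a s"] by simp
qed

lemma half_length_pos: 
  assumes "p > 1" "a \<ge> 0" "M > 0" shows "half_length p M a > 0"
proof -
  have le: "1 / (1 + M powr p / (p - 1) + a * M) \<le> 1 / riccati_rate p a s" if "s \<in> {0..M}" for s
    unfolding riccati_rate_def using assms that
    by (intro divide_left_mono add_mono divide_right_mono powr_mono2 mult_left_mono mult_pos_pos add_pos_nonneg) auto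
  have "0 < M * (1 / (1 + M powr p / (p - 1) + a * M))"
    using assms by (intro mult_pos_pos divide_pos_pos add_pos_nonneg) auto
  also have "\<dots> = integral {0..M} (\<lambda>_. 1 / (1 + M powr p / (p - 1) + a * M))"
    using assms by simp
  also have "\<dots> \<le> half_length p M a"
    unfolding half_length_def
    by (intro integral_le riccati_rate_inverse_integrable assms le)
       (use riccati_rate_ge_1[OF assms(1,2)] in \<open>force intro: less_le_trans\<close>)+
  finally show ?thesis .
qed

text \<open>The integrands at \<open>a\<close> and \<open>-a\<close> are \<open>1 / (A + x)\<close> and \<open>1 / (A - x)\<close>, whose sum \<open>2 A / (A\<^sup>2 - x\<^sup>2)\<close> is at
least \<open>2 / A\<close>.\<close>

lemma half_length_sum:
  assumes p: "p > 1" and a: "a \<ge> 0" and pos: "\<And>s. s \<in> {0..M} \<Longrightarrow> riccati_rate p (- a) s > 0"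
  shows "2 * half_length p M 0 \<le> half_length p M a + half_length p M (- a)"
proof -
  have int: "(\<lambda>s. 1 / riccati_rate p a s) integrable_on {0..M}" "(\<lambda>s. 1 / riccati_rate p (- a) s) integrable_on {0..M}"
     "(\<lambda>s. 1 / riccati_rate p 0 s) integrable_on {0..M}"
    using riccati_rate_ge_1[OF p a] riccati_rate_ge_1[OF p order_refl] pos
    by (intro riccati_rate_inverse_integrable p; force intro: less_le_trans)+
  have le: "2 * (1 / riccati_rate p 0 s) \<le> 1 / riccati_rate p a s + 1 / riccati_rate p (- a) s" if s: "s \<in> {0..M}" for s
  proof -
    define A x where "A = riccati_rate p 0 s" and "x = a * s"
    have e: "riccati_rate p a s = A + x" "riccati_rate p (- a) s = A - x" by (auto simp: A_def x_def riccati_rate_def)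
    have A: "A > 0" "A - x > 0" "A + x > 0" using riccati_rate_ge_1[OF p order_refl, of s] riccati_rate_ge_1[OF p a, of s] pos[OF s] s e
      by (auto simp: A_def)
    have "2 * ((A + x) * (A - x)) \<le> 2 * A * A" by (simp add: algebra_simps)
    then have "2 / A \<le> 2 * A / ((A + x) * (A - x))" using A by (simp add: divide_simps mult_ac)
    also have "\<dots> = 1 / (A + x) + 1 / (A - x)" using A by (simp add: field_simps)
    finally show ?thesis by (simp add: e A_def)
  qed
  have "2 * half_length p M 0 = integral {0..M} (\<lambda>s. 2 * (1 / riccati_rate p 0 s))"
    unfolding half_length_def by (rule Henstock_Kurzweil_Integration.integral_mult_right[symmetric])
  also have "\<dots> \<le> integral {0..M} (\<lambda>s. 1 / riccati_rate p a s + 1 / riccati_rate p (- a) s)"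
    using integrable_cmul[OF int(3), of 2] by (intro integral_le integrable_add int le) auto
  also have "\<dots> = half_length p M a + half_length p M (- a)"
    unfolding half_length_def by (rule integral_add[OF int(1,2)])
  finally show ?thesis .
qed

text \<open>The condition under which \<open>supersolution_ex\<close> yields a positive supersolution on \<open>[0, l]\<close>.\<close>

definition supersolvable :: "real \<Rightarrow> real \<Rightarrow> real \<Rightarrow> real \<Rightarrow> bool" where
  "supersolvable p \<kappa> a l \<longleftrightarrow> (\<exists>M>0. (\<exists>s>0. riccati_rate p a s \<le> 0) \<or> (\<forall>s\<in>{0..M}. riccati_rate p a s > 0) \<and> \<kappa> * l < half_length p M a)"

text \<open>For \<open>a \<ge> 0\<close> the left part gets the fixed fraction \<open>\<theta> < 1\<close> of the length that it can afford, where
\<open>\<theta>\<close> is chosen so that both parts are equal at \<open>a = 0\<close>; by \<open>half_length_sum\<close> the remaining length is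
affordable on the right.  Negative \<open>a\<close> are treated by reflection.  Once \<open>a \<ge> K\<close>, the rate
for \<open>-a\<close> is nonpositive at \<open>1\<close>, so the right part may have any length, and the left part can be
shrunk to zero.\<close>

lemma splitting_curve:
  assumes p: "p > 1" and \<kappa>: "\<kappa> > 0" and L: "L > 0" and M: "M \<ge> 1" "\<kappa> * L < 2 * half_length p M 0"
  obtains A c where "A > 0" "continuous_on {-A..A} c" "c (- A) = L" "c A = 0"
    "\<And>a. a \<in> {-A..A} \<Longrightarrow> c a \<in> {0..L} \<and> supersolvable p \<kappa> a (c a) \<and> supersolvable p \<kappa> (- a) (L - c a)"
proof -
  \<comment> \<open>\<open>K = 1 + 1 / (p - 1)\<close> is the tilt at which the rate for \<open>-K\<close> vanishes at \<open>1\<close>.\<close>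
  define K where "K = p / (p - 1)"
  have K: "K > 0" using p by (simp add: K_def)
  define \<theta> where "\<theta> = \<kappa> * L / (2 * half_length p M 0)"
  have H0: "half_length p M 0 > 0" by (rule half_length_pos) (use p M in auto)
  have \<theta>: "0 < \<theta>" "\<theta> < 1" using M L \<kappa> H0 by (auto simp: \<theta>_def)
  define d where "d = (\<lambda>a. \<theta> * half_length p M a / \<kappa> * min 1 (K + 1 - a))"
  have d0: "d 0 = L / 2" using K H0 \<kappa> by (simp add: d_def \<theta>_def min_def field_simps)
  have dend: "d (K + 1) = 0" by (simp add: d_def)
  have dcont: "continuous_on {0..K + 1} d"
    unfolding d_def using half_length_continuous[OF p] \<kappa> by (intro continuous_intros) auto
  have d_le: "d a \<le> \<theta> * half_length p M a / \<kappa>" "0 \<le> d a" if "a \<in> {0..K+1}" for a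
  proof -
    have "0 \<le> \<theta> * half_length p M a / \<kappa>"
      using that \<theta> \<kappa> less_imp_le[OF half_length_pos[OF p, of a M]] M by auto
    then show "d a \<le> \<theta> * half_length p M a / \<kappa>" "0 \<le> d a"
      unfolding d_def using that by (auto intro!: mult_left_le mult_nonneg_nonneg simp del: times_divide_eq_left)
  qed
  have mono: "half_length p M a \<le> half_length p M 0" if "a \<ge> 0" for a
    unfolding half_length_def
  proof (intro integral_le riccati_rate_inverse_integrable p)
    fix s assume s: "s \<in> {0..M}"
    show "0 < riccati_rate p a s" "0 < riccati_rate p 0 s"
      using riccati_rate_ge_1[OF p that, of s] riccati_rate_ge_1[OF p order_refl, of s] s by auto
    then show "1 / riccati_rate p a s \<le> 1 / riccati_rate p 0 s" using s that by (intro divide_left_mono) (auto simp: riccati_rate_def)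
  qed
  have dL: "d a \<le> L / 2" if "a \<in> {0..K+1}" for a
  proof -
    have "d a \<le> \<theta> * half_length p M 0 / \<kappa>"
      using d_le(1)[OF that] mono[of a] that \<theta> \<kappa>
      by (smt (verit) atLeastAtMost_iff divide_right_mono mult_left_mono)
    also have "\<dots> = L / 2" using H0 \<kappa> by (simp add: \<theta>_def field_simps)
    finally show ?thesis .
  qed
  have left: "supersolvable p \<kappa> a (d a)" if a: "a \<in> {0..K+1}" for a
  proof -
    have "\<kappa> * d a \<le> \<theta> * half_length p M a"
      using d_le(1)[OF a] \<kappa> by (simp add: field_simps)
    also have "\<dots> < half_length p M a" using \<theta> half_length_pos[OF p, of a M] a M by simp
    finally show ?thesis
      unfolding supersolvable_def using M a riccati_rate_ge_1[OF p, of a]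
      by (intro exI[of _ M]) (force intro: less_le_trans)
  qed
  have right: "supersolvable p \<kappa> (- a) (L - d a)" if a: "a \<in> {0..K+1}" for a
  proof (cases "\<exists>s>0. riccati_rate p (- a) s \<le> 0")
    case True
    then show ?thesis unfolding supersolvable_def using M by (intro exI[of _ 1]) auto
  next
    case False
    have pos: "riccati_rate p (- a) s > 0" if "s \<in> {0..M}" for s
      using False that by (cases "s = 0") (auto simp: riccati_rate_def not_le)
    have "riccati_rate p (- a) 1 > 0" using pos[of 1] M by auto
    then have "a < K" using p by (simp add: riccati_rate_def K_def field_simps)
    then have da: "d a = \<theta> * half_length p M a / \<kappa>" by (simp add: d_def min_def)
    have L2: "\<kappa> * L = \<theta> * (2 * half_length p M 0)" using H0 by (simp add: \<theta>_def)
    have "\<kappa> * (L - d a) = \<theta> * (2 * half_length p M 0 - half_length p M a)"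
      using \<kappa> by (simp add: right_diff_distrib L2 da)
    also have "\<dots> \<le> \<theta> * half_length p M (- a)"
      using half_length_sum[OF p, of a M] pos a \<theta> by (intro mult_left_mono) auto
    also have "\<dots> < half_length p M (- a)"
    proof -
      have "half_length p M (- a) > 0" using half_length_sum[OF p, of a M] pos a mono[of a] H0 by auto
      then show ?thesis using \<theta> by simp
    qed
    finally show ?thesis unfolding supersolvable_def using M pos by (intro exI[of _ M]) auto
  qed
  define c where "c = (\<lambda>a. if a \<le> 0 then L - d (- a) else d a)"
  show ?thesis
  proof (rule that[of "K + 1" c])
    have eq: "{- (K + 1)..K + 1} = {- (K + 1)..0} \<union> {0..K + 1}" using K by auto
    show "continuous_on {- (K + 1)..K + 1} c"
      unfolding c_def eq
    proof (rule continuous_on_cases)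
      show "continuous_on {- (K + 1)..0} (\<lambda>a. L - d (- a))"
        by (intro continuous_intros continuous_on_compose2[OF dcont]) auto
    qed (use dcont d0 in auto)
    fix a assume a: "a \<in> {- (K + 1)..K + 1}"
    show "c a \<in> {0..L} \<and> supersolvable p \<kappa> a (c a) \<and> supersolvable p \<kappa> (- a) (L - c a)"
    proof (cases "a \<le> 0")
      case True
      then show ?thesis using left[of "- a"] right[of "- a"] d_le[of "- a"] dL[of "- a"] a L by (auto simp: c_def)
    next
      case False
      then show ?thesis using left[of "a"] right[of "a"] d_le[of "a"] dL[of "a"] a L by (auto simp: c_def)
    qed
  qed (use K dend in \<open>auto simp: c_def add.commute[of 1 K]\<close>)
qed

lemma nn_integral_le_has_integral:
  fixes f :: "real \<Rightarrow> real"
  assumes "(f has_integral I) B" "A \<subseteq> B" "\<And>x. x \<in> B \<Longrightarrow> f x \<ge> 0"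
  shows "(\<integral>\<^sup>+x. indicator A x * ennreal (f x) \<partial>lborel) \<le> ennreal I"
proof -
  have "(\<integral>\<^sup>+x. indicator A x * ennreal (f x) \<partial>lborel) \<le> (\<integral>\<^sup>+x. ennreal (f x) * indicator B x \<partial>lborel)"
    using assms(2) by (intro nn_integral_mono) (auto simp: indicator_def)
  also have "\<dots> = ennreal I"
    by (rule nn_integral_has_integral_lebesgue'[OF assms(3,1)])
  finally show ?thesis .
qed

text \<open>The integrated form of \<open>w' = - \<eta>\<close> and of the differential inequality for \<open>e\<^sup>-\<^sup>b\<^sup>x \<eta>\<^sup>p\<^sup>-\<^sup>1\<close>.  The boundary terms
\<open>w(l)\<close> and \<open>\<eta>(0)\<^sup>p\<^sup>-\<^sup>1\<close> that arise have a favourable sign.\<close>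

lemma half_profile:
  assumes p: "p > 1" and \<kappa>: "\<kappa> > 0" and l: "l \<ge> 0" and ss: "supersolvable p \<kappa> a l"
  defines "b \<equiv> (p - 1) * \<kappa> * a"
  obtains w \<eta> :: "real \<Rightarrow> real" where "w \<in> borel_measurable borel" "\<eta> \<in> borel_measurable borel"
    "\<And>x. x \<in> {0..l} \<Longrightarrow> w x > 0" "\<And>x. x \<in> {0..l} \<Longrightarrow> \<eta> x > 0" 
    "\<And>x. x \<in> {0<..<l} \<Longrightarrow> (\<integral>\<^sup>+y. indicator {x<..<l} y * ennreal (\<eta> y) \<partial>lborel) \<le> ennreal (w x)"
    "\<And>y. y \<in> {0<..<l} \<Longrightarrow> ennreal (\<kappa> powr p) * (\<integral>\<^sup>+x. indicator {0<..<y} x * ennreal (exp (- b * x) * w x powr (p - 1)) \<partial>lborel)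
       \<le> ennreal (exp (- b * y) * \<eta> y powr (p - 1))"
proof -
  obtain M where M: "M > 0" "(\<exists>s>0. riccati_rate p a s \<le> 0) \<or> (\<forall>s\<in>{0..M}. riccati_rate p a s > 0) \<and> \<kappa> * l < integral {0..M} (\<lambda>s. 1 / riccati_rate p a s)"
    using ss unfolding supersolvable_def half_length_def by blast
  obtain \<sigma> \<sigma>' where \<sigma>: "\<And>x. x \<in> {0..l} \<Longrightarrow> \<sigma> x > 0" 
    "\<And>x. x \<in> {0..l} \<Longrightarrow> (\<sigma> has_real_derivative \<sigma>' x) (at x)"
    "\<And>x. x \<in> {0..l} \<Longrightarrow> - \<sigma>' x \<ge> \<kappa> * riccati_rate p a (\<sigma> x)"
    using supersolution_ex[OF p \<kappa> M] by blast
  obtain w \<eta> F' where w: "\<And>x. x \<in> {0..l} \<Longrightarrow> w x > 0" "\<And>x. x \<in> {0..l} \<Longrightarrow> \<eta> x > 0" 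
    "continuous_on {0..l} w" "continuous_on {0..l} \<eta>"
    "\<And>x. x \<in> {0..l} \<Longrightarrow> (w has_real_derivative - \<eta> x) (at x within {0..l})"
    "\<And>x. x \<in> {0..l} \<Longrightarrow> ((\<lambda>x. exp (- b * x) * \<eta> x powr (p - 1)) has_real_derivative F' x) (at x within {0..l})"
    "\<And>x. x \<in> {0..l} \<Longrightarrow> F' x \<ge> \<kappa> powr p * exp (- b * x) * w x powr (p - 1)"
    using eigenfunction_from_supersolution[OF p \<kappa> \<sigma>] unfolding b_def by blast
  define W where "W = (\<lambda>x. indicator {0..l} x *\<^sub>R w x)"
  define H where "H = (\<lambda>x. indicator {0..l} x *\<^sub>R \<eta> x)"
  have WH: "W x = w x" "H x = \<eta> x" if "x \<in> {0..l}" for x using that by (auto simp: W_def H_def)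
  show ?thesis
  proof (rule that[of W H])
    show "W \<in> borel_measurable borel" unfolding W_def
      by (rule borel_measurable_continuous_on_indicator) (use w in auto)
    show "H \<in> borel_measurable borel" unfolding H_def
      by (rule borel_measurable_continuous_on_indicator) (use w in auto)
    show "W x > 0" "H x > 0" if "x \<in> {0..l}" for x using WH[OF that] w(1,2)[OF that] by auto
  next
    fix x assume x: "x \<in> {0<..<l}"
    have "(w has_real_derivative - \<eta> z) (at z within {x..l})" if "z \<in> {x..l}" for z
      by (rule DERIV_subset[OF w(5)]) (use x that in auto)
    then have "((\<lambda>y. - \<eta> y) has_integral (w l - w x)) {x..l}"
      using x by (intro fundamental_theorem_of_calculus)
         (auto simp flip: has_real_derivative_iff_has_vector_derivative)
    from has_integral_neg[OF this] have "(\<eta> has_integral (w x - w l)) {x..l}"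
      by simp
    then have "(H has_integral (w x - w l)) {x..l}"
      by (rule has_integral_eq[rotated]) (use x WH in auto)
    then have "(\<integral>\<^sup>+y. indicator {x<..<l} y * ennreal (H y) \<partial>lborel) \<le> ennreal (w x - w l)"
      by (rule nn_integral_le_has_integral) (use x WH w(2) in \<open>auto intro: less_imp_le\<close>)
    also have "\<dots> \<le> ennreal (W x)" using w(1)[of l] x l WH by (intro ennreal_leI) auto
    finally show "(\<integral>\<^sup>+y. indicator {x<..<l} y * ennreal (H y) \<partial>lborel) \<le> ennreal (W x)" .
  next
    fix y assume y: "y \<in> {0<..<l}"
    define G where "G = (\<lambda>x. exp (- b * x) * \<eta> x powr (p - 1))"
    have "(G has_real_derivative F' z) (at z within {0..y})" if "z \<in> {0..y}" for z
      unfolding G_def by (rule DERIV_subset[OF w(6)]) (use y that in auto)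
    then have G: "(F' has_integral (G y - G 0)) {0..y}"
      using y by (intro fundamental_theorem_of_calculus)
         (auto simp flip: has_real_derivative_iff_has_vector_derivative)
    have c: "continuous_on {0..y} (\<lambda>x. exp (- b * x) * w x powr (p - 1))"
      using w(1) y by (intro continuous_intros continuous_on_subset[OF w(3)]) force+
    define I where "I = integral {0..y} (\<lambda>x. exp (- b * x) * w x powr (p - 1))"
    have I: "((\<lambda>x. exp (- b * x) * w x powr (p - 1)) has_integral I) {0..y}"
      unfolding I_def by (intro integrable_integral integrable_continuous_interval c)
    have "\<kappa> powr p * I \<le> G y - G 0"
      by (rule has_integral_le[OF has_integral_mult_right[OF I] G])
         (use w(7) y in \<open>auto simp: mult.assoc\<close>)
    moreover have "G 0 \<ge> 0" by (simp add: G_def)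
    ultimately have le: "\<kappa> powr p * I \<le> G y" by linarith
    have I': "((\<lambda>x. exp (- b * x) * W x powr (p - 1)) has_integral I) {0..y}"
      by (rule has_integral_eq[OF _ I]) (use y WH in auto)
    have "(\<integral>\<^sup>+x. indicator {0<..<y} x * ennreal (exp (- b * x) * W x powr (p - 1)) \<partial>lborel) \<le> ennreal I"
      by (rule nn_integral_le_has_integral[OF I']) auto
    then have "ennreal (\<kappa> powr p) * (\<integral>\<^sup>+x. indicator {0<..<y} x * ennreal (exp (- b * x) * W x powr (p - 1)) \<partial>lborel)
        \<le> ennreal (\<kappa> powr p) * ennreal I" by (rule mult_left_mono) auto
    also have "\<dots> = ennreal (\<kappa> powr p * I)" by (rule ennreal_mult'[symmetric]) auto
    also have "\<dots> \<le> ennreal (G y)" by (rule ennreal_leI[OF le])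
    finally show "ennreal (\<kappa> powr p) * (\<integral>\<^sup>+x. indicator {0<..<y} x * ennreal (exp (- b * x) * W x powr (p - 1)) \<partial>lborel)
        \<le> ennreal (exp (- b * y) * H y powr (p - 1))" using WH y by (simp add: G_def)
  qed
qed

text \<open>The hypotheses of the Schur test for the kernel \<open>x < y < l\<close>, uniformly for all weights \<open>f\<close> such that
\<open>f(x) e\<^sup>b\<^sup>x\<close> is increasing.\<close>

definition comparison_pair :: "real \<Rightarrow> real \<Rightarrow> real \<Rightarrow> real \<Rightarrow> (real \<Rightarrow> real) \<Rightarrow> (real \<Rightarrow> real) \<Rightarrow> bool" where
  "comparison_pair p \<mu> b l w \<eta> \<longleftrightarrow>
     w \<in> borel_measurable borel \<and> \<eta> \<in> borel_measurable borel \<and>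
     (\<forall>x\<in>{0..l}. w x > 0 \<and> \<eta> x > 0) \<and>
     (\<forall>x\<in>{0<..<l}. (\<integral>\<^sup>+y. indicator {x<..<l} y * ennreal (\<eta> y) \<partial>lborel) \<le> ennreal (w x)) \<and>
     (\<forall>f. (\<forall>x. f x \<ge> 0) \<longrightarrow> (\<forall>x y. 0 < x \<longrightarrow> x \<le> y \<longrightarrow> y < l \<longrightarrow> f x * exp (b * x) \<le> f y * exp (b * y)) \<longrightarrow>
       (\<forall>y\<in>{0<..<l}. ennreal \<mu> * (\<integral>\<^sup>+x. indicator {0<..<y} x * ennreal (f x * w x powr (p - 1)) \<partial>lborel)
          \<le> ennreal (f y * \<eta> y powr (p - 1))))"

lemma comparison_pairD:
  assumes "comparison_pair p \<mu> b l w \<eta>"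
  shows "w \<in> borel_measurable borel" "\<eta> \<in> borel_measurable borel"
    "\<And>x. x \<in> {0..l} \<Longrightarrow> w x > 0" "\<And>x. x \<in> {0..l} \<Longrightarrow> \<eta> x > 0"
    "\<And>x. x \<in> {0<..<l} \<Longrightarrow> (\<integral>\<^sup>+y. indicator {x<..<l} y * ennreal (\<eta> y) \<partial>lborel) \<le> ennreal (w x)"
    "\<And>f y. (\<And>x y. 0 < x \<Longrightarrow> x \<le> y \<Longrightarrow> y < l \<Longrightarrow> f x * exp (b * x) \<le> f y * exp (b * y)) \<Longrightarrow>
       (\<And>x. f x \<ge> 0) \<Longrightarrow> y \<in> {0<..<l} \<Longrightarrow>
       ennreal \<mu> * (\<integral>\<^sup>+x. indicator {0<..<y} x * ennreal (f x * w x powr (p - 1)) \<partial>lborel)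
         \<le> ennreal (f y * \<eta> y powr (p - 1))"
proof -
  show "ennreal \<mu> * (\<integral>\<^sup>+x. indicator {0<..<y} x * ennreal (f x * w x powr (p - 1)) \<partial>lborel)
         \<le> ennreal (f y * \<eta> y powr (p - 1))"
    if "\<And>x y. 0 < x \<Longrightarrow> x \<le> y \<Longrightarrow> y < l \<Longrightarrow> f x * exp (b * x) \<le> f y * exp (b * y)"
      "\<And>x. f x \<ge> 0" "y \<in> {0<..<l}" for f y
  proof -
    have "\<forall>f. (\<forall>x. f x \<ge> 0) \<longrightarrow> (\<forall>x y. 0 < x \<longrightarrow> x \<le> y \<longrightarrow> y < l \<longrightarrow> f x * exp (b * x) \<le> f y * exp (b * y)) \<longrightarrow>
       (\<forall>y\<in>{0<..<l}. ennreal \<mu> * (\<integral>\<^sup>+x. indicator {0<..<y} x * ennreal (f x * w x powr (p - 1)) \<partial>lborel)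
          \<le> ennreal (f y * \<eta> y powr (p - 1)))"
      using assms unfolding comparison_pair_def by (elim conjE)
    from this[rule_format, of f] show ?thesis using that by blast
  qed
qed (use assms in \<open>auto simp: comparison_pair_def\<close>)

text \<open>If \<open>f(x) e\<^sup>b\<^sup>x\<close> increases, then \<open>f(x) \<le> f(y) e\<^sup>b\<^sup>y e\<^sup>-\<^sup>b\<^sup>x\<close> for \<open>x \<le> y\<close>, so that the estimate for the weight
\<open>e\<^sup>-\<^sup>b\<^sup>x\<close>, multiplied by \<open>f(y) e\<^sup>b\<^sup>y\<close>, gives the one for \<open>f\<close>.\<close>

lemma comparison_pair_ex:
  assumes p: "p > 1" and \<kappa>: "\<kappa> > 0" and l: "l \<ge> 0" and ss: "supersolvable p \<kappa> a l"
  shows "\<exists>w \<eta>. comparison_pair p (\<kappa> powr p) ((p - 1) * \<kappa> * a) l w \<eta>"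
proof -
  define b where "b = (p - 1) * \<kappa> * a"
  obtain w \<eta> where w: "w \<in> borel_measurable borel" "\<eta> \<in> borel_measurable borel"
    "\<And>x. x \<in> {0..l} \<Longrightarrow> w x > 0" "\<And>x. x \<in> {0..l} \<Longrightarrow> \<eta> x > 0" 
    "\<And>x. x \<in> {0<..<l} \<Longrightarrow> (\<integral>\<^sup>+y. indicator {x<..<l} y * ennreal (\<eta> y) \<partial>lborel) \<le> ennreal (w x)"
    "\<And>y. y \<in> {0<..<l} \<Longrightarrow> ennreal (\<kappa> powr p) * (\<integral>\<^sup>+x. indicator {0<..<y} x * ennreal (exp (- b * x) * w x powr (p - 1)) \<partial>lborel)
       \<le> ennreal (exp (- b * y) * \<eta> y powr (p - 1))"
    using half_profile[OF p \<kappa> l ss] unfolding b_def by blast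
  note [measurable] = w(1,2)
  have "comparison_pair p (\<kappa> powr p) b l w \<eta>"
    unfolding comparison_pair_def
  proof (intro conjI ballI allI impI w(1-5))
    fix f :: "real \<Rightarrow> real" and y
    assume mono': "\<forall>x y. 0 < x \<longrightarrow> x \<le> y \<longrightarrow> y < l \<longrightarrow> f x * exp (b * x) \<le> f y * exp (b * y)"
      and f0': "\<forall>x. f x \<ge> 0" and y: "y \<in> {0<..<l}"
    from mono' have mono: "f x * exp (b * x) \<le> f y * exp (b * y)" if "0 < x" "x \<le> y" "y < l" for x y
      using that by blast
    from f0' have f0: "f x \<ge> 0" for x by blast
    let ?I = "\<integral>\<^sup>+x. indicator {0<..<y} x * ennreal (exp (- b * x) * w x powr (p - 1)) \<partial>lborel"
    have le: "f x * w x powr (p - 1) \<le> f y * exp (b * y) * (exp (- b * x) * w x powr (p - 1))" if "0 < x" "x < y" for x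
    proof -
      have "f x = f x * exp (b * x) * exp (- b * x)" by (simp add: exp_minus)
      also have "\<dots> \<le> f y * exp (b * y) * exp (- b * x)"
        by (intro mult_right_mono mono) (use that y in auto)
      finally show ?thesis by (simp add: mult_right_mono mult.assoc[symmetric])
    qed
    have "(\<integral>\<^sup>+x. indicator {0<..<y} x * ennreal (f x * w x powr (p - 1)) \<partial>lborel)
       \<le> (\<integral>\<^sup>+x. ennreal (f y * exp (b * y)) * (indicator {0<..<y} x * ennreal (exp (- b * x) * w x powr (p - 1))) \<partial>lborel)"
    proof (intro nn_integral_mono)
      fix x
      show "indicator {0<..<y} x * ennreal (f x * w x powr (p - 1)) \<le> ennreal (f y * exp (b * y)) * (indicator {0<..<y} x * ennreal (exp (- b * x) * w x powr (p - 1)))"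
        using le[of x] f0[of y] by (auto simp: indicator_def ennreal_mult[symmetric] intro!: ennreal_leI)
    qed
    also have "\<dots> = ennreal (f y * exp (b * y)) * ?I"
      by (rule nn_integral_cmult) measurable
    finally have "ennreal (\<kappa> powr p) * (\<integral>\<^sup>+x. indicator {0<..<y} x * ennreal (f x * w x powr (p - 1)) \<partial>lborel)
      \<le> ennreal (\<kappa> powr p) * (ennreal (f y * exp (b * y)) * ?I)"
      by (rule mult_left_mono) auto
    also have "\<dots> = ennreal (f y * exp (b * y)) * (ennreal (\<kappa> powr p) * ?I)"
      by (simp add: mult_ac)
    also have "\<dots> \<le> ennreal (f y * exp (b * y)) * ennreal (exp (- b * y) * \<eta> y powr (p - 1))"
      by (intro mult_left_mono w y) auto
    also have "\<dots> = ennreal (f y * exp (b * y) * (exp (- b * y) * \<eta> y powr (p - 1)))"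
      using f0[of y] by (intro ennreal_mult[symmetric]) auto
    also have "f y * exp (b * y) * (exp (- b * y) * \<eta> y powr (p - 1)) = f y * \<eta> y powr (p - 1)"
      by (simp add: exp_minus)
    finally show "ennreal (\<kappa> powr p) * (\<integral>\<^sup>+x. indicator {0<..<y} x * ennreal (f x * w x powr (p - 1)) \<partial>lborel)
      \<le> ennreal (f y * \<eta> y powr (p - 1))" .
  qed
  then show ?thesis unfolding b_def by blast
qed

lemma borel_measurable_tilted_monotone:
  fixes f :: "real \<Rightarrow> real"
  assumes "\<And>x y. x \<in> {l<..<u} \<Longrightarrow> y \<in> {l<..<u} \<Longrightarrow> x \<le> y \<Longrightarrow> s * (f x * exp (b * x)) \<le> s * (f y * exp (b * y))" "s \<noteq> 0"
  shows "(\<lambda>x. indicator {l<..<u} x * f x) \<in> borel_measurable borel"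
proof -
  have "(\<lambda>x. s * (f x * exp (b * x))) \<in> borel_measurable (restrict_space borel {l<..<u})"
    by (rule borel_measurable_mono_on_fnc) (use assms in \<open>auto simp: mono_on_def\<close>)
  then have m[measurable]: "(\<lambda>x. indicator {l<..<u} x * (s * (f x * exp (b * x)))) \<in> borel_measurable borel"
    by (subst (asm) borel_measurable_restrict_space_iff) auto
  have "(\<lambda>x. indicator {l<..<u} x * (s * (f x * exp (b * x))) * (exp (- b * x) / s)) \<in> borel_measurable borel"
    by measurable
  also have "(\<lambda>x. indicator {l<..<u} x * (s * (f x * exp (b * x))) * (exp (- b * x) / s)) = (\<lambda>x. indicator {l<..<u} x * f x)"
    using assms(2) by (auto simp: exp_minus fun_eq_iff)
  finally show ?thesis .
qed

section \<open>A weighted Poincare inequality about a point\<close>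

text \<open>By mode selection without tilt, \<open>f\<close> is monotone on two intervals that cover all but one point.\<close>

lemma log_concave_borel_measurable:
  assumes lc: "log_concave_on {0..L} f" and nn: "\<And>x. x \<in> {0..L} \<Longrightarrow> f x \<ge> 0" and L: "L > 0"
  shows "(\<lambda>x. indicator {0<..<L} x * f x) \<in> borel_measurable borel"
proof -
  obtain c where c: "c \<in> {0..L}"
    "\<And>x y. 0 < x \<Longrightarrow> x \<le> y \<Longrightarrow> y < c \<Longrightarrow> f x \<le> f y"
    "\<And>x y. c < x \<Longrightarrow> x \<le> y \<Longrightarrow> y < L \<Longrightarrow> f y \<le> f x"
    by (rule tilted_mode_selection[OF lc nn, where lo = 0 and hi = L and b = "\<lambda>_. 0" and c = "\<lambda>x. x"])
       (use L in auto)
  have "(\<lambda>x. indicator {0<..<c} x * f x) \<in> borel_measurable borel"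
    by (rule borel_measurable_tilted_monotone[where b = 0 and s = 1]) (use c in auto)
  moreover have "(\<lambda>x. indicator {c<..<L} x * f x) \<in> borel_measurable borel"
    by (rule borel_measurable_tilted_monotone[where b = 0 and s = "-1"]) (use c in auto)
  moreover have "(\<lambda>x. indicator {c} x * k) \<in> borel_measurable borel" for k :: real
    by (intro borel_measurable_times borel_measurable_indicator borel_measurable_const) simp
  ultimately have "(\<lambda>x. indicator {0<..<c} x * f x + indicator {c<..<L} x * f x + indicator {c} x * (indicator {0<..<L} c * f c)) \<in> borel_measurable borel"
    by (intro borel_measurable_add)
  also have "(\<lambda>x. indicator {0<..<c} x * f x + indicator {c<..<L} x * f x + indicator {c} x * (indicator {0<..<L} c * f c))
      = (\<lambda>x. indicator {0<..<L} x * f x)"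
    using c(1) by (auto simp: fun_eq_iff indicator_def)
  finally show ?thesis .
qed

lemma sigma_finite_lebesgue: "sigma_finite_measure (lebesgue :: real measure)"
proof -
  obtain A :: "nat \<Rightarrow> real set" where A: "range A \<subseteq> sets lborel" "(\<Union>i. A i) = space lborel" "\<And>i. emeasure lborel (A i) \<noteq> \<infinity>"
    using lborel.sigma_finite by blast
  show ?thesis
    by (standard, rule exI[of _ "range A"]) (use A in auto)
qed

lemma borel_measurable_fst_snd_lebesgue:
  "fst \<in> borel_measurable (lebesgue \<Otimes>\<^sub>M lebesgue :: (real \<times> real) measure)"
  "snd \<in> borel_measurable (lebesgue \<Otimes>\<^sub>M lebesgue :: (real \<times> real) measure)"
proof -
  have id: "(\<lambda>x. x) \<in> borel_measurable (lebesgue :: real measure)"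
    by (rule measurable_completion) simp
  show "fst \<in> borel_measurable (lebesgue \<Otimes>\<^sub>M lebesgue :: (real \<times> real) measure)"
    "snd \<in> borel_measurable (lebesgue \<Otimes>\<^sub>M lebesgue :: (real \<times> real) measure)"
    by (rule measurable_compose[OF measurable_fst id] measurable_compose[OF measurable_snd id])+
qed

lemma two_sided_kernel_measurable:
  "{(x, y). 0 < x \<and> x < y \<and> y < c \<or> c < y \<and> y < x \<and> x < (L::real)} \<in> sets (lebesgue \<Otimes>\<^sub>M lebesgue)"
proof -
  note [measurable] = borel_measurable_fst_snd_lebesgue
  have "{z \<in> space (lebesgue \<Otimes>\<^sub>M lebesgue). 0 < fst z \<and> fst z < snd z \<and> snd z < c \<or> c < snd z \<and> snd z < fst z \<and> fst z < L}
    \<in> sets (lebesgue \<Otimes>\<^sub>M lebesgue)"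
    by measurable
  also have "{z \<in> space (lebesgue \<Otimes>\<^sub>M lebesgue). 0 < fst z \<and> fst z < snd z \<and> snd z < c \<or> c < snd z \<and> snd z < fst z \<and> fst z < L}
    = {(x, y). 0 < x \<and> x < y \<and> y < c \<or> c < y \<and> y < x \<and> x < L}"
    by (auto simp: space_pair_measure)
  finally show ?thesis .
qed

lemma primitive_increment_bound:
  fixes g :: "real \<Rightarrow> real"
  assumes g: "integrable lebesgue g" and "x < y"
  defines "U \<equiv> (\<lambda>x. LINT z|lebesgue. indicator {..x} z * g z)"
  shows "ennreal \<bar>U x - U y\<bar> \<le> (\<integral>\<^sup>+z. indicator {x<..<y} z * ennreal \<bar>g z\<bar> \<partial>lebesgue)"
proof -
  have i: "integrable lebesgue (\<lambda>z. indicator {..x} z * g z)" for x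
    using integrable_mult_indicator[OF _ g, of "{..x}"] by simp
  have "U x - U y = (LINT z|lebesgue. indicator {..x} z * g z - indicator {..y} z * g z)"
    unfolding U_def by (rule Bochner_Integration.integral_diff[symmetric, OF i i])
  then have "ennreal \<bar>U x - U y\<bar> \<le> (\<integral>\<^sup>+z. ennreal (norm (indicator {..x} z * g z - indicator {..y} z * g z)) \<partial>lebesgue)"
    using integral_norm_bound_ennreal[OF Bochner_Integration.integrable_diff[OF i i]] by simp
  also have "\<dots> = (\<integral>\<^sup>+z. indicator {x<..<y} z * ennreal \<bar>g z\<bar> \<partial>lebesgue)"
  proof (rule nn_integral_cong_AE)
    have "AE z in lebesgue. z \<noteq> y"
      by (rule AE_completion) (rule AE_lborel_singleton)
    then show "AE z in lebesgue. ennreal (norm (indicator {..x} z * g z - indicator {..y} z * g z)) = indicator {x<..<y} z * ennreal \<bar>g z\<bar>"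
      by eventually_elim (use \<open>x < y\<close> in \<open>auto simp: indicator_def\<close>)
  qed
  finally show ?thesis .
qed

text \<open>The point \<open>c\<close> and the tilt come from intersecting the splitting curve, traversed so that \<open>c\<close>
increases, with the modes of the tilted weight.  The Schur test is applied once, with the kernel that
joins \<open>x\<close> to the points between \<open>x\<close> and \<open>c\<close>; the test functions of the right half are those for the
tilt \<open>-b\<close>, reflected at the midpoint of the interval.\<close>

lemma weighted_poincare_about_point:
  fixes f g :: "real \<Rightarrow> real" and L p \<kappa> :: real
  assumes L: "L > 0" and p: "p > 1" and \<kappa>: "\<kappa> > 0" and M: "M \<ge> 1" "\<kappa> * L < 2 * half_length p M 0"
    and lc: "log_concave_on {0..L} f" and nn: "\<And>x. x \<in> {0..L} \<Longrightarrow> f x \<ge> 0"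
    and g: "integrable lebesgue g"
  defines "U \<equiv> (\<lambda>x. LINT z|lebesgue. indicator {..x} z * g z)"
  obtains c where "ennreal (\<kappa> powr p) * (\<integral>\<^sup>+x. ennreal (indicator {0<..<L} x * f x * \<bar>U x - U c\<bar> powr p) \<partial>lebesgue)
      \<le> (\<integral>\<^sup>+x. ennreal (indicator {0<..<L} x * f x * \<bar>g x\<bar> powr p) \<partial>lebesgue)"
proof -
  obtain A C where A: "A > 0" "continuous_on {-A..A} C" "C (- A) = L" "C A = 0"
    "\<And>a. a \<in> {-A..A} \<Longrightarrow> C a \<in> {0..L} \<and> supersolvable p \<kappa> a (C a) \<and> supersolvable p \<kappa> (- a) (L - C a)"
    using splitting_curve[OF p \<kappa> L M] by blast
  \<comment> \<open>The parameter is reversed because the splitting point decreases in \<open>a\<close>.\<close>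
  have cC: "continuous_on {-A..A} (\<lambda>r. C (- r))"
    by (rule continuous_on_compose2[OF A(2)]) (auto intro!: continuous_intros)
  have cb: "continuous_on {-A..A} (\<lambda>r. (p - 1) * \<kappa> * (- r))" by (intro continuous_intros)
  obtain r where r: "r \<in> {-A..A}"
    "\<And>x y. 0 < x \<Longrightarrow> x \<le> y \<Longrightarrow> y < C (- r) \<Longrightarrow> f x * exp ((p - 1) * \<kappa> * (- r) * x) \<le> f y * exp ((p - 1) * \<kappa> * (- r) * y)"
    "\<And>x y. C (- r) < x \<Longrightarrow> x \<le> y \<Longrightarrow> y < L \<Longrightarrow> f y * exp ((p - 1) * \<kappa> * (- r) * y) \<le> f x * exp ((p - 1) * \<kappa> * (- r) * x)"
    by (rule tilted_mode_selection[OF lc nn cb cC]) (use A in auto)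
  define a where "a = - r"
  define c where "c = C a"
  have a: "a \<in> {-A..A}" using r(1) by (auto simp: a_def)
  have c: "0 \<le> c" "c \<le> L" and ss: "supersolvable p \<kappa> a c" "supersolvable p \<kappa> (- a) (L - c)"
    using A(5)[OF a] by (auto simp: c_def)
  define b where "b = (p - 1) * \<kappa> * a"
  have up: "f x * exp (b * x) \<le> f y * exp (b * y)" if "0 < x" "x \<le> y" "y < c" for x y
    using r(2)[of x y] that by (simp add: b_def c_def a_def)
  have down: "f y * exp (b * y) \<le> f x * exp (b * x)" if "c < x" "x \<le> y" "y < L" for x y
    using r(3)[of x y] that by (simp add: b_def c_def a_def)
  obtain w1 \<eta>1 where cp1: "comparison_pair p (\<kappa> powr p) b c w1 \<eta>1"
    using comparison_pair_ex[OF p \<kappa> c(1) ss(1)] unfolding b_def by blast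
  have "L - c \<ge> 0" using c by simp
  from comparison_pair_ex[OF p \<kappa> this ss(2)]
  obtain w2 \<eta>2 where cp2: "comparison_pair p (\<kappa> powr p) (- b) (L - c) w2 \<eta>2"
    unfolding b_def by auto
  note w1 = comparison_pairD[OF cp1] and w2 = comparison_pairD[OF cp2]
  note [measurable] = w1(1,2) w2(1,2)
  \<comment> \<open>The point \<open>c\<close>, where the Dirichlet condition holds, is removed; it is a null set.\<close>
  define S where "S = {0<..<c} \<union> {c<..<L}"
  define F where "F = (\<lambda>x. indicator S x * f x)"
  define w where "w = (\<lambda>x. if x < c then w1 x else w2 (L - x))"
  define \<eta> where "\<eta> = (\<lambda>x. if x < c then \<eta>1 x else \<eta>2 (L - x))"
  have [measurable]: "F \<in> borel_measurable borel"
  proof -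
    have [measurable]: "(\<lambda>x. indicator {0<..<L} x * f x) \<in> borel_measurable borel"
      by (rule log_concave_borel_measurable[OF lc nn L])
    have "(\<lambda>x. indicator S x * (indicator {0<..<L} x * f x)) \<in> borel_measurable borel"
      unfolding S_def by measurable
    also have "(\<lambda>x. indicator S x * (indicator {0<..<L} x * f x)) = F"
      using c by (auto simp: F_def S_def fun_eq_iff indicator_def)
    finally show ?thesis .
  qed
  have wm[measurable]: "w \<in> borel_measurable borel" "\<eta> \<in> borel_measurable borel"
    unfolding w_def \<eta>_def by measurable
  have F0: "F x \<ge> 0" for x using nn[of x] c by (auto simp: F_def S_def indicator_def)
  define K where "K = {(x, y). 0 < x \<and> x < y \<and> y < c \<or> c < y \<and> y < x \<and> x < L}"
  have K1: "indicator K (x, y) = (indicator {x<..<c} y :: ennreal)" "indicator K (y, x) = (indicator {0<..<x} y :: ennreal)"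
    if "x \<in> {0<..<c}" for x y using that by (auto simp: K_def indicator_def)
  have K2: "indicator K (x, y) = (indicator {c<..<x} y :: ennreal)" "indicator K (y, x) = (indicator {x<..<L} y :: ennreal)"
    if "x \<in> {c<..<L}" for x y using that by (auto simp: K_def indicator_def)
  have main: "ennreal (\<kappa> powr p) * (\<integral>\<^sup>+x. ennreal (F x * \<bar>U x - U c\<bar> powr p) \<partial>lebesgue) \<le> (\<integral>\<^sup>+y. ennreal (F y * \<bar>g y\<bar> powr p) \<partial>lebesgue)"
  proof (rule schur_test[OF sigma_finite_lebesgue p, where K = K and S = S and w = w and \<eta> = \<eta>])
    show "F \<in> borel_measurable lebesgue" "\<eta> \<in> borel_measurable lebesgue" "w \<in> borel_measurable lebesgue"
      by (auto intro!: measurable_completion)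
    show "g \<in> borel_measurable lebesgue" using g by auto
    show "K \<in> sets (lebesgue \<Otimes>\<^sub>M lebesgue)" unfolding K_def by (rule two_sided_kernel_measurable)
    show "K \<subseteq> S \<times> S" using c by (auto simp: K_def S_def)
    show "\<eta> y > 0" "w y > 0" if "y \<in> S" for y
      using that w1(3,4)[of y] w2(3,4)[of "L - y"] c by (auto simp: S_def \<eta>_def w_def)
    show "F x = 0" if "x \<notin> S" for x using that by (simp add: F_def)
  next
    fix x assume x: "x \<in> S"
    show "(\<integral>\<^sup>+y. indicator K (x, y) * ennreal (\<eta> y) \<partial>lebesgue) \<le> ennreal (w x)"
    proof (cases "x < c")
      case True
      then have x: "x \<in> {0<..<c}" using x by (auto simp: S_def)
      have "(\<integral>\<^sup>+y. indicator K (x, y) * ennreal (\<eta> y) \<partial>lebesgue) = (\<integral>\<^sup>+y. indicator {x<..<c} y * ennreal (\<eta>1 y) \<partial>lborel)"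
        unfolding nn_integral_completion by (intro nn_integral_cong) (simp only: K1[OF x], auto simp: \<eta>_def indicator_def)
      then show ?thesis using w1(5)[OF x] True by (simp add: w_def)
    next
      case False
      then have x: "x \<in> {c<..<L}" using x by (auto simp: S_def)
      have "(\<integral>\<^sup>+y. indicator K (x, y) * ennreal (\<eta> y) \<partial>lebesgue) = (\<integral>\<^sup>+y. indicator {c<..<x} y * ennreal (\<eta>2 (L - y)) \<partial>lborel)"
        unfolding nn_integral_completion by (intro nn_integral_cong) (simp only: K2[OF x], auto simp: \<eta>_def indicator_def)
      also have "\<dots> = (\<integral>\<^sup>+y. indicator {c<..<x} (L - y) * ennreal (\<eta>2 (L - (L - y))) \<partial>lborel)"
        by (subst nn_integral_real_affine[where t = L and c = "-1"]) auto
      also have "\<dots> = (\<integral>\<^sup>+y. indicator {L - x<..<L - c} y * ennreal (\<eta>2 y) \<partial>lborel)"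
        by (intro nn_integral_cong) (auto simp: indicator_def)
      also have "\<dots> \<le> ennreal (w2 (L - x))" by (rule w2(5)) (use x in auto)
      finally show ?thesis using False by (simp add: w_def)
    qed
    show "ennreal \<bar>U x - U c\<bar> \<le> (\<integral>\<^sup>+y. indicator K (x, y) * ennreal \<bar>g y\<bar> \<partial>lebesgue)"
    proof (cases "x < c")
      case True
      then have x: "x \<in> {0<..<c}" using x by (auto simp: S_def)
      show ?thesis unfolding K1[OF x] U_def by (rule primitive_increment_bound[OF g True])
    next
      case False
      then have x: "x \<in> {c<..<L}" using x by (auto simp: S_def)
      show ?thesis unfolding K2[OF x] U_def
        using primitive_increment_bound[OF g, of c x] x by (simp add: abs_minus_commute)
    qed
  next
    fix y assume y: "y \<in> S"
    show "ennreal (\<kappa> powr p) * (\<integral>\<^sup>+x. indicator K (x, y) * ennreal (F x * w x powr (p - 1)) \<partial>lebesgue)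
        \<le> ennreal (F y * \<eta> y powr (p - 1))"
    proof (cases "y < c")
      case True
      then have y: "y \<in> {0<..<c}" using y by (auto simp: S_def)
      have "(\<integral>\<^sup>+x. indicator K (x, y) * ennreal (F x * w x powr (p - 1)) \<partial>lebesgue)
          = (\<integral>\<^sup>+x. indicator {0<..<y} x * ennreal (F x * w1 x powr (p - 1)) \<partial>lborel)"
        unfolding nn_integral_completion using y
        by (intro nn_integral_cong) (simp only: K1[OF y], auto simp: w_def indicator_def)
      also have "ennreal (\<kappa> powr p) * \<dots> \<le> ennreal (F y * \<eta>1 y powr (p - 1))"
      proof (rule w1(6)[OF _ F0 y])
        show "F x * exp (b * x) \<le> F y * exp (b * y)" if "0 < x" "x \<le> y" "y < c" for x y
          using up[of x y] that by (simp add: F_def S_def)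
      qed
      finally show ?thesis using True by (simp add: \<eta>_def)
    next
      case False
      then have y: "y \<in> {c<..<L}" using y by (auto simp: S_def)
      have "(\<integral>\<^sup>+x. indicator K (x, y) * ennreal (F x * w x powr (p - 1)) \<partial>lebesgue)
          = (\<integral>\<^sup>+x. indicator {y<..<L} x * ennreal (F x * w2 (L - x) powr (p - 1)) \<partial>lborel)"
        unfolding nn_integral_completion using y
        by (intro nn_integral_cong) (simp only: K2[OF y], auto simp: w_def indicator_def)
      also have "\<dots> = (\<integral>\<^sup>+x. indicator {y<..<L} (L - x) * ennreal (F (L - x) * w2 (L - (L - x)) powr (p - 1)) \<partial>lborel)"
        by (subst nn_integral_real_affine[where t = L and c = "-1"]) auto
      also have "\<dots> = (\<integral>\<^sup>+x. indicator {0<..<L - y} x * ennreal (F (L - x) * w2 x powr (p - 1)) \<partial>lborel)"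
        by (intro nn_integral_cong) (auto simp: indicator_def)
      also have "ennreal (\<kappa> powr p) * \<dots> \<le> ennreal (F (L - (L - y)) * \<eta>2 (L - y) powr (p - 1))"
      proof (rule w2(6))
        show "F (L - x) * exp (- b * x) \<le> F (L - y) * exp (- b * y)"
          if xy: "0 < x" "x \<le> y" "y < L - c" for x y
        proof -
          have "F (L - x) * exp (b * (L - x)) \<le> F (L - y) * exp (b * (L - y))"
            using down[of "L - y" "L - x"] xy c by (simp add: F_def S_def)
          then have "F (L - x) * exp (b * (L - x)) * exp (- b * L) \<le> F (L - y) * exp (b * (L - y)) * exp (- b * L)"
            by (rule mult_right_mono) auto
          moreover have "exp (b * (L - z)) * exp (- b * L) = exp (- b * z)" for z
            by (simp add: algebra_simps flip: exp_add)
          ultimately show ?thesis by (simp only: mult.assoc)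
        qed
      qed (use y F0 in auto)
      finally show ?thesis using False by (simp add: \<eta>_def)
    qed
  qed (use F0 in auto)
  have cong: "(\<integral>\<^sup>+x. ennreal (F x * h x) \<partial>lebesgue) = (\<integral>\<^sup>+x. ennreal (indicator {0<..<L} x * f x * h x) \<partial>lebesgue)" for h
  proof (rule nn_integral_cong_AE)
    have "AE z in lebesgue. z \<noteq> c"
      by (rule AE_completion) (rule AE_lborel_singleton)
    then show "AE x in lebesgue. ennreal (F x * h x) = ennreal (indicator {0<..<L} x * f x * h x)"
      by eventually_elim (use c in \<open>auto simp: F_def S_def indicator_def\<close>)
  qed
  show ?thesis by (rule that[of c]) (use main in \<open>simp only: cong\<close>)
qed

section \<open>Test functions and weak derivatives on an interval\<close>

text \<open>The class of these functions, with \<open>q\<close> and \<open>m\<close> varying, is closed under differentiation, which makes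
each of them smooth.  With \<open>q = 1\<close>, \<open>m = 0\<close> one obtains the usual bump function.\<close>

definition bump :: "real poly \<Rightarrow> nat \<Rightarrow> real \<Rightarrow> real \<Rightarrow> real \<Rightarrow> real \<Rightarrow> real" where
  "bump q m k \<alpha> \<beta> x =
     (if \<alpha> < x \<and> x < \<beta> then
        poly q x / ((x - \<alpha>) * (\<beta> - x)) ^ m * exp (- k / ((x - \<alpha>) * (\<beta> - x))) else 0)"

lemma has_real_derivative_0_if_quadratic_bound:
  fixes f :: "real \<Rightarrow> real"
  assumes "\<And>x. \<bar>f x\<bar> \<le> C * (x - a)\<^sup>2"
  shows "(f has_real_derivative 0) (at a)"
proof -
  have fa: "f a = 0" using assms[of a] by simp
  have "((\<lambda>h. (f (a + h) - f a) / h) \<longlongrightarrow> 0) (at 0)"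
  proof (rule Lim_null_comparison)
    have "norm ((f (a + h) - f a) / h) \<le> C * \<bar>h\<bar>" if "h \<noteq> 0" for h
      using assms[of "a + h"] that
      by (simp add: fa abs_divide divide_le_eq power2_eq_square mult.assoc)
    then show "\<forall>\<^sub>F h in at 0. norm ((f (a + h) - f a) / h) \<le> C * \<bar>h\<bar>"
      by (auto simp: eventually_at_filter)
    show "((\<lambda>h. C * \<bar>h\<bar>) \<longlongrightarrow> 0) (at 0)"
      by (auto intro!: tendsto_eq_intros)
  qed
  then show ?thesis by (simp add: DERIV_def)
qed

lemma power_le_fact_mult_exp:
  fixes y :: real
  assumes "y \<ge> 0" shows "y ^ n \<le> fact n * exp y"
proof -
  have "(\<Sum>k\<in>{n}. y ^ k /\<^sub>R fact k) \<le> (\<Sum>k. y ^ k /\<^sub>R fact k)"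
    using assms by (intro sum_le_suminf summable_exp_generic) auto
  then show ?thesis by (simp add: exp_def field_simps)
qed

text \<open>The exponential dominates every power of \<open>1 / w\<close> where \<open>w = (x - \<alpha>) (\<beta> - x)\<close>.  A quadratic bound is what
differentiability at the two end points requires.\<close>

lemma bump_quadratic_bound:
  assumes "\<alpha> < \<beta>" "k > 0"
  obtains C where "\<And>x. \<bar>bump q m k \<alpha> \<beta> x\<bar> \<le> C * (x - \<alpha>)\<^sup>2" "\<And>x. \<bar>bump q m k \<alpha> \<beta> x\<bar> \<le> C * (x - \<beta>)\<^sup>2"
proof -
  have "bounded (poly q ` {\<alpha>..\<beta>})"
    by (intro compact_imp_bounded compact_continuous_image continuous_intros) auto
  then obtain Q where "\<forall>y\<in>poly q ` {\<alpha>..\<beta>}. \<bar>y\<bar> \<le> Q"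
    by (auto simp: bounded_real)
  then have Q: "\<bar>poly q x\<bar> \<le> Q" if "x \<in> {\<alpha>..\<beta>}" for x
    using that by blast
  have Q0: "Q \<ge> 0" using Q[of \<alpha>] assms by auto
  define n where "n = m + 2"
  define C where "C = Q * (fact n / k ^ n) * (\<beta> - \<alpha>)\<^sup>2"
  have C0: "C \<ge> 0" using Q0 assms by (simp add: C_def)
  have main: "\<bar>bump q m k \<alpha> \<beta> x\<bar> \<le> Q * (fact n / k ^ n) * ((x - \<alpha>) * (\<beta> - x))\<^sup>2"
    if x: "\<alpha> < x" "x < \<beta>" for x
  proof -
    define w where "w = (x - \<alpha>) * (\<beta> - x)"
    have w: "w > 0" using x by (simp add: w_def)
    have "(k / w) ^ n \<le> fact n * exp (k / w)"
      using w assms by (intro power_le_fact_mult_exp) auto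
    then have "exp (- (k / w)) \<le> fact n / k ^ n * w ^ n"
      using w assms by (simp add: exp_minus field_simps power_divide)
    then have e: "exp (- k / w) / w ^ m \<le> fact n / k ^ n * w\<^sup>2"
      using w by (simp add: n_def field_simps power_add power2_eq_square)
    have "\<bar>bump q m k \<alpha> \<beta> x\<bar> = \<bar>poly q x\<bar> * (exp (- k / w) / w ^ m)"
      using x w by (simp add: bump_def w_def [symmetric] abs_mult)
    also have "\<dots> \<le> Q * (fact n / k ^ n * w\<^sup>2)"
      using Q[of x] x e w by (intro mult_mono Q0) auto
    finally show ?thesis by (simp add: w_def mult.assoc)
  qed
  have le: "Q * (fact n / k ^ n) * ((x - \<alpha>) * (\<beta> - x))\<^sup>2 \<le> Q * (fact n / k ^ n) * ((\<beta> - \<alpha>) * y)\<^sup>2"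
    if "\<alpha> < x" "x < \<beta>" "y = x - \<alpha> \<or> y = \<beta> - x" for x y
  proof (intro mult_left_mono power_mono)
    show "(x - \<alpha>) * (\<beta> - x) \<le> (\<beta> - \<alpha>) * y"
      using that by (auto simp: mult.commute intro!: mult_right_mono)
  qed (use that Q0 assms in auto)
  show ?thesis
  proof
    fix x
    have "(x - \<beta>)\<^sup>2 = (\<beta> - x)\<^sup>2" by (simp add: power2_commute)
    then show "\<bar>bump q m k \<alpha> \<beta> x\<bar> \<le> C * (x - \<beta>)\<^sup>2" 
      using main[of x] le[of x "\<beta> - x"] mult_nonneg_nonneg[OF C0 zero_le_power2[of "x - \<beta>"]]
      by (cases "\<alpha> < x \<and> x < \<beta>") (auto simp: C_def power_mult_distrib mult.assoc bump_def)
    show "\<bar>bump q m k \<alpha> \<beta> x\<bar> \<le> C * (x - \<alpha>)\<^sup>2" 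
      using main[of x] le[of x "x - \<alpha>"] mult_nonneg_nonneg[OF C0 zero_le_power2[of "x - \<alpha>"]]
      by (cases "\<alpha> < x \<and> x < \<beta>") (auto simp: C_def power_mult_distrib mult.assoc bump_def)
  qed
qed

definition bump_deriv_poly :: "real poly \<Rightarrow> nat \<Rightarrow> real \<Rightarrow> real \<Rightarrow> real \<Rightarrow> real poly" where
  "bump_deriv_poly q m k \<alpha> \<beta> =
     (let w = [:- \<alpha>, 1:] * [:\<beta>, - 1:]; w' = [:\<alpha> + \<beta>, - 2:]
      in pderiv q * w ^ 2 - smult (of_nat m) (q * w * w') + smult k (q * w'))"

lemma has_real_derivative_bump:
  assumes "\<alpha> < \<beta>" "k > 0"
  shows "(bump q m k \<alpha> \<beta> has_real_derivative
            bump (bump_deriv_poly q m k \<alpha> \<beta>) (m + 2) k \<alpha> \<beta> x) (at x)"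
proof -
  let ?q = "bump_deriv_poly q m k \<alpha> \<beta>"
  consider "x < \<alpha>" | "x > \<beta>" | "x = \<alpha>" | "x = \<beta>" | "\<alpha> < x" "x < \<beta>" by linarith
  then show ?thesis
  proof cases
    case 1
    have "((\<lambda>_. 0) has_real_derivative 0) (at x)" by simp
    then have "(bump q m k \<alpha> \<beta> has_real_derivative 0) (at x)"
      by (rule has_field_derivative_transform_within_open[of _ _ _ "{..<\<alpha>}"])
         (use 1 in \<open>auto simp: bump_def\<close>)
    then show ?thesis using 1 by (simp add: bump_def[of ?q])
  next
    case 2
    have "((\<lambda>_. 0) has_real_derivative 0) (at x)" by simp
    then have "(bump q m k \<alpha> \<beta> has_real_derivative 0) (at x)"
      by (rule has_field_derivative_transform_within_open[of _ _ _ "{\<beta><..}"])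
         (use 2 in \<open>auto simp: bump_def\<close>)
    then show ?thesis using 2 by (simp add: bump_def[of ?q])
  next
    case 3
    then show ?thesis
      by (metis bump_def bump_quadratic_bound[OF assms] has_real_derivative_0_if_quadratic_bound less_irrefl)
  next
    case 4
    then show ?thesis
      by (metis bump_def bump_quadratic_bound[OF assms] has_real_derivative_0_if_quadratic_bound less_irrefl)
  next
    case 5
    define w where "w = (\<lambda>x. (x - \<alpha>) * (\<beta> - x))"
    have w: "w x > 0" using 5 by (simp add: w_def)
    have dw: "(w has_real_derivative (\<alpha> + \<beta> - 2 * x)) (at x)"
      unfolding w_def by (auto intro!: derivative_eq_intros)
    define w' where "w' = \<alpha> + \<beta> - 2 * x"
    have de: "((\<lambda>x. exp (- k / w x)) has_real_derivative exp (- k / w x) * (k * w' / (w x)\<^sup>2)) (at x)"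
      using dw w by (auto intro!: derivative_eq_intros simp: w'_def power2_eq_square)
    have dp: "((\<lambda>x. w x ^ m) has_real_derivative of_nat m * w x ^ m / w x * w') (at x)"
    proof -
      have "of_nat m * w x ^ m / w x * w' = of_nat m * (w' * w x ^ (m - Suc 0))"
        using w by (cases m) auto
      then show ?thesis
        using DERIV_power[OF dw, of m] by (simp add: w'_def)
    qed
    have "((\<lambda>x. poly q x / w x ^ m * exp (- k / w x)) has_real_derivative
        ((poly (pderiv q) x * w x ^ m - poly q x * (of_nat m * w x ^ m / w x * w')) / (w x ^ m * w x ^ m)) 
           * exp (- k / w x) + exp (- k / w x) * (k * w' / (w x)\<^sup>2) * (poly q x / w x ^ m)) (at x)"
      by (rule DERIV_mult[OF DERIV_divide[OF poly_DERIV dp] de]) (use w in auto)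
    also have "((poly (pderiv q) x * w x ^ m - poly q x * (of_nat m * w x ^ m / w x * w')) / (w x ^ m * w x ^ m)) 
           * exp (- k / w x) + exp (- k / w x) * (k * w' / (w x)\<^sup>2) * (poly q x / w x ^ m)
        = poly ?q x / w x ^ (m + 2) * exp (- k / w x)"
    proof -
      have pq: "poly ?q x = poly (pderiv q) x * (w x)\<^sup>2 - of_nat m * (poly q x * w x * w') + k * (poly q x * w')"
        by (simp add: bump_deriv_poly_def w_def w'_def algebra_simps power2_eq_square)
      have "w x ^ m \<noteq> 0" using w by simp
      define z where "z = w x ^ m"
      define v where "v = w x"
      have zv: "z \<noteq> 0" "v \<noteq> 0" using w by (auto simp: z_def v_def)
      show ?thesis
        unfolding pq power_add unfolding z_def[symmetric] v_def[symmetric]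
        using zv by (simp add: field_simps power2_eq_square)
    qed
    finally have "((\<lambda>x. poly q x / w x ^ m * exp (- k / w x)) has_real_derivative
        poly ?q x / w x ^ (m + 2) * exp (- k / w x)) (at x)" .
    then have "(bump q m k \<alpha> \<beta> has_real_derivative poly ?q x / w x ^ (m + 2) * exp (- k / w x)) (at x)"
      by (rule has_field_derivative_transform_within_open[of _ _ _ "{\<alpha><..<\<beta>}"])
         (use 5 in \<open>auto simp: bump_def w_def\<close>)
    then show ?thesis using 5 by (simp add: bump_def[of ?q] w_def)
  qed
qed

text \<open>The regularity part of \<open>test_function_on\<close>.\<close>

definition smooth :: "(real \<Rightarrow> real) \<Rightarrow> bool" where
  "smooth \<phi> \<longleftrightarrow> (\<forall>n x. (deriv ^^ n) \<phi> differentiable at x)"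

lemma smooth_bump:
  assumes "\<alpha> < \<beta>" "k > 0"
  shows "smooth (bump q m k \<alpha> \<beta>)"
proof -
  have d: "deriv (bump q m k \<alpha> \<beta>) = bump (bump_deriv_poly q m k \<alpha> \<beta>) (m + 2) k \<alpha> \<beta>" for q m
    by (rule ext) (rule DERIV_imp_deriv[OF has_real_derivative_bump[OF assms]])
  have "\<exists>q' m'. (deriv ^^ n) (bump q m k \<alpha> \<beta>) = bump q' m' k \<alpha> \<beta>" for n
    by (induction n) (use d in \<open>auto, metis\<close>)
  then show ?thesis
    using has_real_derivative_bump[OF assms] unfolding smooth_def
    by (metis real_differentiable_def)
qed

lemma smooth_antiderivative:
  assumes "smooth \<psi>" "\<And>x. (\<phi> has_real_derivative \<psi> x) (at x)"
  shows "smooth \<phi>"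
  unfolding smooth_def
proof (intro allI)
  fix n x
  have "deriv \<phi> = \<psi>" using assms(2) DERIV_imp_deriv by blast
  then show "(deriv ^^ n) \<phi> differentiable at x"
    using assms
    by (cases n) (auto simp: smooth_def funpow_Suc_right real_differentiable_def simp del: funpow.simps)
qed

lemma smooth_diff_cmult:
  assumes "smooth f" "smooth g"
  shows "smooth (\<lambda>x. f x - c * g x)"
proof -
  have D: "((deriv ^^ n) f has_real_derivative (deriv ^^ Suc n) f x) (at x)" if "smooth f" for f n x
    using that by (simp add: smooth_def DERIV_deriv_iff_real_differentiable)
  have "(deriv ^^ n) (\<lambda>x. f x - c * g x) = (\<lambda>x. (deriv ^^ n) f x - c * (deriv ^^ n) g x)" for n
  proof (induction n)
    case (Suc n)
    have "((\<lambda>x. (deriv ^^ n) f x - c * (deriv ^^ n) g x) has_real_derivative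
            (deriv ^^ Suc n) f x - c * (deriv ^^ Suc n) g x) (at x)" for x
      by (intro DERIV_diff DERIV_cmult D assms)
    then show ?case using Suc by (auto intro!: ext DERIV_imp_deriv)
  qed simp
  moreover have "((\<lambda>x. (deriv ^^ n) f x - c * (deriv ^^ n) g x) has_real_derivative
            (deriv ^^ Suc n) f x - c * (deriv ^^ Suc n) g x) (at x)" for n x
      by (intro DERIV_diff DERIV_cmult D assms)
  ultimately show ?thesis unfolding smooth_def
    by (metis real_differentiable_def)
qed

lemma test_function_onI:
  assumes "smooth \<phi>" "\<And>x. x \<notin> {c..d} \<Longrightarrow> \<phi> x = 0" "{c..d} \<subseteq> S"
  shows "test_function_on S \<phi>"
proof -
  have "{x. \<phi> x \<noteq> 0} \<subseteq> {c..d}"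
    using assms(2) by blast
  then have sub: "closure {x. \<phi> x \<noteq> 0} \<subseteq> {c..d}"
    by (intro closure_minimal) auto
  then have "compact (closure {x. \<phi> x \<noteq> 0})"
    by (meson bounded_closed_interval bounded_subset closed_closure compact_eq_bounded_closed)
  then show ?thesis using sub assms by (auto simp: test_function_on_def smooth_def)
qed

lemma smooth_imp_continuous: "smooth f \<Longrightarrow> continuous_on S f"
  unfolding smooth_def
  by (metis continuous_at_imp_continuous_on differentiable_imp_continuous_within funpow_0)

lemma test_function_antiderivative:
  assumes \<psi>: "smooth \<psi>" and z: "\<And>x. x \<notin> {c..d} \<Longrightarrow> \<psi> x = 0"
    and I: "integral {c..d} \<psi> = 0" and "c < d" "{c..d} \<subseteq> S"
  obtains \<phi> where "test_function_on S \<phi>" "\<And>x. (\<phi> has_real_derivative \<psi> x) (at x)"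
proof -
  define \<phi> where "\<phi> = (\<lambda>x. integral {c - 1..x} \<psi>)"
  have int: "\<psi> integrable_on {a..b}" for a b
    by (intro integrable_continuous_interval smooth_imp_continuous \<psi>)
  have \<phi>0: "\<phi> x = 0" if "x \<le> c" for x
  proof -
    have "\<phi> x = integral {c - 1..x} (\<lambda>_. 0)"
      unfolding \<phi>_def
      by (rule integral_spike[of "{c}"]) (use that z in auto)
    then show ?thesis by simp
  qed
  have \<phi>1: "\<phi> x = 0" if "x \<ge> d" for x
  proof -
    have "\<phi> x = integral {c - 1..c} \<psi> + integral {c..d} \<psi> + integral {d..x} \<psi>"
      unfolding \<phi>_def using that \<open>c < d\<close> int by (simp add: Henstock_Kurzweil_Integration.integral_combine)
    also have "integral {d..x} \<psi> = integral {d..x} (\<lambda>_. 0)"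
      by (rule integral_spike[of "{d}"]) (use that z in auto)
    finally show ?thesis using I \<phi>0[of c] by (simp add: \<phi>_def)
  qed
  have D: "(\<phi> has_real_derivative \<psi> x) (at x)" for x
  proof (cases "x < c")
    case True
    have "((\<lambda>_. 0) has_real_derivative 0) (at x)" by simp
    then have "(\<phi> has_real_derivative 0) (at x)"
      by (rule has_field_derivative_transform_within_open[of _ _ _ "{..<c}"])
         (use True \<phi>0 in auto)
    then show ?thesis using True z by simp
  next
    case False
    have "(\<phi> has_real_derivative \<psi> x) (at x within {c - 1..x + 1})"
      unfolding \<phi>_def using False
      by (intro integral_has_real_derivative smooth_imp_continuous \<psi>) auto
    then show ?thesis using False by (subst (asm) at_within_interior) auto
  qed
  have "test_function_on S \<phi>"
    by (rule test_function_onI[of _ c d]) (use smooth_antiderivative[OF \<psi> D] \<phi>0 \<phi>1 assms in auto)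
  then show ?thesis using D that by blast
qed

lemma test_function_continuous: "test_function_on S \<phi> \<Longrightarrow> continuous_on A \<phi>"
  by (rule smooth_imp_continuous) (simp add: test_function_on_def smooth_def)

lemma bump_1_le_1:
  assumes "k > 0" shows "0 \<le> bump 1 0 k \<alpha> \<beta> x" "bump 1 0 k \<alpha> \<beta> x \<le> 1"
  using assms by (auto simp: bump_def)

text \<open>As \<open>k\<close> tends to zero, the bump with exponent \<open>- k / w\<close> flattens to the indicator of its interval.\<close>

lemma bump_tendsto_indicator:
  "(\<lambda>n. bump 1 0 (1 / real (Suc n)) \<alpha> \<beta> x) \<longlonglongrightarrow> indicator {\<alpha><..<\<beta>} x"
proof (cases "\<alpha> < x \<and> x < \<beta>")
  case True
  have "(\<lambda>n. exp (- (1 / real (Suc n)) / ((x - \<alpha>) * (\<beta> - x)))) \<longlonglongrightarrow> exp (- 0 / ((x - \<alpha>) * (\<beta> - x)))"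
    using True by (intro tendsto_intros LIMSEQ_Suc[OF lim_1_over_n]) auto
  then show ?thesis using True by (simp add: bump_def)
qed (auto simp: bump_def)

lemma test_function_bump:
  assumes "\<alpha> < \<beta>" "k > 0" "{\<alpha>..\<beta>} \<subseteq> S"
  shows "test_function_on S (bump 1 0 k \<alpha> \<beta>)"
  by (rule test_function_onI[of _ \<alpha> \<beta>]) (use assms smooth_bump in \<open>auto simp: bump_def\<close>)

lemma locally_integrable_bounded_mult:
  fixes w \<psi> :: "real \<Rightarrow> real"
  assumes w: "set_integrable lebesgue {c..d} w" and \<psi>: "continuous_on UNIV \<psi>" "\<And>x. x \<notin> {c..d} \<Longrightarrow> \<psi> x = 0"
    and S: "{c..d} \<subseteq> S"
  shows "set_integrable lebesgue S (\<lambda>x. w x * \<psi> x)"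
proof -
  have "bounded (\<psi> ` {c..d})"
    by (intro compact_imp_bounded compact_continuous_image continuous_on_subset[OF \<psi>(1)]) auto
  then obtain B where B: "\<forall>y\<in>\<psi> ` {c..d}. \<bar>y\<bar> \<le> B" by (auto simp: bounded_real)
  have i: "integrable lebesgue (\<lambda>x. indicator {c..d} x * w x)" using w by (simp add: set_integrable_def)
  have m: "\<psi> \<in> borel_measurable lebesgue"
    using borel_measurable_continuous_onI[OF \<psi>(1)] by (simp add: measurable_completion)
  have "integrable lebesgue (\<lambda>x. indicator S x *\<^sub>R (w x * \<psi> x))"
  proof (rule Bochner_Integration.integrable_bound)
    show "integrable lebesgue (\<lambda>x. B * (indicator {c..d} x * w x))" using i by simp
    have eq: "(\<lambda>x. indicator S x *\<^sub>R (w x * \<psi> x)) = (\<lambda>x. (indicator {c..d} x * w x) * \<psi> x)"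
      using S \<psi>(2) by (auto simp: fun_eq_iff indicator_def)
    show "(\<lambda>x. indicator S x *\<^sub>R (w x * \<psi> x)) \<in> borel_measurable lebesgue"
      unfolding eq by (rule borel_measurable_times[OF borel_measurable_integrable[OF i] m])
    have "\<bar>\<psi> x\<bar> \<le> \<bar>B\<bar>" if "x \<in> {c..d}" for x using B that by force
    then have "norm (indicator S x *\<^sub>R (w x * \<psi> x)) \<le> norm (B * (indicator {c..d} x * w x))" for x
      using S \<psi>(2)[of x] by (auto simp: indicator_def abs_mult mult.commute[of "\<bar>B\<bar>"] intro!: mult_left_mono)
    then show "AE x in lebesgue. norm (indicator S x *\<^sub>R (w x * \<psi> x)) \<le> norm (B * (indicator {c..d} x * w x))"
      by simp
  qed
  then show ?thesis by (simp add: set_integrable_def)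
qed

text \<open>Almost everywhere \<open>w x\<close> is the limit of the averages of \<open>w\<close> over \<open>[x, x + h]\<close>.\<close>

lemma AE_zero_if_interval_integrals_zero:
  fixes w :: "real \<Rightarrow> real"
  assumes w: "set_integrable lebesgue {c..d} w"
    and z: "\<And>\<alpha> \<beta>. c \<le> \<alpha> \<Longrightarrow> \<alpha> < \<beta> \<Longrightarrow> \<beta> \<le> d \<Longrightarrow> (LINT x:{\<alpha><..<\<beta>}|lebesgue. w x) = 0"
  shows "AE x in lebesgue. x \<in> {c<..<d} \<longrightarrow> w x = 0"
proof -
  let ?W = "\<lambda>x. if x \<in> {c..d} then w x else 0"
  have "w integrable_on {c..d}" by (rule set_lebesgue_integral_eq_integral(1)[OF w])
  then have "?W integrable_on UNIV" by (simp only: integrable_restrict_UNIV)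
  then have "?W integrable_on cbox a b" for a b
    by (rule integrable_on_subcbox) auto
  then obtain N where N: "negligible N" "\<And>x e. \<lbrakk>x \<notin> N; 0 < e\<rbrakk> \<Longrightarrow>
     \<exists>d>0. \<forall>h. 0 < h \<and> h < d \<longrightarrow> norm (integral (cbox x (x + h *\<^sub>R One)) ?W /\<^sub>R h ^ DIM(real) - ?W x) < e"
    using integrable_ccontinuous_explicit by blast
  have zero: "w x = 0" if x: "x \<notin> N" "x \<in> {c<..<d}" for x
  proof (rule ccontr)
    assume "w x \<noteq> 0"
    then obtain \<delta> where \<delta>: "\<delta> > 0" "\<And>h. 0 < h \<and> h < \<delta> \<Longrightarrow> norm (integral (cbox x (x + h *\<^sub>R One)) ?W /\<^sub>R h ^ DIM(real) - ?W x) < \<bar>w x\<bar>"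
      using N(2)[OF x(1), of "\<bar>w x\<bar>"] by auto
    define h where "h = min (\<delta> / 2) (d - x)"
    have h: "0 < h" "h < \<delta>" "x + h \<le> d" using \<delta>(1) x by (auto simp: h_def min_def)
    have "integral {x..x + h} ?W = integral {x<..<x + h} w"
    proof -
      have "integral {x..x + h} ?W = integral {x..x + h} w"
        by (rule Henstock_Kurzweil_Integration.integral_cong) (use h x in auto)
      also have "\<dots> = integral {x<..<x + h} w"
        using integral_open_interval_real[of x "x + h" w] by simp
      finally show ?thesis .
    qed
    also have "\<dots> = (LINT y:{x<..<x + h}|lebesgue. w y)"
      by (rule set_lebesgue_integral_eq_integral(2)[symmetric])
         (use h x in \<open>auto intro!: set_integrable_subset[OF w]\<close>)
    also have "\<dots> = 0" using h x by (intro z) auto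
    finally have "integral {x..x + h} ?W = 0" .
    then show False using \<delta>(2)[of h] h x by simp
  qed
  have "N \<in> null_sets lebesgue" using N(1) by (simp add: negligible_iff_null_sets)
  then have "AE x in lebesgue. x \<notin> N" by (rule AE_not_in)
  then show ?thesis by eventually_elim (use zero in blast)
qed

text \<open>By dominated convergence along the flattening bumps, the integral of \<open>w\<close> over every compactly
contained interval vanishes.\<close>

lemma fundamental_lemma_calculus_of_variations:
  fixes w :: "real \<Rightarrow> real"
  assumes w: "locally_integrable_on {a<..<b} w"
    and z: "\<And>\<psi>. test_function_on {a<..<b} \<psi> \<Longrightarrow> (LINT x:{a<..<b}|lebesgue. w x * \<psi> x) = 0"
  shows "AE x in lebesgue. x \<in> {a<..<b} \<longrightarrow> w x = 0"
proof -
  have int0: "(LINT x:{\<alpha><..<\<beta>}|lebesgue. w x) = 0" if \<alpha>\<beta>: "a < \<alpha>" "\<alpha> < \<beta>" "\<beta> < b" for \<alpha> \<beta>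
  proof -
    let ?k = "\<lambda>n. 1 / real (Suc n)"
    have w': "set_integrable lebesgue {\<alpha>..\<beta>} w"
    proof -
      have "{\<alpha>..\<beta>} \<subseteq> {a<..<b}" using \<alpha>\<beta> by auto
      then show ?thesis using w unfolding locally_integrable_on_def by blast
    qed
    then have i: "integrable lebesgue (\<lambda>x. indicator {\<alpha>..\<beta>} x * w x)" by (simp add: set_integrable_def)
    have "(\<lambda>n. LINT x|lebesgue. (indicator {\<alpha>..\<beta>} x * w x) * bump 1 0 (?k n) \<alpha> \<beta> x)
       \<longlonglongrightarrow> (LINT x|lebesgue. (indicator {\<alpha>..\<beta>} x * w x) * indicator {\<alpha><..<\<beta>} x)"
    proof (rule integral_dominated_convergence[where w = "\<lambda>x. \<bar>indicator {\<alpha>..\<beta>} x * w x\<bar>"])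
      show "(\<lambda>x. (indicator {\<alpha>..\<beta>} x * w x) * indicator {\<alpha><..<\<beta>} x) \<in> borel_measurable lebesgue"
        by (rule borel_measurable_times[OF borel_measurable_integrable[OF i]])
           (intro borel_measurable_indicator, simp)
      have "bump 1 0 (?k n) \<alpha> \<beta> \<in> borel_measurable borel" for n
        by (intro borel_measurable_continuous_onI smooth_imp_continuous smooth_bump) (use \<alpha>\<beta> in auto)
      then show "(\<lambda>x. (indicator {\<alpha>..\<beta>} x * w x) * bump 1 0 (?k n) \<alpha> \<beta> x) \<in> borel_measurable lebesgue" for n
        by (intro borel_measurable_times[OF borel_measurable_integrable[OF i]] measurable_completion) simp
      show "AE x in lebesgue. (\<lambda>n. (indicator {\<alpha>..\<beta>} x * w x) * bump 1 0 (?k n) \<alpha> \<beta> x) \<longlonglongrightarrow> (indicator {\<alpha>..\<beta>} x * w x) * indicator {\<alpha><..<\<beta>} x"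
        by (intro always_eventually allI tendsto_mult_left bump_tendsto_indicator)
      show "AE x in lebesgue. norm ((indicator {\<alpha>..\<beta>} x * w x) * bump 1 0 (?k n) \<alpha> \<beta> x) \<le> \<bar>indicator {\<alpha>..\<beta>} x * w x\<bar>" for n
        using bump_1_le_1[of "?k n" \<alpha> \<beta>] by (intro always_eventually allI) (auto simp: abs_mult intro!: mult_left_le)
    qed (use i in auto)
    moreover have "(LINT x|lebesgue. (indicator {\<alpha>..\<beta>} x * w x) * bump 1 0 (?k n) \<alpha> \<beta> x) = 0" for n
    proof -
      have "(LINT x:{a<..<b}|lebesgue. w x * bump 1 0 (?k n) \<alpha> \<beta> x) = 0"
        by (intro z test_function_bump) (use \<alpha>\<beta> in auto)
      also have "(LINT x:{a<..<b}|lebesgue. w x * bump 1 0 (?k n) \<alpha> \<beta> x) = (LINT x|lebesgue. (indicator {\<alpha>..\<beta>} x * w x) * bump 1 0 (?k n) \<alpha> \<beta> x)"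
        unfolding set_lebesgue_integral_def using \<alpha>\<beta>
        by (intro Bochner_Integration.integral_cong) (auto simp: indicator_def bump_def)
      finally show ?thesis .
    qed
    ultimately have "(LINT x|lebesgue. (indicator {\<alpha>..\<beta>} x * w x) * indicator {\<alpha><..<\<beta>} x) = 0"
      using LIMSEQ_unique[OF tendsto_const] by fastforce
    also have "(LINT x|lebesgue. (indicator {\<alpha>..\<beta>} x * w x) * indicator {\<alpha><..<\<beta>} x) = (LINT x:{\<alpha><..<\<beta>}|lebesgue. w x)"
      unfolding set_lebesgue_integral_def
      by (intro Bochner_Integration.integral_cong) (auto simp: indicator_def)
    finally show ?thesis .
  qed
  define c where "c = (\<lambda>n. a + 1 / real (Suc n))"
  define d where "d = (\<lambda>n. b - 1 / real (Suc n))"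
  have "AE x in lebesgue. x \<in> {c n<..<d n} \<longrightarrow> w x = 0" for n
  proof (rule AE_zero_if_interval_integrals_zero)
    show "set_integrable lebesgue {c n..d n} w"
    proof -
      have "a < c n" "d n < b" by (auto simp: c_def d_def)
      then have "{c n..d n} \<subseteq> {a<..<b}" by auto
      then show ?thesis using w unfolding locally_integrable_on_def by blast
    qed
    fix \<alpha> \<beta> assume "c n \<le> \<alpha>" "\<alpha> < \<beta>" "\<beta> \<le> d n"
    moreover have "a < c n" "d n < b" by (auto simp: c_def d_def)
    ultimately show "(LINT x:{\<alpha><..<\<beta>}|lebesgue. w x) = 0" by (intro int0) auto
  qed
  then have "AE x in lebesgue. \<forall>n. x \<in> {c n<..<d n} \<longrightarrow> w x = 0" unfolding AE_all_countable by blast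
  then show ?thesis
  proof eventually_elim
    case (elim x)
    show ?case
    proof
      assume x: "x \<in> {a<..<b}"
      then have "min (x - a) (b - x) > 0" by auto
      then obtain n where "inverse (real (Suc n)) < min (x - a) (b - x)" using reals_Archimedean by blast
      then have "x \<in> {c n<..<d n}" by (auto simp: c_def d_def inverse_eq_divide)
      then show "w x = 0" using elim by blast
    qed
  qed
qed

lemma test_function_support_bounds:
  assumes ab: "a < b" and \<phi>: "test_function_on {a<..<b} \<phi>"
  obtains c d where "a < c" "c < d" "d < b" "\<And>x. x \<notin> {c..d} \<Longrightarrow> \<phi> x = 0"
proof -
  let ?K = "closure {x. \<phi> x \<noteq> 0}"
  have K: "compact ?K" "?K \<subseteq> {a<..<b}" using \<phi> by (auto simp: test_function_on_def)
  define m where "m = (a + b) / 2"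
  have m: "m \<in> {a<..<b}" using ab by (auto simp: m_def)
  have K': "compact (insert m ?K)" "insert m ?K \<noteq> {}" using K by auto
  obtain c where c: "c \<in> insert m ?K" "\<forall>x\<in>insert m ?K. c \<le> x"
    using compact_attains_inf[OF K'] by metis
  obtain d where d: "d \<in> insert m ?K" "\<forall>x\<in>insert m ?K. x \<le> d"
    using compact_attains_sup[OF K'] by metis
  have "insert m ?K \<subseteq> {a<..<b}" using K(2) m by simp
  then have cd: "c \<in> {a<..<b}" "d \<in> {a<..<b}" using c(1) d(1) by (meson subsetD)+
  have "c \<le> d" using c(2) d(1) by meson
  have out: "\<phi> x = 0" if "x \<notin> {c..d}" for x
  proof (rule ccontr)
    assume "\<phi> x \<noteq> 0"
    then have "x \<in> {x. \<phi> x \<noteq> 0}" by simp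
    then have "x \<in> insert m ?K" by (meson closure_subset insertI2 subsetD)
    then have "c \<le> x" "x \<le> d" using c(2) d(2) by (meson bspec)+
    then show False using that by simp
  qed
  show ?thesis
    by (rule that[of c "(d + b) / 2"]) (use cd \<open>c \<le> d\<close> out in auto)
qed

lemma set_integrable_mult_test_function:
  assumes ab: "a < b" and \<phi>: "test_function_on {a<..<b} \<phi>" and v: "locally_integrable_on {a<..<b} v"
  shows "set_integrable lebesgue {a<..<b} (\<lambda>x. v x * \<phi> x)"
proof -
  obtain c d where "a < c" "d < b" "\<And>x. x \<notin> {c..d} \<Longrightarrow> \<phi> x = 0"
    using test_function_support_bounds[OF ab \<phi>] by blast
  moreover from this have sub: "{c..d} \<subseteq> {a<..<b}" by auto
  moreover have "set_integrable lebesgue {c..d} v"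
    using v sub unfolding locally_integrable_on_def by blast
  ultimately show ?thesis
    by (intro locally_integrable_bounded_mult[of c d] test_function_continuous[OF \<phi>]) auto
qed

text \<open>Every test function \<open>\<psi>\<close> differs by a multiple of one fixed bump \<open>\<beta>\<close> from the derivative of a test
function, namely of the primitive of \<open>\<psi> - k \<beta>\<close>, where \<open>k\<close> makes the total integral vanish.  Hence
\<open>\<integral> w \<psi> = k \<integral> w \<beta> = C \<integral> \<psi>\<close>, and the fundamental lemma applies to \<open>w - C\<close>.\<close>

lemma du_bois_reymond:
  fixes w :: "real \<Rightarrow> real"
  assumes ab: "a < b" and w: "locally_integrable_on {a<..<b} w"
    and z: "\<And>\<phi>. test_function_on {a<..<b} \<phi> \<Longrightarrow> (LINT x:{a<..<b}|lebesgue. w x * deriv \<phi> x) = 0"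
  obtains C where "AE x in lebesgue. x \<in> {a<..<b} \<longrightarrow> w x = C"
proof -
  let ?S = "{a<..<b}"
  note prod_int = set_integrable_mult_test_function[OF ab]
  have one: "locally_integrable_on ?S (\<lambda>_. 1)"
  proof -
    have "set_integrable lebesgue K (\<lambda>_. 1 :: real)" if "compact K" for K :: "real set"
      using that by (intro absolutely_integrable_on_const lmeasurable_compact)
    then show ?thesis by (auto simp: locally_integrable_on_def)
  qed
  obtain c0 d0 where cd0: "a < c0" "c0 < d0" "d0 < b"
    by (rule that[of "(2 * a + b) / 3" "(a + 2 * b) / 3"]) (use ab in auto)
  define \<beta> where "\<beta> = bump 1 0 1 c0 d0"
  have \<beta>: "test_function_on ?S \<beta>" unfolding \<beta>_def by (rule test_function_bump) (use cd0 in auto)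
  \<comment> \<open>The factor \<open>1\<close> lets the integrability of products with test functions apply.\<close>
  define J where "J = (LINT x:?S|lebesgue. 1 * \<beta> x)"
  have "J > 0"
  proof -
    have nn: "J \<ge> 0" unfolding J_def \<beta>_def set_lebesgue_integral_def
      by (rule Bochner_Integration.integral_nonneg) (auto simp: bump_1_le_1)
    have "J \<noteq> 0"
    proof
      assume "J = 0"
      then have "AE x in lebesgue. indicator ?S x * \<beta> x = 0"
        using prod_int[OF \<beta> one] bump_1_le_1[of 1 c0 d0] unfolding J_def set_lebesgue_integral_def set_integrable_def
        by (subst (asm) integral_nonneg_eq_0_iff_AE) (auto simp: \<beta>_def)
      then have "AE x in lebesgue. x \<notin> {c0<..<d0}"
        by eventually_elim (use cd0 in \<open>auto simp: \<beta>_def bump_def\<close>)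
      then have "{c0<..<d0} \<in> null_sets lebesgue"
        by (subst (asm) AE_iff_null_sets[symmetric]) auto
      then show False using cd0 by (simp add: null_sets_def)
    qed
    then show ?thesis using nn by simp
  qed
  define C where "C = (LINT x:?S|lebesgue. w x * \<beta> x) / J"
  have "AE x in lebesgue. x \<in> ?S \<longrightarrow> w x - C = 0"
  proof (rule fundamental_lemma_calculus_of_variations)
    have "set_integrable lebesgue K (\<lambda>_. C)" if "compact K" for K :: "real set"
      using that by (intro absolutely_integrable_on_const lmeasurable_compact)
    then show "locally_integrable_on ?S (\<lambda>x. w x - C)"
      using w by (auto simp: locally_integrable_on_def)
    fix \<psi> assume \<psi>: "test_function_on ?S \<psi>"
    define k where "k = (LINT x:?S|lebesgue. 1 * \<psi> x) / J"
    define \<rho> where "\<rho> = (\<lambda>x. \<psi> x - k * \<beta> x)"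
    have sm: "smooth \<rho>" unfolding \<rho>_def
      by (rule smooth_diff_cmult) (use \<psi> \<beta> in \<open>auto simp: test_function_on_def smooth_def\<close>)
    obtain c d where cd: "a < c" "c < d" "d < b" "\<And>x. x \<notin> {c..d} \<Longrightarrow> \<psi> x = 0" 
      using test_function_support_bounds[OF ab \<psi>] by blast
    define c' d' where "c' = min c c0" and "d' = max d d0"
    have out: "\<rho> x = 0" if "x \<notin> {c'..d'}" for x
    proof -
      have "x \<notin> {c..d}" "\<not> (c0 < x \<and> x < d0)"
        using that by (auto simp: c'_def d'_def min_def max_def split: if_splits)
      then show ?thesis using cd(4)[of x] by (simp only: \<rho>_def \<beta>_def bump_def if_False) simp
    qed
    have cd': "a < c'" "c' < d'" "d' < b" using cd cd0 by (auto simp: c'_def d'_def)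
    have int\<rho>: "(LINT x:?S|lebesgue. 1 * \<psi> x - k * (1 * \<beta> x)) = 0"
      using prod_int[OF \<psi> one] prod_int[OF \<beta> one] \<open>J > 0\<close>
      by (subst set_integral_diff) (auto simp: k_def J_def)
    have "integral {c'..d'} \<rho> = 0"
    proof -
      have si: "set_integrable lebesgue {c'..d'} \<rho>"
        by (intro absolutely_integrable_continuous_real smooth_imp_continuous sm)
      have "integral {c'..d'} \<rho> = (LINT x:{c'..d'}|lebesgue. \<rho> x)"
        by (rule set_lebesgue_integral_eq_integral(2)[OF si, symmetric])
      also have "\<dots> = (LINT x:?S|lebesgue. 1 * \<psi> x - k * (1 * \<beta> x))"
        unfolding set_lebesgue_integral_def
      proof (rule Bochner_Integration.integral_cong[OF refl])
        fix x show "indicator {c'..d'} x *\<^sub>R \<rho> x = indicator ?S x *\<^sub>R (1 * \<psi> x - k * (1 * \<beta> x))"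
          using out[of x] cd' by (auto simp: indicator_def \<rho>_def)
      qed
      finally show ?thesis using int\<rho> by simp
    qed
    moreover have sub: "{c'..d'} \<subseteq> ?S" using cd' by auto
    ultimately obtain \<phi> where \<phi>: "test_function_on ?S \<phi>" "\<And>x. (\<phi> has_real_derivative \<rho> x) (at x)"
      using test_function_antiderivative[OF sm out _ cd'(2) sub] by blast
    have "deriv \<phi> = \<rho>" using \<phi>(2) DERIV_imp_deriv by blast
    then have "0 = (LINT x:?S|lebesgue. w x * \<rho> x)" using z[OF \<phi>(1)] by simp
    also have "\<dots> = (LINT x:?S|lebesgue. w x * \<psi> x - k * (w x * \<beta> x))"
      by (simp add: \<rho>_def algebra_simps)
    also have "\<dots> = (LINT x:?S|lebesgue. w x * \<psi> x) - k * (LINT x:?S|lebesgue. w x * \<beta> x)"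
      using prod_int[OF \<psi> w] prod_int[OF \<beta> w] by (subst set_integral_diff) auto
    also have "k * (LINT x:?S|lebesgue. w x * \<beta> x) = C * (LINT x:?S|lebesgue. 1 * \<psi> x)"
      by (simp add: k_def C_def)
    also have "(LINT x:?S|lebesgue. w x * \<psi> x) - \<dots> = (LINT x:?S|lebesgue. w x * \<psi> x - C * (1 * \<psi> x))"
      using prod_int[OF \<psi> w] prod_int[OF \<psi> one] by (subst set_integral_diff) auto
    finally show "(LINT x:?S|lebesgue. (w x - C) * \<psi> x) = 0" by (simp add: algebra_simps)
  qed
  then show ?thesis by (intro that[of C]) simp
qed

lemma test_function_derivative:
  assumes "test_function_on S \<phi>"
  shows "(\<phi> has_real_derivative deriv \<phi> x) (at x)" "continuous_on A (deriv \<phi>)"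
proof -
  have "(deriv ^^ 0) \<phi> differentiable at x" "\<And>x. (deriv ^^ 1) \<phi> differentiable at x"
    using assms unfolding test_function_on_def by blast+
  then show "(\<phi> has_real_derivative deriv \<phi> x) (at x)" "continuous_on A (deriv \<phi>)"
    by (auto simp: DERIV_deriv_iff_real_differentiable continuous_at_imp_continuous_on differentiable_imp_continuous_within)
qed

lemma deriv_zero_outside:
  assumes "\<And>x. x \<notin> {c..d} \<Longrightarrow> \<phi> x = (0::real)" "x \<notin> {c..d}"
  shows "deriv \<phi> x = 0"
proof -
  have "((\<lambda>_. 0) has_real_derivative 0) (at x)" by simp
  then have "(\<phi> has_real_derivative 0) (at x)"
    by (rule has_field_derivative_transform_within_open[of _ _ _ "- {c..d}"])
       (use assms in \<open>auto simp: open_Compl\<close>)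
  then show ?thesis by (rule DERIV_imp_deriv)
qed

lemma integral_tail_deriv:
  assumes \<phi>: "test_function_on S \<phi>" and z: "\<And>x. x \<notin> {c..d} \<Longrightarrow> \<phi> x = 0"
  shows "(LINT x|lebesgue. indicator {z..} x * deriv \<phi> x) = - \<phi> z"
proof -
  \<comment> \<open>A point to the right of \<open>z\<close> and of the support.\<close>
  define e where "e = max z d + 1"
  have e: "z \<le> e" "e \<notin> {c..d}" by (auto simp: e_def)
  have si: "set_integrable lebesgue {z..e} (deriv \<phi>)"
    by (intro absolutely_integrable_continuous_real test_function_derivative(2)[OF \<phi>])
  have "(LINT x|lebesgue. indicator {z..} x * deriv \<phi> x) = (LINT x:{z..e}|lebesgue. deriv \<phi> x)"
    unfolding set_lebesgue_integral_def
  proof (rule Bochner_Integration.integral_cong[OF refl])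
    fix x
    have "deriv \<phi> x = 0" if "x > e" using that by (intro deriv_zero_outside[of c d \<phi>, OF z]) (auto simp: e_def)
    then show "indicator {z..} x * deriv \<phi> x = indicator {z..e} x *\<^sub>R deriv \<phi> x"
      by (auto simp: indicator_def)
  qed
  also have "\<dots> = integral {z..e} (deriv \<phi>)" by (rule set_lebesgue_integral_eq_integral(2)[OF si])
  also have "\<dots> = \<phi> e - \<phi> z"
    by (intro integral_unique fundamental_theorem_of_calculus e(1))
       (auto intro!: has_field_derivative_at_within test_function_derivative(1)[OF \<phi>]
         simp flip: has_real_derivative_iff_has_vector_derivative)
  finally show ?thesis using z[OF e(2)] by simp
qed

text \<open>By Fubini's theorem, \<open>\<integral> (\<integral>\<^sub>z\<^sub>\<le>\<^sub>x g(z)) \<phi>'(x) = \<integral> g(z) (\<integral>\<^sub>x\<^sub>\<ge>\<^sub>z \<phi>'(x))\<close>, and the inner integral is \<open>- \<phi>(z)\<close>.\<close>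

lemma integral_primitive_mult_deriv:
  fixes g \<phi> :: "real \<Rightarrow> real"
  assumes g: "integrable lebesgue g" and ab: "a < b" and \<phi>: "test_function_on {a<..<b} \<phi>"
  defines "U \<equiv> (\<lambda>x. LINT z|lebesgue. indicator {..x} z * g z)"
  shows "(LINT x|lebesgue. U x * deriv \<phi> x) = - (LINT x|lebesgue. g x * \<phi> x)"
proof -
  interpret L: sigma_finite_measure "lebesgue :: real measure" by (rule sigma_finite_lebesgue)
  interpret P: pair_sigma_finite "lebesgue :: real measure" "lebesgue :: real measure" by standard
  obtain c d where cd: "a < c" "c < d" "d < b" "\<And>x. x \<notin> {c..d} \<Longrightarrow> \<phi> x = 0"
    using test_function_support_bounds[OF ab \<phi>] by blast
  have dz: "deriv \<phi> x = 0" if "x \<notin> {c..d}" for x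
    by (rule deriv_zero_outside[of c d \<phi>, OF cd(4) that])
  have hint: "integrable lebesgue (deriv \<phi>)"
  proof -
    have "set_integrable lebesgue {c..d} (deriv \<phi>)"
      by (intro absolutely_integrable_continuous_real test_function_derivative(2)[OF \<phi>])
    moreover have "(\<lambda>x. indicator {c..d} x *\<^sub>R deriv \<phi> x) = deriv \<phi>"
    proof
      show "indicator {c..d} x *\<^sub>R deriv \<phi> x = deriv \<phi> x" for x
        using dz[of x] by (cases "x \<in> {c..d}") auto
    qed
    ultimately show ?thesis by (simp add: set_integrable_def)
  qed
  note [measurable] = borel_measurable_fst_snd_lebesgue
  have m1: "(\<lambda>z. deriv \<phi> (fst z)) \<in> borel_measurable (lebesgue \<Otimes>\<^sub>M lebesgue :: (real \<times> real) measure)"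
    by (rule measurable_compose[OF measurable_fst borel_measurable_integrable[OF hint]])
  have m2: "(\<lambda>z. g (snd z)) \<in> borel_measurable (lebesgue \<Otimes>\<^sub>M lebesgue :: (real \<times> real) measure)"
    by (rule measurable_compose[OF measurable_snd borel_measurable_integrable[OF g]])
  have m3: "(\<lambda>z. indicator {z. snd z \<le> fst z} z :: real) \<in> borel_measurable (lebesgue \<Otimes>\<^sub>M lebesgue :: (real \<times> real) measure)"
  proof (rule borel_measurable_indicator)
    have "{z \<in> space (lebesgue \<Otimes>\<^sub>M lebesgue). snd z \<le> fst z} \<in> sets (lebesgue \<Otimes>\<^sub>M lebesgue :: (real \<times> real) measure)"
      by measurable
    then show "{z :: real \<times> real. snd z \<le> fst z} \<in> sets (lebesgue \<Otimes>\<^sub>M lebesgue)"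
      by (simp add: space_pair_measure)
  qed
  have prod: "integrable (lebesgue \<Otimes>\<^sub>M lebesgue) (\<lambda>z. deriv \<phi> (fst z) * g (snd z))"
  proof (rule P.Fubini_integrable)
    show "(\<lambda>z. deriv \<phi> (fst z) * g (snd z)) \<in> borel_measurable (lebesgue \<Otimes>\<^sub>M lebesgue)"
      by (intro borel_measurable_times m1 m2)
    show "integrable lebesgue (\<lambda>x. LINT y|lebesgue. norm (deriv \<phi> (fst (x, y)) * g (snd (x, y))))"
      using hint by (simp add: abs_mult)
    show "AE x in lebesgue. integrable lebesgue (\<lambda>y. deriv \<phi> (fst (x, y)) * g (snd (x, y)))"
      using g by simp
  qed
  have int: "integrable (lebesgue \<Otimes>\<^sub>M lebesgue) (\<lambda>(x, z). indicator {z..} x * (deriv \<phi> x * g z))"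
  proof (rule Bochner_Integration.integrable_bound[OF prod])
    have "(\<lambda>(x, z). indicator {z..} x * (deriv \<phi> x * g z)) = (\<lambda>z. indicator {z. snd z \<le> fst z} z * (deriv \<phi> (fst z) * g (snd z)))"
      by (auto simp: fun_eq_iff indicator_def)
    then show "(\<lambda>(x, z). indicator {z..} x * (deriv \<phi> x * g z)) \<in> borel_measurable (lebesgue \<Otimes>\<^sub>M lebesgue)"
      by (simp only:) (intro borel_measurable_times m1 m2 m3)
    show "AE x in lebesgue \<Otimes>\<^sub>M lebesgue. norm (case x of (x, z) \<Rightarrow> indicator {z..} x * (deriv \<phi> x * g z)) \<le> norm (deriv \<phi> (fst x) * g (snd x))"
      by (intro always_eventually allI) (auto simp: indicator_def split: prod.splits)
  qed
  have "(LINT x|lebesgue. U x * deriv \<phi> x) = (LINT x|lebesgue. (LINT z|lebesgue. indicator {z..} x * (deriv \<phi> x * g z)))"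
  proof (rule Bochner_Integration.integral_cong[OF refl])
    fix x
    have "U x * deriv \<phi> x = (LINT z|lebesgue. indicator {..x} z * g z * deriv \<phi> x)"
      unfolding U_def by simp
    also have "\<dots> = (LINT z|lebesgue. indicator {z..} x * (deriv \<phi> x * g z))"
      by (rule Bochner_Integration.integral_cong) (auto simp: indicator_def)
    finally show "U x * deriv \<phi> x = (LINT z|lebesgue. indicator {z..} x * (deriv \<phi> x * g z))" .
  qed
  also have "\<dots> = (LINT z|lebesgue. (LINT x|lebesgue. indicator {z..} x * (deriv \<phi> x * g z)))"
    by (rule P.Fubini_integral[OF int, symmetric])
  also have "\<dots> = (LINT z|lebesgue. - (g z * \<phi> z))"
  proof (rule Bochner_Integration.integral_cong[OF refl])
    fix z
    have "(LINT x|lebesgue. indicator {z..} x * (deriv \<phi> x * g z)) = (LINT x|lebesgue. indicator {z..} x * deriv \<phi> x * g z)"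
      by (simp add: mult.assoc)
    also have "\<dots> = (LINT x|lebesgue. indicator {z..} x * deriv \<phi> x) * g z"
      by (rule integral_mult_left_zero)
    finally show "(LINT x|lebesgue. indicator {z..} x * (deriv \<phi> x * g z)) = - (g z * \<phi> z)"
      using integral_tail_deriv[of _ \<phi> c d z, OF \<phi> cd(4)] by simp
  qed
  also have "\<dots> = - (LINT x|lebesgue. g x * \<phi> x)" by simp
  finally show ?thesis .
qed

lemma continuous_primitive:
  fixes g :: "real \<Rightarrow> real"
  assumes g: "integrable lebesgue g"
  shows "continuous_on A (\<lambda>x. LINT z|lebesgue. indicator {..x} z * g z)"
proof -
  have "isCont (\<lambda>x. LINT z|lebesgue. indicator {..x} z * g z) x" for x
  proof (rule continuous_at_sequentiallyI)
    fix s assume s: "s \<longlonglongrightarrow> x"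
    show "(\<lambda>n. LINT z|lebesgue. indicator {..s n} z * g z) \<longlonglongrightarrow> (LINT z|lebesgue. indicator {..x} z * g z)"
    proof (rule integral_dominated_convergence[where w = "\<lambda>z. \<bar>g z\<bar>"])
      show "(\<lambda>z. indicator {..y} z * g z) \<in> borel_measurable lebesgue" for y :: real
        by (rule borel_measurable_times[OF _ borel_measurable_integrable[OF g]])
           (intro borel_measurable_indicator, simp)
      then show "(\<lambda>z. indicator {..s n} z * g z) \<in> borel_measurable lebesgue" for n .
      show "integrable lebesgue (\<lambda>z. \<bar>g z\<bar>)" using g by simp
      show "AE z in lebesgue. norm (indicator {..s n} z * g z) \<le> \<bar>g z\<bar>" for n
        by (intro always_eventually allI) (auto simp: indicator_def)
      have "AE z in lebesgue. z \<noteq> x"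
        by (rule AE_completion) (rule AE_lborel_singleton)
      then show "AE z in lebesgue. (\<lambda>n. indicator {..s n} z * g z) \<longlonglongrightarrow> indicator {..x} z * g z"
      proof eventually_elim
        case (elim z)
        have "\<forall>\<^sub>F n in sequentially. indicator {..s n} z = (indicator {..x} z :: real)"
        proof (cases "z < x")
          case True
          then have "\<forall>\<^sub>F n in sequentially. z < s n" using s by (auto dest: order_tendstoD(1))
          then show ?thesis by eventually_elim (use True in \<open>auto simp: indicator_def\<close>)
        next
          case False
          then have "z > x" using elim by simp
          then have "\<forall>\<^sub>F n in sequentially. s n < z" using s by (auto dest: order_tendstoD(2))
          then show ?thesis by eventually_elim (use \<open>z > x\<close> in \<open>auto simp: indicator_def\<close>)
        qed
        then have "(\<lambda>n. indicator {..s n} z :: real) \<longlonglongrightarrow> indicator {..x} z" by (rule tendsto_eventually)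
        then show ?case by (rule tendsto_mult_right)
      qed
    qed
  qed
  then show ?thesis by (intro continuous_at_imp_continuous_on ballI)
qed

text \<open>The primitive of the weak derivative has the same weak derivative as \<open>u\<close>, so the difference is
constant by the lemma of du Bois-Reymond.\<close>

lemma weak_derivative_primitive:
  fixes u g :: "real \<Rightarrow> real"
  assumes ab: "a < b" and wd: "has_weak_deriv_on {a<..<b} u g" and g: "set_integrable lebesgue {a<..<b} g"
  defines "h \<equiv> (\<lambda>x. indicator {a<..<b} x * g x)"
  obtains C where "AE x in lebesgue. x \<in> {a<..<b} \<longrightarrow> u x = C + (LINT z|lebesgue. indicator {..x} z * h z)"
proof -
  let ?S = "{a<..<b}"
  define U where "U = (\<lambda>x. LINT z|lebesgue. indicator {..x} z * h z)"
  have h: "integrable lebesgue h" using g by (simp add: set_integrable_def h_def)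
  have u: "locally_integrable_on ?S u" using wd by (simp add: has_weak_deriv_on_def)
  have U: "locally_integrable_on ?S U"
    unfolding locally_integrable_on_def
  proof (intro allI impI)
    fix K :: "real set" assume K: "compact K \<and> K \<subseteq> ?S"
    have "set_integrable lebesgue {a..b} U"
      unfolding U_def by (intro absolutely_integrable_continuous_real continuous_primitive h)
    then show "set_integrable lebesgue K U"
      by (rule set_integrable_subset) (use K in \<open>auto dest: lmeasurable_compact\<close>)
  qed
  obtain C where "AE x in lebesgue. x \<in> ?S \<longrightarrow> u x - U x = C"
  proof (rule du_bois_reymond[OF ab])
    show "locally_integrable_on ?S (\<lambda>x. u x - U x)"
      using u U by (auto simp: locally_integrable_on_def)
    fix \<phi> assume \<phi>: "test_function_on ?S \<phi>"
    obtain c d where cd: "a < c" "c < d" "d < b" "\<And>x. x \<notin> {c..d} \<Longrightarrow> \<phi> x = 0"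
      using test_function_support_bounds[OF ab \<phi>] by blast
    have dz: "deriv \<phi> x = 0" if "x \<notin> {c..d}" for x
      by (rule deriv_zero_outside[of c d \<phi>, OF cd(4) that])
    have int: "set_integrable lebesgue ?S (\<lambda>x. v x * deriv \<phi> x)" if v: "locally_integrable_on ?S v" for v
    proof (rule locally_integrable_bounded_mult[of c d])
      have "{c..d} \<subseteq> ?S" using cd by auto
      then show "set_integrable lebesgue {c..d} v" "{c..d} \<subseteq> ?S"
        using v unfolding locally_integrable_on_def by blast+
    qed (rule test_function_derivative(2)[OF \<phi>], rule dz)
    have "(LINT x:?S|lebesgue. (u x - U x) * deriv \<phi> x) = (LINT x:?S|lebesgue. u x * deriv \<phi> x) - (LINT x:?S|lebesgue. U x * deriv \<phi> x)"
      unfolding left_diff_distrib by (rule set_integral_diff) (intro int u U)+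
    also have "(LINT x:?S|lebesgue. u x * deriv \<phi> x) = - (LINT x:?S|lebesgue. g x * \<phi> x)"
      using wd \<phi> by (simp add: has_weak_deriv_on_def)
    also have "(LINT x:?S|lebesgue. U x * deriv \<phi> x) = (LINT x|lebesgue. U x * deriv \<phi> x)"
      unfolding set_lebesgue_integral_def
    proof (rule Bochner_Integration.integral_cong[OF refl])
      fix x show "indicator ?S x *\<^sub>R (U x * deriv \<phi> x) = U x * deriv \<phi> x"
        using dz[of x] cd by (cases "x \<in> {c..d}") (auto simp: indicator_def)
    qed
    also have "\<dots> = - (LINT x|lebesgue. h x * \<phi> x)"
      unfolding U_def by (rule integral_primitive_mult_deriv[OF h ab \<phi>])
    also have "(LINT x|lebesgue. h x * \<phi> x) = (LINT x:?S|lebesgue. g x * \<phi> x)"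
      by (simp add: set_lebesgue_integral_def h_def mult.assoc)
    finally show "(LINT x:?S|lebesgue. (u x - U x) * deriv \<phi> x) = 0" by simp
  qed
  then have "AE x in lebesgue. x \<in> ?S \<longrightarrow> u x = C + (LINT z|lebesgue. indicator {..x} z * h z)"
    by eventually_elim (auto simp: U_def)
  then show ?thesis by (rule that)
qed

lemma weak_derivative_unique:
  assumes ab: "a < b" and g: "has_weak_deriv_on {a<..<b} u g" and h: "has_weak_deriv_on {a<..<b} u h"
  shows "AE x in lebesgue. x \<in> {a<..<b} \<longrightarrow> g x = h x"
proof -
  have l: "locally_integrable_on {a<..<b} g" "locally_integrable_on {a<..<b} h"
    using g h by (auto simp: has_weak_deriv_on_def)
  have "AE x in lebesgue. x \<in> {a<..<b} \<longrightarrow> g x - h x = 0"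
  proof (rule fundamental_lemma_calculus_of_variations)
    show "locally_integrable_on {a<..<b} (\<lambda>x. g x - h x)"
      using l by (auto simp: locally_integrable_on_def)
    fix \<phi> assume \<phi>: "test_function_on {a<..<b} \<phi>"
    have "(LINT x:{a<..<b}|lebesgue. (g x - h x) * \<phi> x) = (LINT x:{a<..<b}|lebesgue. g x * \<phi> x) - (LINT x:{a<..<b}|lebesgue. h x * \<phi> x)"
      unfolding left_diff_distrib
      by (rule set_integral_diff) (intro set_integrable_mult_test_function[OF ab \<phi>] l)+
    also have "\<dots> = 0" using g h \<phi> by (simp add: has_weak_deriv_on_def)
    finally show "(LINT x:{a<..<b}|lebesgue. (g x - h x) * \<phi> x) = 0" .
  qed
  then show ?thesis by eventually_elim auto
qed

section \<open>The lower bound for the Rayleigh quotient\<close>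

text \<open>The tangent inequality for the convex function \<open>t \<mapsto> |u - t|\<^sup>p\<close> at \<open>t = 0\<close>.\<close>

lemma powr_shift_lower_bound:
  fixes u t p :: real
  assumes "p > 1"
  shows "\<bar>u\<bar> powr p - p * t * (\<bar>u\<bar> powr (p - 2) * u) \<le> \<bar>u - t\<bar> powr p"
proof -
  have e: "\<bar>u\<bar> powr (p - 2) * (u * (u - t)) \<le> \<bar>u\<bar> powr (p - 1) * \<bar>u - t\<bar>"
  proof (cases "u = 0")
    case False
    have "\<bar>u\<bar> powr (p - 2) * (u * (u - t)) \<le> \<bar>u\<bar> powr (p - 2) * (\<bar>u\<bar> * \<bar>u - t\<bar>)"
      by (intro mult_left_mono) (auto simp flip: abs_mult)
    also have "\<bar>u\<bar> powr (p - 2) * \<bar>u\<bar> = \<bar>u\<bar> powr (p - 1)"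
      using powr_minus_one_mult[of "\<bar>u\<bar>" "p - 1"] by simp
    then have "\<bar>u\<bar> powr (p - 2) * (\<bar>u\<bar> * \<bar>u - t\<bar>) = \<bar>u\<bar> powr (p - 1) * \<bar>u - t\<bar>"
      by (simp flip: mult.assoc)
    finally show ?thesis .
  qed auto
  have "p * \<bar>u\<bar> powr (p - 1) * \<bar>u - t\<bar> \<le> \<bar>u - t\<bar> powr p + (p - 1) * \<bar>u\<bar> powr p"
    by (rule young_tangent) (use assms in auto)
  moreover have "p * (\<bar>u\<bar> powr (p - 2) * (u * (u - t))) \<le> p * (\<bar>u\<bar> powr (p - 1) * \<bar>u - t\<bar>)"
    using e assms by (intro mult_left_mono) auto
  moreover have "\<bar>u\<bar> powr (p - 2) * (u * u) = \<bar>u\<bar> powr p"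
  proof (cases "u = 0")
    case False
    then show ?thesis
      using powr_add[of "\<bar>u\<bar>" "p - 2" 2] by (simp add: powr_numeral power2_eq_square)
  qed auto
  then have "\<bar>u\<bar> powr (p - 2) * (u * (u - t)) = \<bar>u\<bar> powr p - t * (\<bar>u\<bar> powr (p - 2) * u)"
    by (simp add: algebra_simps)
  ultimately show ?thesis by (simp add: algebra_simps)
qed

lemma powr_le_one_plus_powr:
  fixes x p q :: real
  assumes "0 \<le> x" "0 \<le> q" "q \<le> p"
  shows "x powr q \<le> 1 + x powr p"
proof (cases "x \<le> 1")
  case True
  then have "x powr q \<le> 1 powr q" using assms by (intro powr_mono2) auto
  then show ?thesis by (simp add: add_increasing2)
next
  case False
  then have "x powr q \<le> x powr p" using assms by (intro powr_mono) auto
  then show ?thesis by simp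
qed

text \<open>Since the interval is bounded, the majorant \<open>1 + |u|\<^sup>p\<close> of \<open>|u|\<close> is integrable.\<close>

lemma Lp_on_imp_set_integrable:
  assumes u: "u \<in> Lp_on p {a<..<b}" and p: "p \<ge> 1"
  shows "set_integrable lebesgue {a<..<b} u"
  unfolding set_integrable_def
proof (rule Bochner_Integration.integrable_bound)
  have "set_integrable lebesgue {a<..<b} (\<lambda>_. 1 :: real)"
    by (rule absolutely_integrable_on_const) simp
  then have "set_integrable lebesgue {a<..<b} (\<lambda>x. 1 + \<bar>u x\<bar> powr p)"
    using u by (intro set_integral_add) (auto simp: Lp_on_def)
  then show "integrable lebesgue (\<lambda>x. indicator {a<..<b} x *\<^sub>R (1 + \<bar>u x\<bar> powr p))"
    by (simp add: set_integrable_def)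
  show "(\<lambda>x. indicator {a<..<b} x *\<^sub>R u x) \<in> borel_measurable lebesgue"
    using u by (simp add: Lp_on_def set_borel_measurable_def)
  have "\<bar>u x\<bar> \<le> 1 + \<bar>u x\<bar> powr p" for x
    using powr_le_one_plus_powr[of "\<bar>u x\<bar>" 1 p] p by simp
  then show "AE x in lebesgue. norm (indicator {a<..<b} x *\<^sub>R u x) \<le> norm (indicator {a<..<b} x *\<^sub>R (1 + \<bar>u x\<bar> powr p))"
    by (intro always_eventually allI) (auto simp: indicator_def intro: order_trans)
qed

lemma integrable_weight_mult:
  fixes F h :: "real \<Rightarrow> real"
  assumes F: "F \<in> borel_measurable borel" "\<And>x. 0 \<le> F x" "\<And>x. F x \<le> B" and h: "integrable lebesgue h"
  shows "integrable lebesgue (\<lambda>x. F x * h x)"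
proof (rule Bochner_Integration.integrable_bound)
  show "integrable lebesgue (\<lambda>x. B * h x)" using h by simp
  show "(\<lambda>x. F x * h x) \<in> borel_measurable lebesgue"
    using F(1) h by (intro borel_measurable_times) (auto intro: measurable_completion)
  have "\<bar>F x * h x\<bar> \<le> \<bar>B * h x\<bar>" for x
    unfolding abs_mult using F(2,3)[of x] by (intro mult_right_mono) auto
  then show "AE x in lebesgue. norm (F x * h x) \<le> norm (B * h x)" by simp
qed

lemma sobolev_W1_weak_deriv:
  assumes "a < b" "u \<in> sobolev_W1 p {a<..<b}"
  obtains g where "g \<in> Lp_on p {a<..<b}" "has_weak_deriv_on {a<..<b} u g"
    "AE x in lebesgue. x \<in> {a<..<b} \<longrightarrow> weak_deriv_on {a<..<b} u x = g x"
proof -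
  obtain g where g: "g \<in> Lp_on p {a<..<b}" "has_weak_deriv_on {a<..<b} u g"
    using assms(2) by (auto simp: sobolev_W1_def)
  then have "has_weak_deriv_on {a<..<b} u (weak_deriv_on {a<..<b} u)"
    unfolding weak_deriv_on_def by (metis someI)
  then have "AE x in lebesgue. x \<in> {a<..<b} \<longrightarrow> weak_deriv_on {a<..<b} u x = g x"
    by (rule weak_derivative_unique[OF assms(1) _ g(2)])
  then show ?thesis using g that by blast
qed

text \<open>Let \<open>D\<close> and \<open>N\<close> be the denominator and the numerator of the quotient, and \<open>I = \<integral> f |u - t|\<^sup>p\<close> with
\<open>t = u(c)\<close>.  The Poincare inequality about \<open>c\<close> is \<open>\<kappa>\<^sup>p I \<le> N\<close>, and integrating the tangent inequality
gives \<open>D \<le> I\<close>, because the linear term vanishes by the constraint.  Boundedness of \<open>f\<close> makes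
\<open>D\<close> and \<open>N\<close> finite.\<close>

lemma rayleigh_lower_bound:
  fixes L p \<kappa> :: real and f :: "real \<Rightarrow> real"
  assumes L: "L > 0" and p: "p > 1" and \<kappa>: "\<kappa> > 0" and M: "M \<ge> 1" "\<kappa> * L < 2 * half_length p M 0"
    and nn: "\<And>x. x \<in> {0..L} \<Longrightarrow> f x \<ge> 0" and lc: "log_concave_on {0..L} f"
    and u: "u \<in> admissible p L f"
  shows "\<kappa> powr p \<le> rayleigh p L f u"
proof -
  let ?S = "{0<..<L}"
  let ?g = "weak_deriv_on ?S u"
  have uW: "u \<in> sobolev_W1 p ?S" and constr: "(LINT x:?S|lebesgue. f x * (\<bar>u x\<bar> powr (p - 2) * u x)) = 0"
    and D0: "(LINT x:?S|lebesgue. f x * \<bar>u x\<bar> powr p) \<noteq> 0"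
    using u by (auto simp: admissible_def)
  obtain g where g: "g \<in> Lp_on p ?S" "has_weak_deriv_on ?S u g"
    "AE x in lebesgue. x \<in> ?S \<longrightarrow> ?g x = g x"
    using sobolev_W1_weak_deriv[OF L uW] by blast
  have uLp: "u \<in> Lp_on p ?S" using uW by (simp add: sobolev_W1_def)
  define F where "F = (\<lambda>x. indicator ?S x * f x)"
  obtain B where B: "B \<ge> 0" "\<And>x. x \<in> {0..L} \<Longrightarrow> f x \<le> B"
    using log_concave_bounded[OF lc nn] by blast
  have Fm: "F \<in> borel_measurable borel"
    unfolding F_def by (rule log_concave_borel_measurable[OF lc nn L])
  have F: "0 \<le> F x" "F x \<le> B" for x using nn[of x] B by (auto simp: F_def indicator_def)
  have Fm': "F \<in> borel_measurable lebesgue" using Fm by (simp add: measurable_completion)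
  define v where "v = (\<lambda>x. indicator ?S x * u x)"
  define h where "h = (\<lambda>x. indicator ?S x * g x)"
  have vi: "integrable lebesgue v" and hi: "integrable lebesgue h"
    using Lp_on_imp_set_integrable[OF uLp] Lp_on_imp_set_integrable[OF g(1)] p
    by (auto simp: set_integrable_def v_def h_def)
  have vp: "integrable lebesgue (\<lambda>x. \<bar>v x\<bar> powr p)" and hp: "integrable lebesgue (\<lambda>x. \<bar>h x\<bar> powr p)"
  proof -
    have "(\<lambda>x. \<bar>indicator ?S x * w x\<bar> powr p) = (\<lambda>x. indicator ?S x *\<^sub>R \<bar>w x\<bar> powr p)" for w :: "real \<Rightarrow> real"
      using p by (auto simp: fun_eq_iff indicator_def)
    then show "integrable lebesgue (\<lambda>x. \<bar>v x\<bar> powr p)" "integrable lebesgue (\<lambda>x. \<bar>h x\<bar> powr p)"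
      using uLp g(1) by (simp_all add: Lp_on_def set_integrable_def v_def h_def)
  qed
  have Fv: "integrable lebesgue (\<lambda>x. F x * \<bar>v x\<bar> powr p)" and Fh: "integrable lebesgue (\<lambda>x. F x * \<bar>h x\<bar> powr p)"
    using integrable_weight_mult[OF Fm F vp] integrable_weight_mult[OF Fm F hp] by auto
  define N where "N = (LINT x|lebesgue. F x * \<bar>h x\<bar> powr p)"
  define D where "D = (LINT x|lebesgue. F x * \<bar>v x\<bar> powr p)"
  have N: "(LINT x:?S|lebesgue. f x * \<bar>?g x\<bar> powr p) = N"
  proof -
    have ae: "AE x in lebesgue. F x * \<bar>h x\<bar> powr p = indicator ?S x *\<^sub>R (f x * \<bar>?g x\<bar> powr p)"
      using g(3) by eventually_elim (auto simp: F_def h_def indicator_def)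
    show ?thesis
      unfolding N_def set_lebesgue_integral_def
    proof (rule integral_cong_AE[symmetric])
      show "(\<lambda>x. indicator ?S x *\<^sub>R (f x * \<bar>?g x\<bar> powr p)) \<in> borel_measurable lebesgue"
        by (rule borel_measurable_AE[OF borel_measurable_integrable[OF Fh] ae])
    qed (use Fh ae in auto)
  qed
  have D: "(LINT x:?S|lebesgue. f x * \<bar>u x\<bar> powr p) = D"
    unfolding D_def set_lebesgue_integral_def
    by (rule Bochner_Integration.integral_cong) (auto simp: F_def v_def indicator_def)
  have "D \<ge> 0" unfolding D_def using F by (intro Bochner_Integration.integral_nonneg) auto
  then have Dpos: "D > 0" using D0 D by simp
  define U where "U = (\<lambda>x. LINT z|lebesgue. indicator {..x} z * h z)"
  obtain C where C: "AE x in lebesgue. x \<in> ?S \<longrightarrow> u x = C + U x"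
    using weak_derivative_primitive[OF L g(2) Lp_on_imp_set_integrable[OF g(1)]] p unfolding U_def h_def by auto
  obtain c where c: "ennreal (\<kappa> powr p) * (\<integral>\<^sup>+x. ennreal (F x * \<bar>U x - U c\<bar> powr p) \<partial>lebesgue)
      \<le> (\<integral>\<^sup>+x. ennreal (F x * \<bar>h x\<bar> powr p) \<partial>lebesgue)"
    using weighted_poincare_about_point[OF L p \<kappa> M lc nn hi] unfolding U_def F_def by blast
  define t where "t = C + U c"
  have "(\<integral>\<^sup>+x. ennreal (F x * \<bar>U x - U c\<bar> powr p) \<partial>lebesgue) = (\<integral>\<^sup>+x. ennreal (F x * \<bar>v x - t\<bar> powr p) \<partial>lebesgue)"
  proof (rule nn_integral_cong_AE)
    show "AE x in lebesgue. ennreal (F x * \<bar>U x - U c\<bar> powr p) = ennreal (F x * \<bar>v x - t\<bar> powr p)"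
      using C by eventually_elim (auto simp: F_def v_def t_def indicator_def)
  qed
  moreover have "(\<integral>\<^sup>+x. ennreal (F x * \<bar>h x\<bar> powr p) \<partial>lebesgue) = ennreal N"
    unfolding N_def using F by (intro nn_integral_eq_integral Fh) auto
  ultimately have le: "ennreal (\<kappa> powr p) * (\<integral>\<^sup>+x. ennreal (F x * \<bar>v x - t\<bar> powr p) \<partial>lebesgue) \<le> ennreal N"
    using c by simp
  \<comment> \<open>Finiteness comes from the Poincare inequality itself.\<close>
  have Fvt: "integrable lebesgue (\<lambda>x. F x * \<bar>v x - t\<bar> powr p)"
  proof (rule integrableI_bounded)
    show "(\<lambda>x. F x * \<bar>v x - t\<bar> powr p) \<in> borel_measurable lebesgue"
      using Fm' vi by measurable
    have "(\<integral>\<^sup>+x. ennreal (F x * \<bar>v x - t\<bar> powr p) \<partial>lebesgue) < \<infinity>"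
    proof (rule ccontr)
      assume "\<not> ?thesis"
      then have "(\<integral>\<^sup>+x. ennreal (F x * \<bar>v x - t\<bar> powr p) \<partial>lebesgue) = \<infinity>" by (auto simp: less_top[symmetric])
      then show False using le \<kappa> by (simp add: ennreal_mult_top top_unique)
    qed
    then show "(\<integral>\<^sup>+x. ennreal (norm (F x * \<bar>v x - t\<bar> powr p)) \<partial>lebesgue) < \<infinity>"
      using F by (simp add: abs_mult)
  qed
  define I where "I = (LINT x|lebesgue. F x * \<bar>v x - t\<bar> powr p)"
  have I0: "I \<ge> 0" unfolding I_def using F by (intro Bochner_Integration.integral_nonneg) auto
  have "(\<integral>\<^sup>+x. ennreal (F x * \<bar>v x - t\<bar> powr p) \<partial>lebesgue) = ennreal I"
    unfolding I_def using F by (intro nn_integral_eq_integral Fvt) auto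
  moreover have "N \<ge> 0" unfolding N_def using F by (intro Bochner_Integration.integral_nonneg) auto
  ultimately have kI: "\<kappa> powr p * I \<le> N"
    using le I0 by (simp add: ennreal_mult[symmetric])
  have "D \<le> I"
  proof -
    let ?E = "\<lambda>x. F x * (\<bar>v x\<bar> powr (p - 2) * v x)"
    have Ei: "integrable lebesgue ?E"
    proof (rule Bochner_Integration.integrable_bound)
      have "integrable lebesgue (\<lambda>x. indicator ?S x * B :: real)"
        using absolutely_integrable_on_const[of ?S B] by (simp add: set_integrable_def)
      then show "integrable lebesgue (\<lambda>x. indicator ?S x * B + F x * \<bar>v x\<bar> powr p)"
        by (intro Bochner_Integration.integrable_add Fv)
      show "?E \<in> borel_measurable lebesgue" using Fm' vi by measurable
      have le: "\<bar>?E x\<bar> \<le> indicator ?S x * B + F x * \<bar>v x\<bar> powr p" for x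
      proof -
        have "\<bar>?E x\<bar> = F x * \<bar>v x\<bar> powr (p - 1)"
          using F powr_minus_one_mult[of "\<bar>v x\<bar>" "p - 1"] by (simp add: abs_mult)
        also have "\<dots> \<le> F x * (1 + \<bar>v x\<bar> powr p)"
          using F p by (intro mult_left_mono powr_le_one_plus_powr) auto
        also have "\<dots> \<le> indicator ?S x * B + F x * \<bar>v x\<bar> powr p"
          using F[of x] by (auto simp: algebra_simps F_def indicator_def)
        finally show ?thesis .
      qed
      show "AE x in lebesgue. norm (?E x) \<le> norm (indicator ?S x * B + F x * \<bar>v x\<bar> powr p)"
        unfolding real_norm_def by (intro always_eventually allI order_trans[OF le abs_ge_self])
    qed
    have E0: "(LINT x|lebesgue. ?E x) = 0"
    proof -
      have "(LINT x|lebesgue. ?E x) = (LINT x:?S|lebesgue. f x * (\<bar>u x\<bar> powr (p - 2) * u x))"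
        unfolding set_lebesgue_integral_def
        by (rule Bochner_Integration.integral_cong) (auto simp: F_def v_def indicator_def)
      then show ?thesis using constr by simp
    qed
    have "D = (LINT x|lebesgue. F x * \<bar>v x\<bar> powr p - p * t * ?E x)"
      unfolding D_def using Fv Ei by (subst Bochner_Integration.integral_diff) (auto simp: E0)
    also have "\<dots> \<le> I"
      unfolding I_def
    proof (rule integral_mono)
      show "integrable lebesgue (\<lambda>x. F x * \<bar>v x\<bar> powr p - p * t * ?E x)"
        by (intro Bochner_Integration.integrable_diff integrable_mult_right Fv Ei)
      show "F x * \<bar>v x\<bar> powr p - p * t * ?E x \<le> F x * \<bar>v x - t\<bar> powr p" for x
        using mult_left_mono[OF powr_shift_lower_bound[OF p, of "v x" t] F(1)[of x]]
        by (simp add: algebra_simps)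
    qed (rule Fvt)
    finally show ?thesis .
  qed
  then have "\<kappa> powr p * D \<le> N" using kI mult_left_mono[of D I "\<kappa> powr p"] by simp
  then show ?thesis unfolding rayleigh_def N D using Dpos by (simp add: pos_le_divide_eq)
qed

section \<open>Generalised trigonometric functions and the extremal function\<close>

text \<open>The generalised tangent is the solution of \<open>s' = tan_p_rate p s\<close>, \<open>s(0) = 0\<close>.\<close>

definition tan_p_rate :: "real \<Rightarrow> real \<Rightarrow> real" where "tan_p_rate p s = 1 + \<bar>s\<bar> powr p / (p - 1)"

text \<open>The primitive of \<open>1 / tan_p_rate p\<close> that vanishes at zero.  One of the two integrals is over a null set,
depending on the sign of \<open>s\<close>.\<close>

definition arctan_p :: "real \<Rightarrow> real \<Rightarrow> real" where
  "arctan_p p s = integral {0..s} (\<lambda>t. 1 / tan_p_rate p t) - integral {s..0} (\<lambda>t. 1 / tan_p_rate p t)"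

lemma tan_p_rate_ge_1: "p > 1 \<Longrightarrow> tan_p_rate p s \<ge> 1" by (simp add: tan_p_rate_def)

lemma tan_p_rate_pos: "p > 1 \<Longrightarrow> tan_p_rate p s > 0" using tan_p_rate_ge_1[of p s] by simp

lemma tan_p_rate_minus [simp]: "tan_p_rate p (- s) = tan_p_rate p s" by (simp add: tan_p_rate_def)

lemma continuous_on_tan_p_rate: "p > 1 \<Longrightarrow> continuous_on A (tan_p_rate p)"
  unfolding tan_p_rate_def by (intro continuous_intros continuous_on_powr') auto

lemma has_real_derivative_abs_powr:
  assumes "p > 1"
  shows "((\<lambda>s. \<bar>s\<bar> powr p) has_real_derivative p * \<bar>s\<bar> powr (p - 1) * sgn s) (at s)"
proof -
  consider "s > 0" | "s < 0" | "s = 0" by linarith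
  then show ?thesis
  proof cases
    case 1
    have "((\<lambda>s. s powr p) has_real_derivative p * s powr (p - 1)) (at s)"
      using 1 by (intro has_real_derivative_powr)
    then have "((\<lambda>s. \<bar>s\<bar> powr p) has_real_derivative p * s powr (p - 1)) (at s)"
      by (rule has_field_derivative_transform_within_open[of _ _ _ "{0<..}"]) (use 1 in auto)
    then show ?thesis using 1 by simp
  next
    case 2
    have "((\<lambda>s. (- s) powr p) has_real_derivative p * (- s) powr (p - 1) * (- 1)) (at s)"
      by (rule DERIV_chain2[where g = uminus, OF has_real_derivative_powr]) (use 2 in \<open>auto intro!: derivative_eq_intros\<close>)
    then have "((\<lambda>s. \<bar>s\<bar> powr p) has_real_derivative p * (- s) powr (p - 1) * (- 1)) (at s)"
      by (rule has_field_derivative_transform_within_open[of _ _ _ "{..<0}"]) (use 2 in auto)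
    then show ?thesis using 2 by simp
  next
    case 3
    have "((\<lambda>h. (\<bar>0 + h\<bar> powr p - \<bar>0\<bar> powr p) / h) \<longlongrightarrow> 0) (at 0)"
    proof (rule Lim_null_comparison)
      have "norm ((\<bar>0 + h\<bar> powr p - \<bar>0\<bar> powr p) / h) \<le> \<bar>h\<bar> powr (p - 1)" if "h \<noteq> 0" for h :: real
        using that assms by (simp add: powr_diff)
      then show "\<forall>\<^sub>F h in at 0. norm ((\<bar>0 + h\<bar> powr p - \<bar>0 :: real\<bar> powr p) / h) \<le> \<bar>h\<bar> powr (p - 1)"
        by (auto simp: eventually_at_filter)
      have "((\<lambda>h. \<bar>h\<bar> powr (p - 1)) \<longlongrightarrow> \<bar>0\<bar> powr (p - 1)) (at (0 :: real))"
        by (rule tendsto_powr') (use assms in \<open>auto intro!: tendsto_rabs_zero tendsto_ident_at\<close>)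
      then show "((\<lambda>h. \<bar>h\<bar> powr (p - 1)) \<longlongrightarrow> 0) (at (0 :: real))" by simp
    qed
    then show ?thesis using 3 by (simp add: DERIV_def)
  qed
qed

lemma has_real_derivative_tan_p_rate:
  assumes "p > 1"
  shows "(tan_p_rate p has_real_derivative p * \<bar>s\<bar> powr (p - 1) * sgn s / (p - 1)) (at s)"
  unfolding tan_p_rate_def
  using DERIV_add[OF DERIV_const[of 1] DERIV_cdivide[OF has_real_derivative_abs_powr[OF assms, of s], of "p - 1"]]
  by simp

lemma abs_powr_times_sgn: "\<bar>s\<bar> powr (p - 1) * sgn s * s = \<bar>s::real\<bar> powr p"
proof -
  have "sgn s * s = \<bar>s\<bar>" by (simp add: sgn_if)
  then show ?thesis by (simp add: mult.assoc powr_minus_one_mult)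
qed

lemma has_real_derivative_arctan_p:
  assumes p: "p > 1" shows "(arctan_p p has_real_derivative 1 / tan_p_rate p s) (at s)"
proof -
  define A where "A = \<bar>s\<bar> + 1"
  have c: "continuous_on {-A..A} (\<lambda>t. 1 / tan_p_rate p t)"
    using tan_p_rate_pos[OF p] by (intro continuous_intros continuous_on_tan_p_rate p) (auto simp: less_le)
  have int: "(\<lambda>t. 1 / tan_p_rate p t) integrable_on {a..b}" if "-A \<le> a" "b \<le> A" for a b
    by (rule integrable_continuous_interval) (use that in \<open>auto intro: continuous_on_subset[OF c]\<close>)
  have eq: "arctan_p p t = integral {-A..t} (\<lambda>t. 1 / tan_p_rate p t) - integral {-A..0} (\<lambda>t. 1 / tan_p_rate p t)"
    if t: "t \<in> {-A..A}" for t
  proof (cases "t \<ge> 0")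
    case True
    have "integral {-A..0} (\<lambda>t. 1 / tan_p_rate p t) + integral {0..t} (\<lambda>t. 1 / tan_p_rate p t) = integral {-A..t} (\<lambda>t. 1 / tan_p_rate p t)"
      by (rule Henstock_Kurzweil_Integration.integral_combine) (use True t int[of "-A" t] in auto)
    moreover have "integral {t..0} (\<lambda>t. 1 / tan_p_rate p t) = 0" using True by (cases "t = 0") auto
    ultimately show ?thesis by (simp add: arctan_p_def)
  next
    case False
    have "integral {-A..t} (\<lambda>t. 1 / tan_p_rate p t) + integral {t..0} (\<lambda>t. 1 / tan_p_rate p t) = integral {-A..0} (\<lambda>t. 1 / tan_p_rate p t)"
      by (rule Henstock_Kurzweil_Integration.integral_combine) (use False t int[of "-A" 0] in \<open>auto simp: A_def\<close>)
    then show ?thesis using False by (simp add: arctan_p_def)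
  qed
  have s: "s \<in> {-A<..<A}" by (auto simp: A_def)
  have "((\<lambda>t. integral {-A..t} (\<lambda>t. 1 / tan_p_rate p t)) has_real_derivative 1 / tan_p_rate p s) (at s within {-A..A})"
    by (rule integral_has_real_derivative[OF c]) (use s in auto)
  then have "((\<lambda>t. integral {-A..t} (\<lambda>t. 1 / tan_p_rate p t)) has_real_derivative 1 / tan_p_rate p s) (at s)"
    using at_within_interior[of s "{-A..A}"] s by simp
  then have "((\<lambda>t. integral {-A..t} (\<lambda>t. 1 / tan_p_rate p t) - integral {-A..0} (\<lambda>t. 1 / tan_p_rate p t)) has_real_derivative 1 / tan_p_rate p s) (at s)"
    by (auto intro!: derivative_eq_intros)
  then show ?thesis
    by (rule has_field_derivative_transform_within_open[of _ _ _ "{-A<..<A}"]) (use s eq in auto)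
qed

lemma arctan_p_0 [simp]: "arctan_p p 0 = 0" by (simp add: arctan_p_def)

lemma arctan_p_minus:
  assumes p: "p > 1" shows "arctan_p p (- s) = - arctan_p p s"
proof -
  have "((\<lambda>s. arctan_p p s + arctan_p p (- s)) has_real_derivative 0) (at s)" for s
  proof -
    have "((\<lambda>s. arctan_p p (- s)) has_real_derivative 1 / tan_p_rate p (- s) * (- 1)) (at s)"
      by (rule DERIV_chain2[where g = uminus, OF has_real_derivative_arctan_p[OF p]]) (auto intro!: derivative_eq_intros)
    then show ?thesis using DERIV_add[OF has_real_derivative_arctan_p[OF p, of s]] by fastforce
  qed
  then have "arctan_p p s + arctan_p p (- s) = arctan_p p 0 + arctan_p p (- 0)"
    by (intro DERIV_isconst_all[of "\<lambda>s. arctan_p p s + arctan_p p (- s)"]) auto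
  then show ?thesis by simp
qed

lemma arctan_p_strict_mono:
  assumes p: "p > 1" and "s < t" shows "arctan_p p s < arctan_p p t"
proof (rule DERIV_pos_imp_increasing[OF assms(2)])
  fix x
  show "\<exists>y. (arctan_p p has_real_derivative y) (at x) \<and> 0 < y"
    using has_real_derivative_arctan_p[OF p, of x] tan_p_rate_pos[OF p, of x] by (intro exI[of _ "1 / tan_p_rate p x"]) auto
qed

lemma continuous_on_arctan_p: "p > 1 \<Longrightarrow> continuous_on A (arctan_p p)"
  by (meson DERIV_continuous_on has_field_derivative_at_within has_real_derivative_arctan_p)

text \<open>The tail of the integrand is at most \<open>(p - 1) t\<^sup>-\<^sup>p\<close>, the derivative of \<open>- t\<^sup>1\<^sup>-\<^sup>p\<close>.\<close>

lemma arctan_p_bounded: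
  assumes p: "p > 1" shows "arctan_p p s \<le> arctan_p p 1 + 1"
proof (cases "s \<le> 1")
  case True
  then show ?thesis using arctan_p_strict_mono[OF p, of s 1] by (cases "s = 1") auto
next
  case False
  have "arctan_p p s + s powr (1 - p) \<le> arctan_p p 1 + 1 powr (1 - p)"
  proof (rule DERIV_nonpos_imp_nonincreasing[where f = "\<lambda>s. arctan_p p s + s powr (1 - p)"])
    show "1 \<le> s" using False by simp
    fix x assume x: "1 \<le> x" "x \<le> s"
    have "((\<lambda>s. arctan_p p s + s powr (1 - p)) has_real_derivative 1 / tan_p_rate p x + (1 - p) * x powr (1 - p - 1)) (at x)"
      using x by (intro DERIV_add has_real_derivative_arctan_p p has_real_derivative_powr) auto
    moreover have "1 / tan_p_rate p x + (1 - p) * x powr (1 - p - 1) \<le> 0"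
    proof -
      have "x powr p / (p - 1) \<le> tan_p_rate p x" using x by (simp add: tan_p_rate_def)
      then have "1 / tan_p_rate p x \<le> 1 / (x powr p / (p - 1))" using x p tan_p_rate_pos[OF p, of x] by (intro divide_left_mono) auto
      also have "\<dots> = (p - 1) * x powr (- p)" by (simp add: powr_minus field_simps)
      finally show ?thesis by (simp add: algebra_simps)
    qed
    ultimately show "\<exists>y. ((\<lambda>s. arctan_p p s + s powr (1 - p)) has_real_derivative y) (at x) \<and> y \<le> 0" by blast
  qed
  moreover have "0 \<le> s powr (1 - p)" by (rule powr_ge_zero)
  ultimately show ?thesis unfolding powr_one_eq_one by linarith
qed

definition quarter_period :: "real \<Rightarrow> real" where "quarter_period p = (SUP s. arctan_p p s)"

lemma arctan_p_bdd_above: "p > 1 \<Longrightarrow> bdd_above (range (arctan_p p))"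
  using arctan_p_bounded by (auto intro!: bdd_aboveI)

lemma arctan_p_less_quarter_period: 
  assumes "p > 1" shows "arctan_p p s < quarter_period p"
proof -
  have "arctan_p p s < arctan_p p (s + 1)" by (rule arctan_p_strict_mono[OF assms]) simp
  also have "\<dots> \<le> quarter_period p"
    unfolding quarter_period_def by (intro cSUP_upper arctan_p_bdd_above assms) auto
  finally show ?thesis .
qed

lemma arctan_p_tendsto: 
  assumes p: "p > 1" shows "(arctan_p p \<longlongrightarrow> quarter_period p) at_top"
proof (rule order_tendstoI)
  fix y assume "quarter_period p < y"
  then show "\<forall>\<^sub>F x in at_top. arctan_p p x < y"
    using arctan_p_less_quarter_period[OF p] by (auto intro: always_eventually less_trans)
next
  fix y assume "y < quarter_period p"
  then obtain s where s: "y < arctan_p p s"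
    unfolding quarter_period_def by (subst (asm) less_cSUP_iff) (auto intro: arctan_p_bdd_above p)
  show "\<forall>\<^sub>F x in at_top. y < arctan_p p x"
    using eventually_gt_at_top[of s] by eventually_elim (use s arctan_p_strict_mono[OF p] in \<open>auto intro: less_trans\<close>)
qed

lemma half_length_eq_arctan_p:
  assumes "p > 1" "M \<ge> 0" shows "half_length p M 0 = arctan_p p M"
proof -
  have "integral {M..0} (\<lambda>t. 1 / tan_p_rate p t) = 0" using assms by (cases "M = 0") auto
  moreover have "integral {0..M} (\<lambda>s. 1 / riccati_rate p 0 s) = integral {0..M} (\<lambda>t. 1 / tan_p_rate p t)"
    by (rule Henstock_Kurzweil_Integration.integral_cong) (auto simp: riccati_rate_def tan_p_rate_def)
  ultimately show ?thesis by (simp add: half_length_def arctan_p_def)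
qed

text \<open>The substitution \<open>\<sigma> = t / (1 - t\<^sup>p / (p - 1))\<^sup>1\<^sup>/\<^sup>p\<close> maps \<open>(0, (p - 1)\<^sup>1\<^sup>/\<^sup>p)\<close> onto \<open>(0, \<infinity>)\<close> and turns the integrand
of \<open>pi_p\<close> into \<open>1 / tan_p_rate p \<sigma>\<close>.\<close>

lemma pi_p_eq_quarter_period:
  assumes p: "p > 1" shows "pi_p p = 2 * quarter_period p"
proof -
  define T where "T = (p - 1) powr (1 / p)"
  have T: "T > 0" using p by (simp add: T_def)
  have TP: "T powr p = p - 1" using p by (simp add: T_def powr_powr)
  define m where "m = (\<lambda>t. 1 - t powr p / (p - 1))"
  define \<sigma> where "\<sigma> = (\<lambda>t. t * m t powr (- (1 / p)))"
  have m: "0 < m t" if "0 < t" "t < T" for t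
  proof -
    have "t powr p < T powr p" using that p by (intro powr_less_mono2) auto
    then show ?thesis using p by (simp add: m_def TP field_simps)
  qed
  have dm: "(m has_real_derivative - (p * t powr (p - 1)) / (p - 1)) (at t)" if "0 < t" for t
    unfolding m_def using that p
    by (auto intro!: derivative_eq_intros)
  have dX: "((\<lambda>t. arctan_p p (\<sigma> t)) has_real_derivative m t powr (- (1 / p))) (at t)" if t: "0 < t" "t < T" for t
  proof -
    have mt: "m t > 0" using m t by auto
    have "((\<lambda>t. m t powr (- (1 / p))) has_real_derivative - (1 / p) * m t powr (- (1 / p) - 1) * (- (p * t powr (p - 1)) / (p - 1))) (at t)"
      by (rule DERIV_chain2[OF has_real_derivative_powr[OF mt] dm[OF t(1)]])
    then have "(\<sigma> has_real_derivative 1 * m t powr (- (1 / p)) + - (1 / p) * m t powr (- (1 / p) - 1) * (- (p * t powr (p - 1)) / (p - 1)) * t) (at t)"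
      unfolding \<sigma>_def by (intro DERIV_mult DERIV_ident)
    moreover have "1 * m t powr (- (1 / p)) + - (1 / p) * m t powr (- (1 / p) - 1) * (- (p * t powr (p - 1)) / (p - 1)) * t
        = m t powr (- (1 / p) - 1)"
    proof -
      have e: "m t powr (- (1 / p)) = m t powr (- (1 / p) - 1) * m t" using mt by (simp add: powr_diff)
      have tp: "t powr (p - 1) * t = t powr p" using t by (simp add: powr_diff)
      have "1 * m t powr (- (1 / p)) + - (1 / p) * m t powr (- (1 / p) - 1) * (- (p * t powr (p - 1)) / (p - 1)) * t
          = m t powr (- (1 / p) - 1) * (m t + (t powr (p - 1) * t) / (p - 1))"
        unfolding e using p by (simp add: field_simps)
      also have "m t + (t powr (p - 1) * t) / (p - 1) = 1" unfolding tp by (simp add: m_def)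
      finally show ?thesis by simp
    qed
    ultimately have "(\<sigma> has_real_derivative m t powr (- (1 / p) - 1)) (at t)" by simp
    then have "((\<lambda>t. arctan_p p (\<sigma> t)) has_real_derivative 1 / tan_p_rate p (\<sigma> t) * m t powr (- (1 / p) - 1)) (at t)"
      by (rule DERIV_chain2[OF has_real_derivative_arctan_p[OF p]])
    moreover have "tan_p_rate p (\<sigma> t) = 1 / m t"
    proof -
      have "\<bar>\<sigma> t\<bar> powr p = t powr p / m t"
      proof -
        have "(m t powr (- (1 / p))) powr p = inverse (m t)"
        proof -
          have "(m t powr (- (1 / p))) powr p = m t powr (- (1 / p) * p)" by (rule powr_powr)
          also have "- (1 / p) * p = - 1" using p by simp
          finally show ?thesis using mt by (simp add: powr_minus)
        qed
        then show ?thesis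
          using t by (simp add: \<sigma>_def abs_mult powr_mult divide_inverse)
      qed
      then have "tan_p_rate p (\<sigma> t) = (m t + t powr p / (p - 1)) / m t" using mt by (simp add: tan_p_rate_def field_simps)
      then show ?thesis by (simp add: m_def)
    qed
    moreover have "1 / (1 / m t) * m t powr (- (1 / p) - 1) = m t powr (- (1 / p))"
      using mt by (simp add: powr_diff)
    ultimately show ?thesis by simp
  qed
  have contm: "continuous_on {0..T} m"
    unfolding m_def using p by (intro continuous_intros continuous_on_powr') auto
  have m0: "m 0 = 1" using p by (simp add: m_def)
  have mT: "m T = 0" using p by (simp add: m_def TP)
  have lim0: "((\<lambda>t. arctan_p p (\<sigma> t)) \<longlongrightarrow> 0) (at_right 0)"
  proof -
    have "(m \<longlongrightarrow> m 0) (at 0 within {0..T})" using contm T by (auto simp: continuous_on_def)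
    then have "(m \<longlongrightarrow> 1) (at_right 0)" using T m0 by (simp add: at_within_Icc_at_right)
    then have "(\<sigma> \<longlongrightarrow> 0 * 1 powr (- (1 / p))) (at_right 0)"
      unfolding \<sigma>_def by (intro tendsto_intros) auto
    then have "((\<lambda>t. arctan_p p (\<sigma> t)) \<longlongrightarrow> arctan_p p 0) (at_right 0)"
      using continuous_on_arctan_p[OF p, of UNIV] by (intro isCont_tendsto_compose[of _ "arctan_p p"]) (auto simp: continuous_on_eq_continuous_at)
    then show ?thesis by simp
  qed
  have limT: "((\<lambda>t. arctan_p p (\<sigma> t)) \<longlongrightarrow> quarter_period p) (at_left T)"
  proof -
    have "(m \<longlongrightarrow> m T) (at T within {0..T})" using contm T by (auto simp: continuous_on_def)
    then have "(m \<longlongrightarrow> 0) (at_left T)" using T mT by (simp add: at_within_Icc_at_left)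
    moreover have ev: "\<forall>\<^sub>F t in at_left T. 0 < t \<and> t < T"
      using T eventually_at_left_real[of 0 T] by (auto elim: eventually_mono)
    then have "\<forall>\<^sub>F t in at_left T. m t > 0" by eventually_elim (use m in auto)
    ultimately have "filterlim m (at_right 0) (at_left T)"
      by (auto simp: filterlim_at elim: eventually_mono)
    then have "filterlim (\<lambda>t. m t powr (- (1 / p))) at_top (at_left T)"
      by (rule filterlim_compose[OF _ , rotated]) (use p in real_asymp)
    then have "filterlim \<sigma> at_top (at_left T)"
      unfolding \<sigma>_def by (rule filterlim_tendsto_pos_mult_at_top[OF tendsto_ident_at T])
    then show ?thesis by (rule filterlim_compose[OF arctan_p_tendsto[OF p]])
  qed
  have "(LBINT t=ereal 0..ereal T. m t powr (- (1 / p))) = quarter_period p - 0"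
  proof (rule interval_integral_FTC_nonneg(2)[where F = "\<lambda>t. arctan_p p (\<sigma> t)"])
    show "isCont (\<lambda>t. m t powr (- (1 / p))) t" if "ereal 0 < ereal t" "ereal t < ereal T" for t
      using that m[of t] DERIV_isCont[OF dm[of t]] by (intro continuous_intros) auto
    show "(((\<lambda>t. arctan_p p (\<sigma> t)) \<circ> real_of_ereal) \<longlongrightarrow> 0) (at_right (ereal 0))"
      using lim0 by (simp only: ereal_tendsto_simps1)
    show "(((\<lambda>t. arctan_p p (\<sigma> t)) \<circ> real_of_ereal) \<longlongrightarrow> quarter_period p) (at_left (ereal T))"
      using limT by (simp only: ereal_tendsto_simps1)
  qed (use T dX in auto)
  also have "(LBINT t=ereal 0..ereal T. m t powr (- (1 / p))) = (LBINT t:{0..T}. m t powr (- (1 / p)))"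
    using T by (intro interval_integral_Icc) auto
  also have "\<dots> = (LINT t:{0..T}|lebesgue. m t powr (- (1 / p)))"
    unfolding set_lebesgue_integral_def m_def by (rule integral_completion[symmetric]) measurable
  also have "\<dots> = (LINT t:{0..T}|lebesgue. 1 / (1 - t powr p / (p - 1)) powr (1 / p))"
    by (simp add: m_def powr_minus field_simps)
  finally show ?thesis by (simp add: pi_p_def T_def)
qed

lemma tan_p_ex:
  assumes p: "p > 1"
  obtains \<tau> where "\<And>y. y \<in> {- quarter_period p<..<quarter_period p} \<Longrightarrow> arctan_p p (\<tau> y) = y"
    "\<And>y. y \<in> {- quarter_period p<..<quarter_period p} \<Longrightarrow> (\<tau> has_real_derivative tan_p_rate p (\<tau> y)) (at y)"
    "\<And>s. \<tau> (arctan_p p s) = s"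
proof -
  let ?H = "quarter_period p"
  have inj: "inj (arctan_p p)"
    by (rule linorder_injI) (use arctan_p_strict_mono[OF p] in \<open>auto simp: less_le\<close>)
  define \<tau> where "\<tau> = inv (arctan_p p)"
  have \<tau>: "\<tau> (arctan_p p s) = s" for s unfolding \<tau>_def by (rule inv_f_f[OF inj])
  have ex: "\<exists>s. arctan_p p s = y" if y: "y \<in> {- ?H<..<?H}" for y
  proof -
    have *: "\<exists>s. z < arctan_p p s" if "z < ?H" for z
      using that unfolding quarter_period_def by (subst (asm) less_cSUP_iff) (auto intro: arctan_p_bdd_above p)
    obtain s where s: "y < arctan_p p s" using *[of y] y by auto
    obtain r where r: "- y < arctan_p p r" using *[of "- y"] y by auto
    have "arctan_p p (- r) < y" using r arctan_p_minus[OF p, of r] by simp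
    moreover from this s have "- r \<le> s"
      using arctan_p_strict_mono[OF p, of s "- r"] by (cases "s < - r") auto
    ultimately show ?thesis
      using IVT'[of "arctan_p p" "- r" y s] s continuous_on_arctan_p[OF p] by auto
  qed
  show ?thesis
  proof (rule that[of \<tau>])
    fix y assume y: "y \<in> {- ?H<..<?H}"
    obtain s where s: "arctan_p p s = y" using ex[OF y] by blast
    show "arctan_p p (\<tau> y) = y" using s \<tau> by auto
    have "(\<tau> has_real_derivative inverse (1 / tan_p_rate p s)) (at (arctan_p p s))"
    proof (rule has_derivative_inverse_strong[of UNIV s "arctan_p p" \<tau> "(*) (1 / tan_p_rate p s)" "(*) (inverse (1 / tan_p_rate p s))", folded has_field_derivative_def])
      show "(*) (1 / tan_p_rate p s) \<circ> (*) (inverse (1 / tan_p_rate p s)) = id"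
        using tan_p_rate_pos[OF p, of s] by (auto simp: fun_eq_iff)
    qed (auto simp: \<tau> continuous_on_arctan_p[OF p] has_real_derivative_arctan_p[OF p])
    then show "(\<tau> has_real_derivative tan_p_rate p (\<tau> y)) (at y)" using s \<tau> by auto
  qed (rule \<tau>)
qed

text \<open>The generalised sine as a function of the generalised tangent \<open>s\<close>.  As a function of the angle, where
\<open>ds = tan_p_rate p s\<close>, its derivative is \<open>(tan_p_rate p s)\<^sup>-\<^sup>1\<^sup>/\<^sup>p\<close>.\<close>

definition sin_p_of_tan :: "real \<Rightarrow> real \<Rightarrow> real" where
  "sin_p_of_tan p s = s * tan_p_rate p s powr (- (1 / p))"

lemma has_real_derivative_sin_p_of_tan:
  assumes p: "p > 1"
  shows "(sin_p_of_tan p has_real_derivative tan_p_rate p s powr (- (1 / p) - 1)) (at s)"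
proof -
  define q where "q = tan_p_rate p s"
  have q: "q > 0" unfolding q_def by (rule tan_p_rate_pos[OF p])
  have "((\<lambda>s. tan_p_rate p s powr (- (1 / p))) has_real_derivative - (1 / p) * q powr (- (1 / p) - 1) * (p * \<bar>s\<bar> powr (p - 1) * sgn s / (p - 1))) (at s)"
    unfolding q_def by (rule DERIV_chain2[OF has_real_derivative_powr has_real_derivative_tan_p_rate[OF p]]) (rule tan_p_rate_pos[OF p])
  then have "(sin_p_of_tan p has_real_derivative 1 * q powr (- (1 / p)) + - (1 / p) * q powr (- (1 / p) - 1) * (p * \<bar>s\<bar> powr (p - 1) * sgn s / (p - 1)) * s) (at s)"
    unfolding sin_p_of_tan_def q_def by (intro DERIV_mult DERIV_ident)
  moreover have "1 * q powr (- (1 / p)) + - (1 / p) * q powr (- (1 / p) - 1) * (p * \<bar>s\<bar> powr (p - 1) * sgn s / (p - 1)) * s = q powr (- (1 / p) - 1)"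
  proof -
    have e: "q powr (- (1 / p)) = q powr (- (1 / p) - 1) * q" using q by (simp add: powr_diff)
    have "1 * q powr (- (1 / p)) + - (1 / p) * q powr (- (1 / p) - 1) * (p * \<bar>s\<bar> powr (p - 1) * sgn s / (p - 1)) * s
      = q powr (- (1 / p) - 1) * (q - (\<bar>s\<bar> powr (p - 1) * sgn s * s) / (p - 1))"
      unfolding e using p by (simp add: field_simps)
    also have "q - (\<bar>s\<bar> powr (p - 1) * sgn s * s) / (p - 1) = 1" unfolding abs_powr_times_sgn by (simp add: q_def tan_p_rate_def)
    finally show ?thesis by simp
  qed
  ultimately show ?thesis by (simp add: q_def)
qed

lemma abs_sin_p_of_tan_powr:
  assumes p: "p > 1" shows "\<bar>sin_p_of_tan p s\<bar> powr p = \<bar>s\<bar> powr p / tan_p_rate p s"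
proof -
  have "(tan_p_rate p s powr (- (1 / p))) powr p = tan_p_rate p s powr (- (1 / p) * p)" by (rule powr_powr)
  also have "- (1 / p) * p = - 1" using p by simp
  finally have "(tan_p_rate p s powr (- (1 / p))) powr p = inverse (tan_p_rate p s)" using tan_p_rate_pos[OF p, of s] by (simp add: powr_minus)
  then show ?thesis by (simp add: sin_p_of_tan_def abs_mult powr_mult divide_inverse)
qed

lemma cos_p_powr:
  assumes p: "p > 1" shows "\<bar>tan_p_rate p s powr (- (1 / p))\<bar> powr p = 1 / tan_p_rate p s"
proof -
  have "(tan_p_rate p s powr (- (1 / p))) powr p = tan_p_rate p s powr (- (1 / p) * p)" by (rule powr_powr)
  also have "- (1 / p) * p = - 1" using p by simp
  finally show ?thesis using tan_p_rate_pos[OF p, of s] by (simp add: powr_minus divide_inverse)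
qed

lemma set_integrable_bounded_continuous:
  fixes w :: "real \<Rightarrow> real"
  assumes c: "continuous_on {a<..<b} w" and B: "\<And>x. x \<in> {a<..<b} \<Longrightarrow> \<bar>w x\<bar> \<le> B"
  shows "set_integrable lebesgue {a<..<b} w"
  unfolding set_integrable_def
proof (rule Bochner_Integration.integrable_bound)
  show "integrable lebesgue (\<lambda>x. indicator {a<..<b} x * B :: real)"
    using absolutely_integrable_on_const[of "{a<..<b}" B] by (simp add: set_integrable_def)
  show "(\<lambda>x. indicator {a<..<b} x *\<^sub>R w x) \<in> borel_measurable lebesgue"
    by (rule measurable_completion) (use borel_measurable_continuous_on_indicator[OF _ c] in simp)
  show "AE x in lebesgue. norm (indicator {a<..<b} x *\<^sub>R w x) \<le> norm (indicator {a<..<b} x * B)"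
    using B by (intro always_eventually allI) (force simp: indicator_def)
qed

lemma locally_integrable_on_if_set_integrable:
  assumes "set_integrable lebesgue S w" shows "locally_integrable_on S w"
  unfolding locally_integrable_on_def
  using assms by (auto intro!: set_integrable_subset[OF assms] dest: lmeasurable_compact)

lemma classical_derivative_is_weak:
  fixes v v' :: "real \<Rightarrow> real"
  assumes ab: "a < b" and D: "\<And>x. x \<in> {a<..<b} \<Longrightarrow> (v has_real_derivative v' x) (at x)"
    and c: "continuous_on {a<..<b} v'" and i: "set_integrable lebesgue {a<..<b} v" "set_integrable lebesgue {a<..<b} v'"
  shows "has_weak_deriv_on {a<..<b} v v'"
  unfolding has_weak_deriv_on_def
proof (intro conjI allI impI locally_integrable_on_if_set_integrable i)
  let ?S = "{a<..<b}"
  fix \<phi> assume \<phi>: "test_function_on ?S \<phi>"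
  obtain c d where cd: "a < c" "c < d" "d < b" "\<And>x. x \<notin> {c..d} \<Longrightarrow> \<phi> x = 0"
    using test_function_support_bounds[OF ab \<phi>] by blast
  define c' where "c' = (a + c) / 2"
  define d' where "d' = (d + b) / 2"
  have cd': "a < c'" "c' < c" "d < d'" "d' < b" "c' \<le> d'" using cd by (auto simp: c'_def d'_def)
  have dz: "deriv \<phi> x = 0" if "x \<notin> {c..d}" for x
    by (rule deriv_zero_outside[of c d \<phi>, OF cd(4) that])
  have sub: "{c'..d'} \<subseteq> ?S" using cd' by auto
  have contv: "continuous_on {c'..d'} v"
    using D sub by (meson DERIV_continuous continuous_at_imp_continuous_on subsetD)
  have si: "set_integrable lebesgue {c'..d'} (\<lambda>x. v x * deriv \<phi> x)" "set_integrable lebesgue {c'..d'} (\<lambda>x. v' x * \<phi> x)"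
    by (intro absolutely_integrable_continuous_real continuous_intros contv test_function_derivative(2)[OF \<phi>]
        test_function_continuous[OF \<phi>] continuous_on_subset[OF c sub])+
  have "((\<lambda>x. v x * \<phi> x) has_real_derivative v' x * \<phi> x + deriv \<phi> x * v x) (at x)" if "x \<in> {c'..d'}" for x
    using that sub by (intro DERIV_mult D test_function_derivative(1)[OF \<phi>]) auto
  then have "((\<lambda>x. v' x * \<phi> x + deriv \<phi> x * v x) has_integral v d' * \<phi> d' - v c' * \<phi> c') {c'..d'}"
    using cd' by (intro fundamental_theorem_of_calculus)
      (auto intro: has_field_derivative_at_within simp flip: has_real_derivative_iff_has_vector_derivative)
  moreover have "\<phi> d' = 0" "\<phi> c' = 0" using cd(4)[of d'] cd(4)[of c'] cd' by auto
  ultimately have "integral {c'..d'} (\<lambda>x. v' x * \<phi> x + v x * deriv \<phi> x) = 0"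
    by (simp add: integral_unique mult.commute)
  also have "integral {c'..d'} (\<lambda>x. v' x * \<phi> x + v x * deriv \<phi> x) = (LINT x:{c'..d'}|lebesgue. v' x * \<phi> x + v x * deriv \<phi> x)"
    by (rule set_lebesgue_integral_eq_integral(2)[symmetric]) (intro set_integral_add si)
  also have "\<dots> = (LINT x:{c'..d'}|lebesgue. v' x * \<phi> x) + (LINT x:{c'..d'}|lebesgue. v x * deriv \<phi> x)"
    by (rule set_integral_add) (rule si)+
  also have "(LINT x:{c'..d'}|lebesgue. v' x * \<phi> x) = (LINT x:?S|lebesgue. v' x * \<phi> x)"
    unfolding set_lebesgue_integral_def
  proof (rule Bochner_Integration.integral_cong[OF refl])
    show "indicator {c'..d'} x *\<^sub>R (v' x * \<phi> x) = indicator ?S x *\<^sub>R (v' x * \<phi> x)" for x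
      using cd(4)[of x] cd' cd by (cases "x \<in> {c..d}") (auto simp: indicator_def)
  qed
  also have "(LINT x:{c'..d'}|lebesgue. v x * deriv \<phi> x) = (LINT x:?S|lebesgue. v x * deriv \<phi> x)"
    unfolding set_lebesgue_integral_def
  proof (rule Bochner_Integration.integral_cong[OF refl])
    show "indicator {c'..d'} x *\<^sub>R (v x * deriv \<phi> x) = indicator ?S x *\<^sub>R (v x * deriv \<phi> x)" for x
      using dz[of x] cd' cd by (cases "x \<in> {c..d}") (auto simp: indicator_def)
  qed
  finally show "(LINT x:?S|lebesgue. v x * deriv \<phi> x) = - (LINT x:?S|lebesgue. v' x * \<phi> x)" by simp
qed

text \<open>Reflection at the midpoint of the interval changes the sign of the integral.\<close>

lemma set_integral_odd_zero:
  fixes w :: "real \<Rightarrow> real"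
  assumes c: "continuous_on {0<..<L} w" and odd: "\<And>x. x \<in> {0<..<L} \<Longrightarrow> w (L - x) = - w x"
  shows "(LINT x:{0<..<L}|lebesgue. w x) = 0"
proof -
  let ?w = "\<lambda>x. indicator {0<..<L} x *\<^sub>R w x"
  have m: "?w \<in> borel_measurable lborel" using borel_measurable_continuous_on_indicator[OF _ c] by simp
  have "(LINT x:{0<..<L}|lebesgue. w x) = (LINT x|lborel. ?w x)"
    unfolding set_lebesgue_integral_def by (rule integral_completion[OF m])
  also have "\<dots> = \<bar>-1\<bar> *\<^sub>R (LINT x|lborel. ?w (L + (-1) * x))"
    by (rule lborel_integral_real_affine) simp
  also have "\<dots> = (LINT x|lborel. - ?w x)"
  proof -
    have "?w (L + (-1) * x) = - ?w x" for x
      using odd[of x] by (cases "x \<in> {0<..<L}") (auto simp: indicator_def)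
    then show ?thesis by (simp only: abs_minus_cancel abs_one scaleR_one)
  qed
  also have "\<dots> = - (LINT x|lborel. ?w x)" by simp
  finally have "(LINT x|lborel. ?w x) = 0" "(LINT x:{0<..<L}|lebesgue. w x) = (LINT x|lborel. ?w x)"
    by (simp_all add: \<open>(LINT x:{0<..<L}|lebesgue. w x) = (LINT x|lborel. ?w x)\<close>)
  then show ?thesis by simp
qed

text \<open>The extremal function \<open>v\<close> is the generalised sine, rescaled so that its half period becomes \<open>L\<close> and
centred at \<open>L / 2\<close>.  The constraint holds because \<open>v\<close> is odd about \<open>L / 2\<close>.  The function \<open>F = s / Q\<close>,
where \<open>Q = tan_p_rate p s\<close>, has derivative \<open>k (1 / Q - |v|\<^sup>p)\<close> and tends to zero at both ends;
since \<open>|v'|\<^sup>p = k\<^sup>p / Q\<close>, this is the equality of \<open>\<integral> |v'|\<^sup>p\<close> and \<open>k\<^sup>p \<integral> |v|\<^sup>p\<close>.  The conservation law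
\<open>|v|\<^sup>p / (p - 1) + |v' / k|\<^sup>p = 1\<close> shows that these integrals are positive.\<close>

lemma extremal_function:
  fixes L p :: real
  assumes L: "L > 0" and p: "p \<ge> 2"
  obtains v where "v \<in> admissible p L (\<lambda>_. 1)" "rayleigh p L (\<lambda>_. 1) v = (pi_p p / L) powr p"
proof -
  let ?S = "{0<..<L}"
  have p1: "p > 1" using p by simp
  define H where "H = quarter_period p"
  have H: "H > 0" using arctan_p_less_quarter_period[OF p1, of 0] by (simp add: H_def)
  define k where "k = 2 * H / L"
  have k: "k > 0" using H L by (simp add: k_def)
  have kpi: "k = pi_p p / L" by (simp add: k_def H_def pi_p_eq_quarter_period[OF p1])
  obtain \<tau> where \<tau>: "\<And>y. y \<in> {- H<..<H} \<Longrightarrow> arctan_p p (\<tau> y) = y"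
    "\<And>y. y \<in> {- H<..<H} \<Longrightarrow> (\<tau> has_real_derivative tan_p_rate p (\<tau> y)) (at y)"
    "\<And>s. \<tau> (arctan_p p s) = s"
    using tan_p_ex[OF p1] unfolding H_def by blast
  define y where "y = (\<lambda>x. k * (x - L / 2))"
  have y: "y x \<in> {- H<..<H}" if "x \<in> ?S" for x
  proof -
    have "k * (x - L / 2) < k * (L / 2)" "k * (- (L / 2)) < k * (x - L / 2)"
      by (intro mult_strict_left_mono; use that k in simp)+
    moreover have "k * (L / 2) = H" using L by (simp add: k_def)
    ultimately show ?thesis by (auto simp: y_def)
  qed
  define s where "s = (\<lambda>x. \<tau> (y x))"
  have ds: "(s has_real_derivative tan_p_rate p (s x) * k) (at x)" if "x \<in> ?S" for x
    unfolding s_def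
    by (rule DERIV_chain2[where f = \<tau> and g = y, OF \<tau>(2)[OF y[OF that]]]) (auto intro!: derivative_eq_intros simp: y_def)
  have conts: "continuous_on ?S s"
    using ds by (meson DERIV_continuous continuous_at_imp_continuous_on)
  have odds: "s (L - x) = - s x" if x: "x \<in> ?S" for x
  proof -
    have "y (L - x) = - y x" by (simp add: y_def algebra_simps)
    also have "\<dots> = arctan_p p (- s x)" using \<tau>(1)[OF y[OF x]] by (simp add: s_def arctan_p_minus[OF p1])
    finally show ?thesis by (simp add: s_def \<tau>(3))
  qed
  define v where "v = (\<lambda>x. sin_p_of_tan p (s x))"
  define v' where "v' = (\<lambda>x. k * tan_p_rate p (s x) powr (- (1 / p)))"
  have Qpos: "tan_p_rate p z > 0" for z by (rule tan_p_rate_pos[OF p1])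
  have dv: "(v has_real_derivative v' x) (at x)" if "x \<in> ?S" for x
  proof -
    have "(v has_real_derivative tan_p_rate p (s x) powr (- (1 / p) - 1) * (tan_p_rate p (s x) * k)) (at x)"
      unfolding v_def by (rule DERIV_chain2[OF has_real_derivative_sin_p_of_tan[OF p1] ds[OF that]])
    moreover have "tan_p_rate p (s x) powr (- (1 / p) - 1) * (tan_p_rate p (s x) * k) = v' x"
      using Qpos[of "s x"] by (simp add: v'_def powr_diff)
    ultimately show ?thesis by simp
  qed
  have contv: "continuous_on ?S v"
    using dv by (meson DERIV_continuous continuous_at_imp_continuous_on)
  have contQ: "continuous_on ?S (\<lambda>x. tan_p_rate p (s x))"
    by (rule continuous_on_compose2[OF continuous_on_tan_p_rate[OF p1, of UNIV] conts]) auto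
  have contv': "continuous_on ?S v'"
    unfolding v'_def using Qpos by (intro continuous_intros contQ) (auto simp: less_le)
  have vp: "\<bar>v x\<bar> powr p = \<bar>s x\<bar> powr p / tan_p_rate p (s x)" for x
    unfolding v_def by (rule abs_sin_p_of_tan_powr[OF p1])
  have v'p: "\<bar>v' x\<bar> powr p = k powr p * (1 / tan_p_rate p (s x))" for x
    using k cos_p_powr[OF p1, of "s x"] by (simp add: v'_def abs_mult powr_mult)
  have bQ: "1 / tan_p_rate p z \<le> 1" "0 \<le> 1 / tan_p_rate p z" for z
    using tan_p_rate_ge_1[OF p1, of z] by auto
  have bs: "\<bar>z\<bar> powr p / tan_p_rate p z \<le> p - 1" "0 \<le> \<bar>z\<bar> powr p / tan_p_rate p z" for z
  proof -
    have "(p - 1) * tan_p_rate p z = p - 1 + \<bar>z\<bar> powr p" using p by (simp add: tan_p_rate_def distrib_left)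
    then show "\<bar>z\<bar> powr p / tan_p_rate p z \<le> p - 1" "0 \<le> \<bar>z\<bar> powr p / tan_p_rate p z"
      using Qpos[of z] p by (simp_all add: pos_divide_le_eq)
  qed
  have contvp: "continuous_on ?S (\<lambda>x. \<bar>v x\<bar> powr p)"
    using p by (intro continuous_on_powr' continuous_intros contv) auto
  have contv'p: "continuous_on ?S (\<lambda>x. \<bar>v' x\<bar> powr p)"
    using p by (intro continuous_on_powr' continuous_intros contv') auto
  have ivp: "set_integrable lebesgue ?S (\<lambda>x. \<bar>v x\<bar> powr p)"
    by (rule set_integrable_bounded_continuous[OF contvp, of "p - 1"]) (simp only: vp abs_of_nonneg[OF bs(2)] bs(1))
  have iv'p: "set_integrable lebesgue ?S (\<lambda>x. \<bar>v' x\<bar> powr p)"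
  proof (rule set_integrable_bounded_continuous[OF contv'p, of "k powr p"])
    show "\<bar>\<bar>v' x\<bar> powr p\<bar> \<le> k powr p" for x
      unfolding v'p using mult_left_mono[OF bQ(1)[of "s x"], of "k powr p"] Qpos[of "s x"] by simp
  qed
  have Lp: "w \<in> Lp_on p ?S" if "continuous_on ?S w" "set_integrable lebesgue ?S (\<lambda>x. \<bar>w x\<bar> powr p)" for w
  proof -
    have "(\<lambda>x. indicator ?S x *\<^sub>R w x) \<in> borel_measurable borel"
      by (rule borel_measurable_continuous_on_indicator) (use that in auto)
    then have "(\<lambda>x. indicator ?S x *\<^sub>R w x) \<in> borel_measurable lebesgue"
      by (intro measurable_completion) simp
    then show ?thesis using that by (simp add: Lp_on_def set_borel_measurable_def)
  qed
  have vLp: "v \<in> Lp_on p ?S" "v' \<in> Lp_on p ?S"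
    by (intro Lp contv contv' ivp iv'p)+
  have wd: "has_weak_deriv_on ?S v v'"
    by (rule classical_derivative_is_weak[OF L dv contv' Lp_on_imp_set_integrable[OF vLp(1)] Lp_on_imp_set_integrable[OF vLp(2)]])
       (use p in auto)
  have W: "v \<in> sobolev_W1 p ?S" using vLp wd by (auto simp: sobolev_W1_def)
  have constr: "(LINT x:?S|lebesgue. \<bar>v x\<bar> powr (p - 2) * v x) = 0"
  proof (rule set_integral_odd_zero)
    have "continuous_on UNIV (\<lambda>z :: real. \<bar>z\<bar> powr (p - 2) * z)"
    proof (cases "p = 2")
      case True
      then have "(\<lambda>z :: real. \<bar>z\<bar> powr (p - 2) * z) = (\<lambda>z. z)" by auto
      then show ?thesis by (simp only: continuous_on_id)
    next
      case False
      then show ?thesis using p by (intro continuous_intros continuous_on_powr') auto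
    qed
    then show "continuous_on ?S (\<lambda>x. \<bar>v x\<bar> powr (p - 2) * v x)"
      by (rule continuous_on_compose2[OF _ contv]) auto
    show "\<bar>v (L - x)\<bar> powr (p - 2) * v (L - x) = - (\<bar>v x\<bar> powr (p - 2) * v x)" if "x \<in> ?S" for x
      using odds[OF that] by (simp add: v_def sin_p_of_tan_def)
  qed
  define D where "D = (LINT x:?S|lebesgue. \<bar>v x\<bar> powr p)"
  have E: "(LINT x:?S|lebesgue. \<bar>v' x\<bar> powr p) = k powr p * D"
  proof -
    let ?G = "\<lambda>x. k * (1 / tan_p_rate p (s x) - \<bar>v x\<bar> powr p)"
    define F where "F = (\<lambda>x. s x / tan_p_rate p (s x))"
    have dF: "(F has_real_derivative ?G x) (at x)" if x: "x \<in> ?S" for x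
    proof -
      define q where "q = tan_p_rate p (s x)"
      have q: "q > 0" using Qpos by (simp add: q_def)
      have "((\<lambda>s. s / tan_p_rate p s) has_real_derivative (1 * q - s x * (p * \<bar>s x\<bar> powr (p - 1) * sgn (s x) / (p - 1))) / (q * q)) (at (s x))"
        unfolding q_def by (rule DERIV_divide[OF DERIV_ident has_real_derivative_tan_p_rate[OF p1]]) (use Qpos[of "s x"] in simp)
      then have "(F has_real_derivative (1 * q - s x * (p * \<bar>s x\<bar> powr (p - 1) * sgn (s x) / (p - 1))) / (q * q) * (tan_p_rate p (s x) * k)) (at x)"
        unfolding F_def by (rule DERIV_chain2[where f = "\<lambda>s. s / tan_p_rate p s" and g = s, OF _ ds[OF x]])
      moreover have "(1 * q - s x * (p * \<bar>s x\<bar> powr (p - 1) * sgn (s x) / (p - 1))) / (q * q) * (tan_p_rate p (s x) * k) = k * (1 / q - \<bar>v x\<bar> powr p)"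
      proof -
        have "s x * (p * \<bar>s x\<bar> powr (p - 1) * sgn (s x) / (p - 1)) = p / (p - 1) * (\<bar>s x\<bar> powr (p - 1) * sgn (s x) * s x)"
          by (simp add: mult_ac)
        also have "\<dots> = p / (p - 1) * \<bar>s x\<bar> powr p" by (simp only: abs_powr_times_sgn)
        finally have e: "s x * (p * \<bar>s x\<bar> powr (p - 1) * sgn (s x) / (p - 1)) = p / (p - 1) * \<bar>s x\<bar> powr p" .
        have "1 * (1 + z / r) - (r + 1) / r * z = 1 - z" if "r \<noteq> 0" for z r :: real
          using that by (simp add: field_simps)
        from this[of "p - 1" "\<bar>s x\<bar> powr p"] p
        have "1 * (1 + \<bar>s x\<bar> powr p / (p - 1)) - p / (p - 1) * \<bar>s x\<bar> powr p = 1 - \<bar>s x\<bar> powr p"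
          by simp
        then
        have "1 * q - p / (p - 1) * \<bar>s x\<bar> powr p = 1 - \<bar>s x\<bar> powr p"
          by (simp only: q_def tan_p_rate_def)
        moreover have "(1 - z) / (q * q) * (q * k) = k * (1 / q - z / q)" for z
          using q by (simp add: field_simps)
        ultimately show ?thesis unfolding e vp q_def[symmetric] by simp
      qed
      ultimately show ?thesis by (simp add: q_def)
    qed
    have contG: "continuous_on ?S (\<lambda>x. ?G x)"
      using Qpos by (intro continuous_intros contQ contvp) (auto simp: less_le)
    have iQ: "set_integrable lebesgue ?S (\<lambda>x. 1 / tan_p_rate p (s x))"
      by (rule set_integrable_bounded_continuous[of _ _ _ 1])
         (use Qpos bQ in \<open>auto intro!: continuous_intros contQ simp: less_le\<close>)
    have iG: "set_integrable lebesgue ?S (\<lambda>x. ?G x)"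
      by (intro set_integrable_mult_right set_integral_diff iQ ivp)
    have limQ: "((\<lambda>z. z / tan_p_rate p z) \<longlongrightarrow> 0) at_top"
    proof (rule Lim_null_comparison)
      show "\<forall>\<^sub>F z in at_top. norm (z / tan_p_rate p z) \<le> (p - 1) * z powr (1 - p)"
        using eventually_gt_at_top[of 0]
      proof eventually_elim
        case (elim z)
        have "z powr p / (p - 1) \<le> tan_p_rate p z" using elim by (simp add: tan_p_rate_def)
        then have "z / tan_p_rate p z \<le> z / (z powr p / (p - 1))"
          using elim p Qpos[of z] by (intro divide_left_mono) auto
        also have "\<dots> = (p - 1) * z powr (1 - p)" using elim by (simp add: powr_diff)
        finally show ?case using elim Qpos[of z] by simp
      qed
      show "((\<lambda>z. (p - 1) * z powr (1 - p)) \<longlongrightarrow> 0) at_top"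
        by (intro tendsto_mult_right_zero tendsto_neg_powr) (use p in \<open>auto intro: filterlim_ident\<close>)
    qed
    have evS: "\<forall>\<^sub>F x in at_left L. x \<in> ?S"
      using eventually_at_left_real[OF L] .
    have sL: "filterlim s at_top (at_left L)"
      unfolding filterlim_at_top
    proof
      fix Z
      have "(y \<longlongrightarrow> k * (L - L / 2)) (at_left L)" unfolding y_def by (intro tendsto_intros)
      moreover have "k * (L - L / 2) = H" using L by (simp add: k_def)
      ultimately have "\<forall>\<^sub>F x in at_left L. arctan_p p Z < y x"
        using arctan_p_less_quarter_period[OF p1, of Z] by (auto simp: H_def dest: order_tendstoD(1))
      then show "\<forall>\<^sub>F x in at_left L. Z \<le> s x"
        using evS
      proof eventually_elim
        case (elim x)
        then have "arctan_p p Z < arctan_p p (s x)" using \<tau>(1)[OF y[OF elim(2)]] by (simp add: s_def)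
        then show ?case using arctan_p_strict_mono[OF p1, of "s x" Z] by (cases "s x < Z") auto
      qed
    qed
    \<comment> \<open>Since \<open>p > 1\<close>, \<open>s / tan_p_rate p s\<close> decays like \<open>s\<^sup>1\<^sup>-\<^sup>p\<close>.\<close>
    have FL: "(F \<longlongrightarrow> 0) (at_left L)"
      unfolding F_def by (rule filterlim_compose[OF limQ sL])
    have F0: "(F \<longlongrightarrow> 0) (at_right 0)"
    proof (rule Lim_transform_eventually)
      have "((\<lambda>x. L - x) \<longlongrightarrow> L - 0) (at_right 0)" by (intro tendsto_intros)
      then have "filterlim (\<lambda>x. L - x) (at_left L) (at_right 0)"
        by (auto simp: filterlim_at eventually_at_filter)
      from tendsto_minus[OF filterlim_compose[OF FL this]]
      show "((\<lambda>x. - F (L - x)) \<longlongrightarrow> 0) (at_right 0)" by simp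
      show "\<forall>\<^sub>F x in at_right 0. - F (L - x) = F x"
        using eventually_at_right_real[OF L]
        by eventually_elim (simp add: F_def odds)
    qed
    have "(LBINT x=ereal 0..ereal L. ?G x) = 0 - 0"
    proof (rule interval_integral_FTC_integrable[where F = F])
      show "(F has_vector_derivative ?G x) (at x)" if "ereal 0 < ereal x" "ereal x < ereal L" for x
        using dF[of x] that by (simp add: has_real_derivative_iff_has_vector_derivative)
      show "isCont (\<lambda>x. ?G x) x" if "ereal 0 < ereal x" "ereal x < ereal L" for x
        using contG that by (simp add: continuous_on_eq_continuous_at)
      show "set_integrable lborel (einterval (ereal 0) (ereal L)) (\<lambda>x. ?G x)"
        using iG borel_measurable_continuous_on_indicator[OF _ contG]
        by (simp add: set_integrable_def integrable_completion)
      show "((F \<circ> real_of_ereal) \<longlongrightarrow> 0) (at_right (ereal 0))"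
        using F0 by (simp only: ereal_tendsto_simps1)
      show "((F \<circ> real_of_ereal) \<longlongrightarrow> 0) (at_left (ereal L))"
        using FL by (simp only: ereal_tendsto_simps1)
    qed (use L in auto)
    also have "(LBINT x=ereal 0..ereal L. ?G x) = (LBINT x:?S. ?G x)"
      using L by (simp add: interval_lebesgue_integral_le_eq)
    also have "\<dots> = (LINT x:?S|lebesgue. ?G x)"
      unfolding set_lebesgue_integral_def
      by (rule integral_completion[symmetric]) (use borel_measurable_continuous_on_indicator[OF _ contG] in simp)
    also have "\<dots> = k * ((LINT x:?S|lebesgue. 1 / tan_p_rate p (s x)) - D)"
      unfolding D_def by (simp only: set_integral_mult_right set_integral_diff(2)[OF iQ ivp])
    finally have QD: "(LINT x:?S|lebesgue. 1 / tan_p_rate p (s x)) = D" using k by simp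
    show ?thesis by (simp only: v'p set_integral_mult_right QD)
  qed
  have "D > 0"
  proof -
    have "(LINT x:?S|lebesgue. \<bar>v x\<bar> powr p / (p - 1) + \<bar>v' x\<bar> powr p / k powr p) = (LINT x:?S|lebesgue. 1)"
    proof (rule set_lebesgue_integral_cong)
      show "\<forall>x. x \<in> ?S \<longrightarrow> \<bar>v x\<bar> powr p / (p - 1) + \<bar>v' x\<bar> powr p / k powr p = 1"
      proof (intro allI impI)
        fix x
        have "\<bar>v x\<bar> powr p / (p - 1) + \<bar>v' x\<bar> powr p / k powr p = (\<bar>s x\<bar> powr p / (p - 1) + 1) / tan_p_rate p (s x)"
          using k by (simp add: vp v'p add_divide_distrib mult.commute)
        also have "\<bar>s x\<bar> powr p / (p - 1) + 1 = tan_p_rate p (s x)" by (simp add: tan_p_rate_def)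
        also have "tan_p_rate p (s x) / tan_p_rate p (s x) = 1" using Qpos[of "s x"] by simp
        finally show "\<bar>v x\<bar> powr p / (p - 1) + \<bar>v' x\<bar> powr p / k powr p = 1" .
      qed
    qed auto
    also have "\<dots> = L" using L by (simp add: set_lebesgue_integral_def)
    also have "(LINT x:?S|lebesgue. \<bar>v x\<bar> powr p / (p - 1) + \<bar>v' x\<bar> powr p / k powr p) = D / (p - 1) + (LINT x:?S|lebesgue. \<bar>v' x\<bar> powr p) / k powr p"
      unfolding D_def using ivp iv'p by (subst set_integral_add(2)) auto
    finally have DL: "D / (p - 1) + D = L" using k by (simp add: E)
    show ?thesis
    proof (rule ccontr)
      assume "\<not> D > 0"
      then have "D / (p - 1) \<le> 0" using p by (intro divide_nonpos_pos) auto
      then show False using DL L \<open>\<not> D > 0\<close> by linarith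
    qed
  qed
  have adm: "v \<in> admissible p L (\<lambda>_. 1)"
    using W constr \<open>D > 0\<close> by (simp add: admissible_def D_def)
  have "(LINT x:?S|lebesgue. \<bar>weak_deriv_on ?S v x\<bar> powr p) = (LINT x:?S|lebesgue. \<bar>v' x\<bar> powr p)"
  proof -
    have wd': "has_weak_deriv_on ?S v (weak_deriv_on ?S v)"
      unfolding weak_deriv_on_def using wd by (metis someI)
    have ae: "AE x in lebesgue. indicator ?S x *\<^sub>R \<bar>v' x\<bar> powr p = indicator ?S x *\<^sub>R \<bar>weak_deriv_on ?S v x\<bar> powr p"
      using weak_derivative_unique[OF L wd wd'] by eventually_elim (auto simp: indicator_def)
    have m: "(\<lambda>x. indicator ?S x *\<^sub>R \<bar>v' x\<bar> powr p) \<in> borel_measurable lebesgue"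
      using iv'p by (auto simp: set_integrable_def)
    show ?thesis unfolding set_lebesgue_integral_def
      by (rule integral_cong_AE[symmetric, OF m borel_measurable_AE[OF m ae] ae])
  qed
  then have "rayleigh p L (\<lambda>_. 1) v = k powr p"
    unfolding rayleigh_def using E \<open>D > 0\<close> by (simp add: D_def)
  then show ?thesis using adm kpi that by simp
qed

section \<open>The sharp lower bound and the theorem\<close>

text \<open>For \<open>\<kappa> < pi_p / L\<close> the travel time cut off at a sufficiently large \<open>M\<close> still exceeds \<open>\<kappa> L / 2\<close>, so
\<open>\<kappa>\<^sup>p\<close> is a lower bound; then \<open>\<kappa>\<close> tends to \<open>pi_p / L\<close>.\<close>

lemma rayleigh_ge_pi_p:
  fixes L p :: real and f :: "real \<Rightarrow> real"
  assumes L: "L > 0" and p: "p > 1"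
    and nn: "\<And>x. x \<in> {0..L} \<Longrightarrow> f x \<ge> 0" and lc: "log_concave_on {0..L} f"
    and u: "u \<in> admissible p L f"
  shows "(pi_p p / L) powr p \<le> rayleigh p L f u"
proof -
  have pp: "pi_p p / L > 0"
    using arctan_p_less_quarter_period[OF p, of 0] L by (simp add: pi_p_eq_quarter_period[OF p])
  have bound: "\<kappa> powr p \<le> rayleigh p L f u" if \<kappa>: "0 < \<kappa>" "\<kappa> < pi_p p / L" for \<kappa>
  proof -
    have "\<kappa> * L / 2 < quarter_period p"
      using \<kappa> L by (simp add: pi_p_eq_quarter_period[OF p] field_simps)
    then have "\<forall>\<^sub>F M in at_top. \<kappa> * L / 2 < arctan_p p M"
      by (rule order_tendstoD(1)[OF arctan_p_tendsto[OF p]])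
    then have "\<forall>\<^sub>F M in at_top. \<kappa> * L / 2 < arctan_p p M \<and> M \<ge> 1"
      using eventually_ge_at_top[of 1] by eventually_elim auto
    then obtain M where "M \<ge> 1" "\<kappa> * L / 2 < arctan_p p M"
      using eventually_happens'[OF trivial_limit_at_top_linorder] by blast
    then show ?thesis
      by (intro rayleigh_lower_bound[OF L p \<kappa>(1) _ _ nn lc u, of M]) (auto simp: half_length_eq_arctan_p[OF p])
  qed
  show ?thesis
  proof (rule tendsto_upperbound)
    show "((\<lambda>\<kappa>. \<kappa> powr p) \<longlongrightarrow> (pi_p p / L) powr p) (at_left (pi_p p / L))"
      using pp by (intro tendsto_intros) auto
    show "\<forall>\<^sub>F \<kappa> in at_left (pi_p p / L). \<kappa> powr p \<le> rayleigh p L f u"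
      using eventually_at_left_real[OF pp] by eventually_elim (use bound in auto)
  qed simp
qed

theorem proposition1p1:
  fixes L p :: real and f :: "real \<Rightarrow> real"
  assumes "L > 0"
    and "\<And>x. x \<in> {0..L} \<Longrightarrow> f x \<ge> 0"
    and "log_concave_on {0..L} f"
    and "p \<ge> 2"
  shows "\<exists>v. is_arg_min (rayleigh p L (\<lambda>_. 1)) (\<lambda>u. u \<in> admissible p L (\<lambda>_. 1)) v \<and>
             (INF u\<in>admissible p L f. ereal (rayleigh p L f u))
               \<ge> ereal (rayleigh p L (\<lambda>_. 1) v) \<and>
             rayleigh p L (\<lambda>_. 1) v = (pi_p p / L) powr p"
proof -
  have p: "p > 1" using assms(4) by simp
  obtain v where v: "v \<in> admissible p L (\<lambda>_. 1)" "rayleigh p L (\<lambda>_. 1) v = (pi_p p / L) powr p"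
    using extremal_function[OF assms(1,4)] .
  have one: "log_concave_on {0..L} (\<lambda>_. 1)" by (simp add: log_concave_on_def)
  have "is_arg_min (rayleigh p L (\<lambda>_. 1)) (\<lambda>u. u \<in> admissible p L (\<lambda>_. 1)) v"
    unfolding is_arg_min_def
  proof (intro conjI notI v(1))
    assume "\<exists>u. u \<in> admissible p L (\<lambda>_. 1) \<and> rayleigh p L (\<lambda>_. 1) u < rayleigh p L (\<lambda>_. 1) v"
    then obtain u where "u \<in> admissible p L (\<lambda>_. 1)" "rayleigh p L (\<lambda>_. 1) u < rayleigh p L (\<lambda>_. 1) v" by blast
    then show False using rayleigh_ge_pi_p[OF assms(1) p _ one, of u] v(2) by simp
  qed
  moreover have "(INF u\<in>admissible p L f. ereal (rayleigh p L f u)) \<ge> ereal (rayleigh p L (\<lambda>_. 1) v)"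
    unfolding v(2) by (intro INF_greatest) (use rayleigh_ge_pi_p[OF assms(1) p assms(2,3)] in auto)
  ultimately show ?thesis using v(2) by blast
qed

end
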